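(* For any fixed number $t$ of types and fixed type weights $w_1,\dots,w_t$ (positive integers), the minimum cost shipment problem is solvable in time which is polynomial in the number $v$ of vessels and in the bit size of the integer numbers $n_j$ of items of each type to be shipped ($j=1,\dots,t$), vessel capacities $u_k$ ($k=1,\dots,v$), and shipment costs $p_{j,k}$ ($j=1,\dots,t$, $k=1,\dots,v$).
   Context: The minimum cost shipment problem: there are $t$ types of items; each item of type $j$ has weight $w_j$, and there are $n_j$ items of type $j$ to be shipped ($n_j$ a nonnegative integer). There are $v$ available vessels, where vessel $k$ has maximum weight capacity $u_k$ (a nonnegative integer). The cost of shipping one item of type $j$ on vessel $k$ is the integer $p_{j,k}$. The task is to ship all items on the vessels, respecting the weight capacities, at minimum total cost. That is, with $x^k_j$ the number of items of type $j$ shipped on vessel $k$, minimize $\sum_{j=1}^t\sum_{k=1}^v p_{j,k}x^k_j$ subject to $\sum_{k=1}^v x^k_j=n_j$ for $j=1,\dots,t$, $\sum_{j=1}^t w_jx^k_j\le u_k$ for $k=1,\dots,v$, and all $x^k_j$ nonnegative integers. Solving means either returning an optimal solution or correctly asserting that no feasible solution exists. The numbers $t,w_1,\dots,w_t$ are fixed and not part of the input; the other integers are encoded in binary, and $v$ is counted by its value. *)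

theory Defs
  imports
    Complex_Main
    "HOL-Library.Log_Nat"
    "HOL-Computational_Algebra.Polynomial"
begin

section \<open>Computation model: a structured random access machine with logarithmic cost\<close>

text \<open>
  A program works on integer registers and on an indirectly addressed integer memory. As in the
  logarithmic-cost criterion of Aho, Hopcroft and Ullman, every operation is charged the bit lengths
  of the numbers it handles, addresses and results included. The jumps of the textbook machine are
  replaced by structured control. Running times are thus polynomially related to those of
  Turing machines. Programs are a datatype, so a single program is a finite object and mentions
  only finitely many registers.
\<close>

datatype expr =
    Const int
  | Reg nat
  | Mem expr
  | Add expr expr
  | Sub expr expr
  | Mul expr expr
  | Div expr expr

text \<open>The guard of \<open>IfPos\<close> and \<open>WhilePos\<close> holds when the expression has a positive value.\<close>

datatype prog =
    Skip
  | Assign nat expr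
  | Store expr expr
  | Seq prog prog
  | IfPos expr prog prog
  | WhilePos expr prog

type_synonym state = "(nat \<Rightarrow> int) \<times> (int \<Rightarrow> int)"

text \<open>Bit length of an integer: one sign bit plus the binary digits of the absolute value.\<close>

definition int_bits :: "int \<Rightarrow> nat" where
  "int_bits z = 1 + nat (bitlen \<bar>z\<bar>)"

text \<open>\<open>Div\<close> is the library division: it rounds down, and dividing by \<open>0\<close> gives \<open>0\<close>.\<close>

fun val :: "state \<Rightarrow> expr \<Rightarrow> int" where
  "val s (Const z) = z"
| "val s (Reg r) = fst s r"
| "val s (Mem a) = snd s (val s a)"
| "val s (Add a b) = val s a + val s b"
| "val s (Sub a b) = val s a - val s b"
| "val s (Mul a b) = val s a * val s b"
| "val s (Div a b) = val s a div val s b"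

text \<open>
  The bit lengths of the operands of an operation, and of the address in a memory access, are
  accounted for by the cost of the corresponding subexpressions.
\<close>

fun eval_cost :: "state \<Rightarrow> expr \<Rightarrow> nat" where
  "eval_cost s (Const z) = int_bits z"
| "eval_cost s (Reg r) = int_bits (int r) + int_bits (fst s r)"
| "eval_cost s (Mem a) = eval_cost s a + int_bits (val s (Mem a))"
| "eval_cost s (Add a b) = eval_cost s a + eval_cost s b + int_bits (val s (Add a b))"
| "eval_cost s (Sub a b) = eval_cost s a + eval_cost s b + int_bits (val s (Sub a b))"
| "eval_cost s (Mul a b) = eval_cost s a + eval_cost s b + int_bits (val s (Mul a b))"
| "eval_cost s (Div a b) = eval_cost s a + eval_cost s b + int_bits (val s (Div a b))"

text \<open>\<open>exec c s T s'\<close>: started in state \<open>s\<close>, program \<open>c\<close> halts after time \<open>T\<close> in state \<open>s'\<close>.\<close>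

inductive exec :: "prog \<Rightarrow> state \<Rightarrow> nat \<Rightarrow> state \<Rightarrow> bool" where
  Skip: "exec Skip s 1 s"
| Assign: "exec (Assign r e) s (1 + int_bits (int r) + eval_cost s e) ((fst s)(r := val s e), snd s)"
| Store: "exec (Store a e) s (1 + eval_cost s a + eval_cost s e) (fst s, (snd s)(val s a := val s e))"
| Seq: "exec c s T s' \<Longrightarrow> exec d s' T' s'' \<Longrightarrow> exec (Seq c d) s (T + T') s''"
| IfTrue: "0 < val s e \<Longrightarrow> exec c s T s' \<Longrightarrow> exec (IfPos e c d) s (1 + eval_cost s e + T) s'"
| IfFalse: "\<not> 0 < val s e \<Longrightarrow> exec d s T s' \<Longrightarrow> exec (IfPos e c d) s (1 + eval_cost s e + T) s'"
| WhileFalse: "\<not> 0 < val s e \<Longrightarrow> exec (WhilePos e c) s (1 + eval_cost s e) s"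
| WhileTrue: "0 < val s e \<Longrightarrow> exec c s T s' \<Longrightarrow> exec (WhilePos e c) s' T' s'' \<Longrightarrow>
    exec (WhilePos e c) s (1 + eval_cost s e + T + T') s''"

lemma exec_deterministic:
  "exec c s T s' \<Longrightarrow> exec c s U u \<Longrightarrow> U = T \<and> u = s'"
proof (induction arbitrary: U u rule: exec.induct)
  case (Skip s)
  then show ?case by cases auto
next
  case (Assign r e s)
  then show ?case by cases auto
next
  case (Store a e s)
  then show ?case by cases auto
next
  case (Seq c s T s' d T' s'')
  from Seq.prems show ?case
  proof cases
    case step: (Seq V r V')
    then show ?thesis using Seq.IH(1)[of V r] Seq.IH(2)[of V' u] by simp
  qed
next
  case (IfTrue s e c T s' d)
  from IfTrue.prems show ?case
  proof cases
    case step: (IfTrue V)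
    then show ?thesis using IfTrue.IH[of V u] by simp
  qed (simp add: IfTrue.hyps)
next
  case (IfFalse s e d T s' c)
  from IfFalse.prems show ?case
  proof cases
    case step: (IfFalse V)
    then show ?thesis using IfFalse.IH[of V u] by simp
  qed (use IfFalse.hyps in simp)
next
  case (WhileFalse s e c)
  from WhileFalse.prems show ?case
    by cases (use WhileFalse.hyps in simp_all)
next
  case (WhileTrue s e c T s' T' s'')
  from WhileTrue.prems show ?case
  proof cases
    case step: (WhileTrue V r V')
    then show ?thesis using WhileTrue.IH(1)[of V r] WhileTrue.IH(2)[of V' u] by simp
  qed (simp add: WhileTrue.hyps)
qed

text \<open>The input is placed in the memory cells \<open>0, 1, 2, \<dots>\<close>; all other cells and all registers are \<open>0\<close>.\<close>

definition init_state :: "int list \<Rightarrow> state" where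
  "init_state xs = ((\<lambda>r. 0), (\<lambda>i. if 0 \<le> i \<and> i < int (length xs) then xs ! nat i else 0))"

text \<open>The output is read off the memory cells \<open>0, 1, 2, \<dots>\<close>; what follows it is ignored.\<close>

definition has_output :: "state \<Rightarrow> int list \<Rightarrow> bool" where
  "has_output s ys \<longleftrightarrow> (\<forall>i<length ys. snd s (int i) = ys ! i)"

text \<open>
  A problem is given by an input encoding, the size measure for the inputs, and the relation of
  correct answers. One program has to solve all instances, in time bounded by one polynomial.
\<close>

definition poly_time_solvable ::
    "('a \<Rightarrow> int list) \<Rightarrow> ('a \<Rightarrow> nat) \<Rightarrow> ('a \<Rightarrow> int list \<Rightarrow> bool) \<Rightarrow> bool" where
  "poly_time_solvable enc sz answer \<longleftrightarrow>
     (\<exists>(c :: prog) (q :: nat poly). \<forall>I. \<exists>T s ys.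
        exec c (init_state (enc I)) T s \<and> T \<le> poly q (sz I) \<and> has_output s ys \<and> answer I ys)"


section \<open>The minimum cost shipment problem\<close>

text \<open>
  Types are indexed by \<open>j < t\<close> and vessels by \<open>k < vessels I\<close>; values of the functions outside these
  ranges play no role.
\<close>

record shipment =
  vessels :: nat
  items :: "nat \<Rightarrow> nat"
  capacity :: "nat \<Rightarrow> nat"
  price :: "nat \<Rightarrow> nat \<Rightarrow> int"

text \<open>In a plan \<open>x\<close>, the number of items of type \<open>j\<close> shipped on vessel \<open>k\<close> is \<open>x j k\<close>.\<close>

definition feasible :: "nat \<Rightarrow> (nat \<Rightarrow> nat) \<Rightarrow> shipment \<Rightarrow> (nat \<Rightarrow> nat \<Rightarrow> nat) \<Rightarrow> bool" where
  "feasible t w I x \<longleftrightarrow>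
     (\<forall>j<t. (\<Sum>k<vessels I. x j k) = items I j) \<and>
     (\<forall>k<vessels I. (\<Sum>j<t. w j * x j k) \<le> capacity I k)"

definition total_cost :: "nat \<Rightarrow> shipment \<Rightarrow> (nat \<Rightarrow> nat \<Rightarrow> nat) \<Rightarrow> int" where
  "total_cost t I x = (\<Sum>j<t. \<Sum>k<vessels I. price I j k * int (x j k))"

definition optimal :: "nat \<Rightarrow> (nat \<Rightarrow> nat) \<Rightarrow> shipment \<Rightarrow> (nat \<Rightarrow> nat \<Rightarrow> nat) \<Rightarrow> bool" where
  "optimal t w I x \<longleftrightarrow>
     feasible t w I x \<and> (\<forall>y. feasible t w I y \<longrightarrow> total_cost t I x \<le> total_cost t I y)"

definition table :: "nat \<Rightarrow> nat \<Rightarrow> (nat \<Rightarrow> nat \<Rightarrow> int) \<Rightarrow> int list" where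
  "table t v f = concat (map (\<lambda>j. map (f j) [0..<v]) [0..<t])"

definition shipment_data :: "nat \<Rightarrow> shipment \<Rightarrow> int list" where
  "shipment_data t I =
     map (\<lambda>j. int (items I j)) [0..<t] @ map (\<lambda>k. int (capacity I k)) [0..<vessels I] @
     table t (vessels I) (price I)"

definition shipment_input :: "nat \<Rightarrow> shipment \<Rightarrow> int list" where
  "shipment_input t I = int (vessels I) # shipment_data t I"

text \<open>The number of vessels counts by its value, all other integers by their bit length.\<close>

definition shipment_size :: "nat \<Rightarrow> shipment \<Rightarrow> nat" where
  "shipment_size t I = vessels I + sum_list (map int_bits (shipment_data t I))"

text \<open>The answer is \<open>1\<close> followed by an optimal plan, or \<open>0\<close> if there is no feasible plan.\<close>

definition shipment_answer :: "nat \<Rightarrow> (nat \<Rightarrow> nat) \<Rightarrow> shipment \<Rightarrow> int list \<Rightarrow> bool" where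
  "shipment_answer t w I ys \<longleftrightarrow>
     (\<exists>x. optimal t w I x \<and> ys = 1 # table t (vessels I) (\<lambda>j k. int (x j k))) \<or>
     ((\<nexists>x. feasible t w I x) \<and> ys = [0])"

end

theory Submission
  imports Defs
begin

text \<open>
  The algorithm works by scaling. At scale \<open>D = 2 ^ e\<close> the numbers of items and the capacities are
  divided by \<open>D\<close>; an optimal plan \<open>z\<close> at scale \<open>2 * D\<close> is turned into one at scale \<open>D\<close> because some
  optimal plan \<open>x\<close> at scale \<open>D\<close> has all entries within \<open>P\<close> of \<open>2 * z\<close>, where \<open>P\<close> is polynomial in
  the number of vessels. To see this, add the slack of each vessel as a further type of weight \<open>1\<close>.
  The row and column sums of \<open>x - 2 * z\<close> are small, so a huge entry forces a huge entry of opposite sign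
  in its column, which forces one of opposite sign in its row, and so on. As there are boundedly
  many types, these entries close up to cycles, along which \<open>(\<Prod>i. w i) div w j\<close> items of each type \<open>j\<close>
  can be moved in \<open>x\<close> backwards and in \<open>z\<close> forwards. By optimality of both, this changes no cost,
  and it brings \<open>x\<close> closer to \<open>2 * z\<close>. A plan within distance \<open>P\<close> of \<open>2 * z\<close> is found by dynamic programming over
  the vessels, whose state is the vector of partial row sums of the deviations, of which there are
  polynomially many for a fixed number of types.
\<close>

section \<open>Small kernel elements below a matrix with small row and column sums\<close>

text \<open>Row sums of plans can be exponential in the input size, so dynamic programming on them
  directly is only pseudopolynomial; the row sums of deviations between two scales are polynomial in
  the number of vessels. Rounding must neither lose feasibility nor move the optimum far. The former
  is bought by a capacity surplus, absent at scale \<open>1\<close>; thus infeasibility at any scale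
  is infeasibility of the instance itself. For the latter, \<open>x\<close> and \<open>z\<close>
  belong to instances with different data, and only the smallness of the row and column sums of
  \<open>x - 2 * z\<close> is available. As \<open>x\<close> and \<open>z\<close> move in opposite
  directions and both must stay nonnegative, the exchange may use at most half of each deviation.
  Every round of forcing large entries costs a factor of the order of the number of vessels, so the
  number of rounds must be a function of the number of types alone; therefore the pigeonhole
  argument is about sets of rows and not about entries. The start is a scale above the total number
  of items, where the zero plan is optimal; its exponent is linear in the bit size, and so is the
  number of refinements.\<close>

lemma bij_on_invariant_subset:
  assumes "finite A" "A \<noteq> {}" "f ` A \<subseteq> A"
  obtains X where "X \<subseteq> A" "X \<noteq> {}" "bij_betw f X X"
proof -
  define P where "P X \<longleftrightarrow> X \<subseteq> A \<and> X \<noteq> {} \<and> f ` X \<subseteq> X" for X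
  define X where "X = arg_min card P"
  have "P A" using assms by (simp add: P_def)
  then have PX: "P X" and min: "\<And>Y. P Y \<Longrightarrow> card X \<le> card Y"
    unfolding X_def by (auto intro: arg_min_natI arg_min_nat_le)
  then have X: "X \<subseteq> A" "X \<noteq> {}" "f ` X \<subseteq> X" by (auto simp: P_def)
  have fin: "finite X" using X assms finite_subset by blast
  \<comment> \<open>The image of an invariant set is again invariant and nonempty, so minimality of
    \<open>card X\<close> forbids it to be smaller: \<open>f\<close> is onto the finite set
    \<open>X\<close>, hence injective on it.\<close>
  have "card X \<le> card (f ` X)" using X by (intro min) (auto simp: P_def)
  then have "f ` X = X" using X fin card_seteq by blast
  then show thesis using that X fin
    by (simp add: bij_betw_def eq_card_imp_inj_on)
qed

text \<open>Pigeonhole: if the first \<open>n\<close> inclusions were all strict, each would cost an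
  element, and \<open>A n\<close> would be empty.\<close>

lemma decseq_card_stationary:
  assumes fin: "finite (A 0)" and card: "card (A (0::nat)) \<le> n"
    and dec: "\<And>i. A (Suc i) \<subseteq> A i" and ne: "\<And>i. i \<le> n \<Longrightarrow> A i \<noteq> {}"
  shows "\<exists>i<n. A (Suc i) = A i"
proof (rule ccontr)
  assume "\<not> ?thesis"
  then have neq: "A (Suc i) \<subset> A i" if "i < n" for i using that dec[of i] by blast
  have f: "finite (A i)" for i by (induction i) (use fin dec in \<open>auto intro: finite_subset\<close>)
  have "card (A i) + i \<le> n" if "i \<le> n" for i using that
  proof (induction i)
    case (Suc i)
    then show ?case using psubset_card_mono[OF f neq[of i]] by simp
  qed (use card in simp)
  from this[of n] have "A n = {}" using f by simp
  then show False using ne by simp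
qed

text \<open>An entry that large has to be compensated: if all entries exceeded \<open>- b\<close>,
  the others could lower the weighted sum by at most \<open>b\<close> times the total weight,
  leaving at least \<open>c + 1\<close>. The next lemma is the same argument with reversed signs for
  the unweighted rows.\<close>

lemma negative_entry:
  fixes d :: "nat \<Rightarrow> int" and w :: "nat \<Rightarrow> nat"
  assumes j: "j < n" "0 < w j" and sum: "(\<Sum>i<n. int (w i) * d i) \<le> c"
    and big: "c + 1 + int (\<Sum>i<n. w i) * b \<le> d j" and b: "0 \<le> b" "0 \<le> c"
  shows "\<exists>i<n. d i \<le> - b"
proof (rule ccontr)
  assume "\<not> ?thesis"
  then have gt: "d i > - b" if "i < n" for i using that by (meson not_less)
  have "d j \<ge> 0" using big b by (smt (verit) mult_nonneg_nonneg of_nat_0_le_iff)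
  then have "d j \<le> int (w j) * d j" using j mult_right_mono[of 1 "int (w j)" "d j"] by simp
  moreover have "(\<Sum>i\<in>{..<n}-{j}. int (w i) * d i) \<ge> (\<Sum>i\<in>{..<n}-{j}. int (w i) * (- b))"
    using gt by (intro sum_mono mult_left_mono) (auto simp: less_imp_le)
  moreover have "(\<Sum>i\<in>{..<n}-{j}. int (w i) * b) \<le> (\<Sum>i<n. int (w i) * b)"
    using b by (intro sum_mono2) auto
  moreover have "(\<Sum>i<n. int (w i) * d i) = int (w j) * d j + (\<Sum>i\<in>{..<n}-{j}. int (w i) * d i)"
    using j by (simp add: sum.remove)
  ultimately show False using sum big by (simp add: sum_negf sum_distrib_right)
qed

lemma positive_entry:
  fixes d :: "nat \<Rightarrow> int"
  assumes k: "k < v" and sum: "- c \<le> (\<Sum>i<v. d i)"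
    and big: "d k \<le> - (c + 1 + int v * b)" and b: "0 \<le> b"
  shows "\<exists>i<v. b \<le> d i"
proof (rule ccontr)
  assume "\<not> ?thesis"
  then have "d i \<le> b" if "i < v" for i using that by force
  then have "(\<Sum>i\<in>{..<v}-{k}. d i) \<le> (\<Sum>i\<in>{..<v}-{k}. b)" by (intro sum_mono) auto
  also have "\<dots> \<le> int v * b" using b k by (simp add: mult_right_mono)
  finally have "(\<Sum>i<v. d i) \<le> d k + int v * b" using k by (simp add: sum.remove)
  then show False using sum big by simp
qed

text \<open>A forcing chain read backwards. A positive entry of level \<open>Suc i\<close> forces in
  its column, of total weight \<open>W\<close>, a negative entry of size
  \<open>c + 1 + v * threshold a W c v i\<close>, and this forces in its row, of length
  \<open>v\<close>, a positive entry of level \<open>i\<close>. Each level costs a factor of order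
  \<open>v\<close>, so the result is polynomial in \<open>v\<close> for a fixed number of
  levels.\<close>

fun threshold :: "int \<Rightarrow> int \<Rightarrow> int \<Rightarrow> int \<Rightarrow> nat \<Rightarrow> int" where
  "threshold a W c v 0 = a"
| "threshold a W c v (Suc i) = c + 1 + W * (c + 1 + v * threshold a W c v i)"

lemma threshold_mono:
  assumes "0 \<le> a" "1 \<le> W" "0 \<le> c" "1 \<le> v"
  shows "threshold a W c v i \<le> threshold a W c v (Suc i) \<and> a \<le> threshold a W c v i"
proof -
  have *: "y \<le> c + 1 + W * (c + 1 + v * y)" if "0 \<le> y" for y
  proof -
    have "y \<le> v * y" using that assms mult_right_mono[of 1 v y] by simp
    then have "1 * y \<le> W * (c + 1 + v * y)" using that assms by (intro mult_mono) auto
    then show ?thesis using assms by simp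
  qed
  show ?thesis by (induction i) (use assms * in \<open>auto intro: order_trans\<close>)
qed

text \<open>\<open>T\<close> levels feed the pigeonhole on the sets of rows with a large positive
  entry; the additional one turns a large entry of either sign into a positive one.\<close>

lemma small_kernel_element:
  fixes d :: "nat \<Rightarrow> nat \<Rightarrow> int" and w :: "nat \<Rightarrow> nat" and T v :: nat
  defines "L \<equiv> \<Prod>j<T. w j"
  assumes w: "\<And>j. j < T \<Longrightarrow> 0 < w j"
    and c: "0 \<le> c"
    and row: "\<And>j. j < T \<Longrightarrow> \<bar>\<Sum>k<v. d j k\<bar> \<le> c"
    and col: "\<And>k. k < v \<Longrightarrow> \<bar>\<Sum>j<T. int (w j) * d j k\<bar> \<le> c"
    and big: "j0 < T" "k0 < v"
      "threshold (2 * int L) (int (\<Sum>j<T. w j)) c (int v) (Suc T) \<le> \<bar>d j0 k0\<bar>"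
  obtains h where
    "\<And>j. j < T \<Longrightarrow> (\<Sum>k<v. h j k) = 0"
    "\<And>k. k < v \<Longrightarrow> (\<Sum>j<T. int (w j) * h j k) = 0"
    "\<exists>j<T. \<exists>k<v. h j k \<noteq> 0"
    "\<And>j k. j < T \<Longrightarrow> k < v \<Longrightarrow>
       h j k = 0 \<or> (0 < h j k \<and> 2 * h j k \<le> d j k) \<or> (h j k < 0 \<and> d j k \<le> 2 * h j k)"
proof -
  define W where "W = int (\<Sum>j<T. w j)"
  define \<theta> where "\<theta> = threshold (2 * int L) W c (int v)"
  have "w j0 \<le> (\<Sum>j<T. w j)" using big by (intro member_le_sum) auto
  then have "1 \<le> (\<Sum>j<T. w j)" using w[of j0] big by simp
  then have W: "1 \<le> W" by (simp only: W_def)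
  have v: "1 \<le> int v" using big by simp
  have L: "0 < L" using w by (auto simp: L_def)
  have \<theta>: "\<theta> i \<le> \<theta> (Suc i)" "2 * int L \<le> \<theta> i" for i
    using threshold_mono[of "2 * int L" W c "int v" i] W c v by (auto simp: \<theta>_def)
  have \<theta>0: "0 \<le> \<theta> i" for i using \<theta>(2)[of i] by linarith
  define A where "A i = {j. j < T \<and> (\<exists>k<v. \<theta> i \<le> d j k)}" for i
  have \<theta>_Suc: "\<theta> (Suc i) = c + 1 + W * (c + 1 + int v * \<theta> i)" for i by (simp add: \<theta>_def)
  \<comment> \<open>Column \<open>k\<close> contains a large negative entry, in a row
    \<open>j'\<close>; the bounded sum of that row forces a positive entry there. So
    \<open>j'\<close> is again a row with a positive entry of level \<open>i\<close>, and the walk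
    can go on.\<close>
  have step: "\<exists>j'\<in>A i. \<exists>k<v. \<theta> i \<le> d j k \<and> d j' k \<le> - \<theta> i" if j: "j \<in> A (Suc i)" for i j
  proof -
    obtain k where k: "j < T" "k < v" "\<theta> (Suc i) \<le> d j k" using j by (auto simp: A_def)
    obtain j' where j': "j' < T" "d j' k \<le> - (c + 1 + int v * \<theta> i)"
      using negative_entry[of j T w "\<lambda>j. d j k" c "c + 1 + int v * \<theta> i"] k w col[of k, THEN abs_le_D1] c \<theta>0[of i]
      by (auto simp: \<theta>_Suc W_def)
    have "- c \<le> (\<Sum>k<v. d j' k)" using row[of j'] j' by (simp add: abs_le_iff)
    then obtain k' where "k' < v" "\<theta> i \<le> d j' k'"
      using positive_entry[of k v c "d j'" "\<theta> i"] k j' \<theta>0[of i] by auto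
    moreover have "\<theta> i \<le> int v * \<theta> i" using v \<theta>0[of i] mult_right_mono[of 1 "int v" "\<theta> i"] by simp
    ultimately show ?thesis using k j' \<theta>(1)[of i] c by (intro bexI[of _ j'] exI[of _ k]) (auto simp: A_def)
  qed
  have AT: "A T \<noteq> {}"
  proof (cases "0 \<le> d j0 k0")
    case True
    then show ?thesis using big \<theta>(1)[of T] by (force simp: A_def \<theta>_def W_def)
  next
    case False
    have "1 * (c + 1 + int v * \<theta> T) \<le> W * (c + 1 + int v * \<theta> T)"
      using W c v \<theta>0[of T] by (intro mult_right_mono) auto
    then have "d j0 k0 \<le> - (c + 1 + int v * \<theta> T)"
      using False big c \<theta>_Suc[of T] by (auto simp: \<theta>_def W_def)
    moreover have "- c \<le> (\<Sum>k<v. d j0 k)" using row[of j0] big by (simp add: abs_le_iff)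
    ultimately show ?thesis using positive_entry[of k0 v c "d j0" "\<theta> T"] big \<theta>0[of T] by (auto simp: A_def)
  qed
  have dec: "A (Suc i) \<subseteq> A i" for i using \<theta>(1)[of i] by (auto simp: A_def intro: order_trans)
  have ne: "A i \<noteq> {}" if "i \<le> T" for i
    using lift_Suc_antimono_le[of A, OF dec that] AT by auto
  \<comment> \<open>A chain of \<open>T + 1\<close> nonempty subsets of \<open>{..<T}\<close> has two equal consecutive members.\<close>
  have A0: "finite (A 0)" "card (A 0) \<le> T"
    using card_mono[of "{..<T}" "A 0"] by (auto simp: A_def)
  obtain i where i: "A (Suc i) = A i" "i < T" using decseq_card_stationary[OF A0 dec ne] by auto
  \<comment> \<open>At a stationary level the walk never leaves \<open>A i\<close>, so choosing
    successors gives a self-map \<open>\<sigma>\<close> of a finite set of rows.\<close>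
  then have "\<forall>j\<in>A i. \<exists>j'\<in>A i. \<exists>k<v. \<theta> i \<le> d j k \<and> d j' k \<le> - \<theta> i" using step by simp
  then obtain \<sigma> out where \<sigma>: "\<And>j. j \<in> A i \<Longrightarrow> \<sigma> j \<in> A i \<and> out j < v \<and> \<theta> i \<le> d j (out j) \<and> d (\<sigma> j) (out j) \<le> - \<theta> i"
    by metis
  have "finite (A i)" "\<sigma> ` A i \<subseteq> A i" using \<sigma> by (auto simp: A_def[of i])
  then obtain X where X: "X \<subseteq> A i" "X \<noteq> {}" "bij_betw \<sigma> X X"
    using bij_on_invariant_subset[of "A i" \<sigma>] ne[of i] i by (metis less_imp_le)
  \<comment> \<open>The permutation \<open>\<sigma>\<close> of \<open>X\<close> splits into cycles:
    row \<open>j\<close> is left through its positive entry in column \<open>out j\<close> and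
    entered through its negative one in column \<open>inn j\<close>, where
    \<open>inn (\<sigma> j) = out j\<close>.\<close>
  define inn where "inn j = out (inv_into X \<sigma> j)" for j
  have XT: "X \<subseteq> {..<T}" using X by (auto simp: A_def)
  have innX: "inn j < v" "d j (inn j) \<le> - \<theta> i" if "j \<in> X" for j
    using that X \<sigma>[of "inv_into X \<sigma> j"] bij_betw_inv_into_right[OF X(3) that]
      bij_betwE[OF bij_betw_inv_into[OF X(3)]] by (auto simp: inn_def)
  have outX: "out j < v" "\<theta> i \<le> d j (out j)" if "j \<in> X" for j using \<sigma> X that by auto
  \<comment> \<open>\<open>h\<close> is bounded by half of \<open>\<theta> i\<close> and has the sign pattern of \<open>d\<close> on its support.\<close>
  define h where "h j k = (if j \<in> X then int (L div w j) * (of_bool (k = out j) - of_bool (k = inn j)) else 0)" for j k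
  \<comment> \<open>\<open>L div w j\<close> items of any type \<open>j\<close> weigh exactly
    \<open>L\<close>, so trading them between the rows of a column preserves its weighted
    sum.\<close>
  have wL: "w j * (L div w j) = L" if "j < T" for j
    using that by (intro dvd_mult_div_cancel) (auto simp: L_def intro: dvd_prodI)
  have LL: "0 < L div w j" "L div w j \<le> L" if "j < T" for j using wL[OF that] L
    by (auto intro: Nat.gr0I)
  show thesis
  proof (rule that[of h])
    fix j assume "j < T"
    show "(\<Sum>k<v. h j k) = 0"
      using innX outX by (cases "j \<in> X") (auto simp: h_def sum_subtractf simp flip: sum_distrib_left)
  next
    fix k assume "k < v"
    have "(\<Sum>j<T. int (w j) * h j k) = (\<Sum>j\<in>X. int (w j) * h j k)"
      using XT by (intro sum.mono_neutral_right) (auto simp: h_def)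
    also have "\<dots> = (\<Sum>j\<in>X. int L * of_bool (k = out j) - int L * of_bool (k = inn j))"
    proof (intro sum.cong refl)
      fix j assume j: "j \<in> X"
      then have "int (w j) * int (L div w j) = int L" using wL[of j] XT by (metis lessThan_iff of_nat_mult subsetD)
      then have "int (w j) * (int (L div w j) * b) = int L * b" for b by (metis mult.assoc)
      from this[of "of_bool (k = out j) - of_bool (k = inn j)"] show "int (w j) * h j k = int L * of_bool (k = out j) - int L * of_bool (k = inn j)"
        using j unfolding h_def by (simp only: if_True right_diff_distrib)
    qed
    also have "\<dots> = (\<Sum>j\<in>X. int L * of_bool (k = out j)) - (\<Sum>j\<in>X. int L * of_bool (k = inn j))"
      by (simp add: sum_subtractf)
    \<comment> \<open>The column through which row \<open>j\<close> is left is the one through which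
      row \<open>\<sigma> j\<close> is entered, so gains and losses cancel after reindexing by
      \<open>\<sigma>\<close>.\<close>
    also have "(\<Sum>j\<in>X. int L * of_bool (k = inn j)) = (\<Sum>j\<in>X. int L * of_bool (k = inn (\<sigma> j)))"
      by (rule sum.reindex_bij_betw[OF X(3), symmetric])
    also have "\<dots> = (\<Sum>j\<in>X. int L * of_bool (k = out j))"
      using X(3) by (intro sum.cong refl) (auto simp: inn_def bij_betw_def)
    finally show "(\<Sum>j<T. int (w j) * h j k) = 0" by simp
  next
    obtain j where j: "j \<in> X" using X by auto
    have "out j \<noteq> inn j" using innX(2)[OF j] outX(2)[OF j] \<theta>(2)[of i] L by auto
    then show "\<exists>j<T. \<exists>k<v. h j k \<noteq> 0"
      using j XT outX(1)[OF j] LL(1)[of j] by (intro exI[of _ j] conjI exI[of _ "out j"]) (auto simp: h_def)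
  next
    fix j k assume jk: "j < T" "k < v"
    have "int (L div w j) \<le> int L" using LL(2)[OF jk(1)] by (simp only: of_nat_le_iff)
    then have small: "2 * int (L div w j) \<le> \<theta> i" using \<theta>(2)[of i] by linarith
    consider "h j k = 0" | "j \<in> X" "k = out j" "h j k = int (L div w j)"
      | "j \<in> X" "k = inn j" "h j k = - int (L div w j)"
      unfolding h_def by (cases "j \<in> X"; cases "k = out j"; cases "k = inn j") auto
    then show "h j k = 0 \<or> (0 < h j k \<and> 2 * h j k \<le> d j k) \<or> (h j k < 0 \<and> d j k \<le> 2 * h j k)"
      using innX(2)[of j] outX(2)[of j] small LL(1)[OF jk(1)] by cases auto
  qed
qed

section \<open>Proximity of optimal plans at consecutive scales\<close>

text \<open>The surplus \<open>\<Sum>j<t. w j\<close> makes room for rounding up, so that feasibility is inherited by all scales.\<close>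

definition coarse :: "nat \<Rightarrow> (nat \<Rightarrow> nat) \<Rightarrow> nat \<Rightarrow> shipment \<Rightarrow> shipment" where
  "coarse t w D I = I\<lparr>items := (\<lambda>j. items I j div D),
     capacity := (\<lambda>k. if D = 1 then capacity I k else capacity I k div D + (\<Sum>j<t. w j))\<rparr>"

lemma coarse_simps [simp]:
  "vessels (coarse t w D I) = vessels I" "price (coarse t w D I) = price I"
  "items (coarse t w D I) j = items I j div D"
  "capacity (coarse t w D I) k = (if D = 1 then capacity I k else capacity I k div D + (\<Sum>j<t. w j))"
  by (simp_all add: coarse_def)

lemma coarse_1 [simp]: "coarse t w (Suc 0) I = I"
  by (simp add: coarse_def)

lemma sum_below:
  fixes g :: "nat \<Rightarrow> nat"
  assumes "m \<le> (\<Sum>k<v. g k)"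
  shows "\<exists>z. (\<forall>k<v. z k \<le> g k) \<and> (\<Sum>k<v. z k) = m"
  using assms
proof (induction v arbitrary: m)
  case (Suc v)
  have "m - min m (g v) \<le> (\<Sum>k<v. g k)" using Suc.prems by simp
  from Suc.IH[OF this] obtain z where z: "\<And>k. k < v \<Longrightarrow> z k \<le> g k" "(\<Sum>k<v. z k) = m - min m (g v)"
    by auto
  have "(\<Sum>k<v. (z(v := min m (g v))) k) = (\<Sum>k<v. z k)" by (intro sum.cong) auto
  then show ?case using z by (intro exI[of _ "z(v := min m (g v))"]) (auto simp: less_Suc_eq)
qed auto

text \<open>Rounding every entry up to \<open>x j k div D + 1\<close> covers at least the required
  row sums, and \<open>sum_below\<close> trims the excess. Per vessel this adds at most one item of
  each type, exactly the surplus \<open>\<Sum>j<t. w j\<close>.\<close>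

lemma feasible_coarse:
  assumes "feasible t w I x" "0 < D"
  shows "\<exists>z. feasible t w (coarse t w D I) z"
proof (cases "D = 1")
  case False
  let ?v = "vessels I"
  have "\<exists>z. (\<forall>k<?v. z k \<le> x j k div D + 1) \<and> (\<Sum>k<?v. z k) = items I j div D" if "j < t" for j
  proof (rule sum_below)
    have "items I j = (\<Sum>k<?v. x j k)" using assms that by (simp add: feasible_def)
    also have "\<dots> \<le> (\<Sum>k<?v. D * (x j k div D + 1))"
      using assms(2) by (intro sum_mono) (metis add.commute dividend_less_times_div less_imp_le mult_Suc_right plus_1_eq_Suc)
    finally have "items I j \<le> D * (\<Sum>k<?v. x j k div D + 1)" by (simp add: sum_distrib_left)
    then show "items I j div D \<le> (\<Sum>k<?v. x j k div D + 1)"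
      using assms(2) by (metis div_le_mono nonzero_mult_div_cancel_left not_less0)
  qed
  then obtain z where z: "\<And>j k. j < t \<Longrightarrow> k < ?v \<Longrightarrow> z j k \<le> x j k div D + 1"
    "\<And>j. j < t \<Longrightarrow> (\<Sum>k<?v. z j k) = items I j div D" by metis
  have "(\<Sum>j<t. w j * z j k) \<le> capacity I k div D + (\<Sum>j<t. w j)" if k: "k < ?v" for k
  proof -
    have "(\<Sum>j<t. w j * z j k) \<le> (\<Sum>j<t. w j * (x j k div D + 1))"
      using z k by (intro sum_mono mult_left_mono) auto
    also have "\<dots> = (\<Sum>j<t. w j * (x j k div D)) + (\<Sum>j<t. w j)" by (simp add: sum.distrib)
    also have "(\<Sum>j<t. w j * (x j k div D)) \<le> capacity I k div D"
    proof -
      have "D * (\<Sum>j<t. w j * (x j k div D)) = (\<Sum>j<t. w j * (D * (x j k div D)))"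
        by (simp add: sum_distrib_left mult.left_commute)
      also have "\<dots> \<le> (\<Sum>j<t. w j * x j k)" by (intro sum_mono mult_left_mono) auto
      also have "\<dots> \<le> capacity I k" using assms k by (simp add: feasible_def)
      finally show ?thesis using assms(2) by (metis div_le_mono nonzero_mult_div_cancel_left not_less0)
    qed
    finally show ?thesis by simp
  qed
  then show ?thesis using z False by (auto simp: feasible_def intro!: exI[of _ z])
qed (use assms in \<open>auto simp: feasible_def\<close>)

text \<open>The threshold for \<open>t + 1\<close> rows, the last being the slack of weight
  \<open>1\<close>: hence the total weight \<open>(\<Sum>j<t. w j) + 1\<close>, an unchanged product
  of weights, and \<open>t + 2\<close> levels. The third argument bounds all row and column sums of
  the deviations in \<open>optimal_near_double\<close>; the slack row is the worst.\<close>

definition prox :: "nat \<Rightarrow> (nat \<Rightarrow> nat) \<Rightarrow> nat \<Rightarrow> int" where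
  "prox t w v = threshold (2 * int (\<Prod>j<t. w j)) (int (\<Sum>j<t. w j) + 1)
     ((int v + 1) * (2 * int (\<Sum>j<t. w j) + 1)) (int v) (t + 2)"

text \<open>Among the optimal plans, \<open>x\<close> is taken closest to \<open>2 * z\<close> in
  the sum of absolute deviations, slacks included. A far entry would yield a kernel element
  \<open>h\<close> for which \<open>x - h\<close> is still optimal and strictly closer. The plan
  \<open>y\<close> supplies the existence of an optimum.\<close>

lemma optimal_near_double:
  assumes w: "\<And>j. j < t \<Longrightarrow> 0 < w j"
    and same: "vessels J = vessels I" "price J = price I"
    and items: "\<And>j. j < t \<Longrightarrow> \<bar>int (items I j) - 2 * int (items J j)\<bar> \<le> 1"
    and cap: "\<And>k. k < vessels I \<Longrightarrow>
      \<bar>int (capacity I k) - 2 * int (capacity J k)\<bar> \<le> 2 * int (\<Sum>j<t. w j) + 1"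
    and z: "optimal t w J z" and feas: "feasible t w I y"
  shows "\<exists>x. optimal t w I x \<and>
    (\<forall>j<t. \<forall>k<vessels I. \<bar>int (x j k) - 2 * int (z j k)\<bar> \<le> prox t w (vessels I))"
proof -
  let ?v = "vessels I"
  define W where "W = int (\<Sum>j<t. w j)"
  have W0: "0 \<le> W" by (simp add: W_def sum_nonneg)
  define slack where "slack I x k = int (capacity I k) - (\<Sum>j<t. int (w j) * int (x j k))"
    for I :: shipment and x k
  define dev where "dev x j k = (if j < t then int (x j k) - 2 * int (z j k)
    else slack I x k - 2 * slack J z k)" for x j k
  define M where "M x = nat (\<Sum>j<Suc t. \<Sum>k<?v. \<bar>dev x j k\<bar>)" for x
  have slack_nonneg: "0 \<le> slack I' x k" if "feasible t w I' x" "k < vessels I'" for I' x k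
  proof -
    have "(\<Sum>j<t. w j * x j k) \<le> capacity I' k" using that by (simp add: feasible_def)
    then show ?thesis by (simp add: slack_def flip: of_nat_mult of_nat_sum)
  qed
  \<comment> \<open>Entries of feasible plans are bounded, so adding \<open>lb\<close> makes every
    cost nonnegative and a minimum over natural numbers exists.\<close>
  define lb where "lb = (\<Sum>j<t. \<Sum>k<?v. \<bar>price I j k\<bar> * int (items I j))"
  have x_le: "x j k \<le> items I j" if "feasible t w I x" "j < t" "k < ?v" for x j k
  proof -
    have "x j k \<le> (\<Sum>k<?v. x j k)" using that by (intro member_le_sum) auto
    then show ?thesis using that by (simp add: feasible_def)
  qed
  have lb: "0 \<le> lb + total_cost t I x" if "feasible t w I x" for x
  proof -
    have "- lb = (\<Sum>j<t. \<Sum>k<?v. - (\<bar>price I j k\<bar> * int (items I j)))"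
      by (simp add: lb_def sum_negf)
    also have "\<dots> \<le> total_cost t I x" unfolding total_cost_def
    proof (intro sum_mono)
      fix j k assume jk: "j \<in> {..<t}" "k \<in> {..<?v}"
      have "\<bar>price I j k\<bar> * int (x j k) \<le> \<bar>price I j k\<bar> * int (items I j)"
        using x_le[OF that, of j k] jk by (intro mult_left_mono) auto
      moreover have "- (\<bar>price I j k\<bar> * int (x j k)) \<le> price I j k * int (x j k)"
        by (metis abs_ge_minus_self abs_mult abs_of_nat minus_le_iff)
      ultimately show "- (\<bar>price I j k\<bar> * int (items I j)) \<le> price I j k * int (x j k)" by linarith
    qed
    finally show ?thesis by simp
  qed
  define x0 where "x0 = arg_min (\<lambda>x. nat (lb + total_cost t I x)) (feasible t w I)"
  have x0: "feasible t w I x0" "nat (lb + total_cost t I x0) \<le> nat (lb + total_cost t I x)"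
    if "feasible t w I x" for x
    unfolding x0_def by (rule arg_min_natI[of "feasible t w I" x, OF that])
      (rule arg_min_nat_le[of "feasible t w I" x, OF that])
  have opt0: "optimal t w I x0" unfolding optimal_def
    using x0[OF feas] lb x0(2) by (meson add_le_cancel_left nat_le_eq_zle)
  define x where "x = arg_min M (optimal t w I)"
  have x: "optimal t w I x" unfolding x_def by (rule arg_min_natI[of "optimal t w I", OF opt0])
  have xmin: "M x \<le> M x'" if "optimal t w I x'" for x' unfolding x_def by (rule arg_min_nat_le[of "optimal t w I", OF that])
  have xf: "feasible t w I x" and zf: "feasible t w J z" using x z by (auto simp: optimal_def)
  define w' where "w' = w(t := 1)"
  have w'sum: "(\<Sum>j<Suc t. int (w' j) * g j) = (\<Sum>j<t. int (w j) * g j) + g t" for g :: "nat \<Rightarrow> int"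
    unfolding w'_def by (simp cong: sum.cong_simp)
  have w'W: "int (\<Sum>j<Suc t. w' j) = W + 1"
    unfolding w'_def W_def by (simp cong: sum.cong_simp)
  have w'L: "(\<Prod>j<Suc t. w' j) = (\<Prod>j<t. w j)" unfolding w'_def by (simp cong: prod.cong_simp)
  define c where "c = (int ?v + 1) * (2 * W + 1)"
  have c_alt: "c = int ?v * (2 * W + 1) + (2 * W + 1)" by (simp add: c_def algebra_simps)
  have c0: "0 \<le> int ?v * (2 * W + 1)" using W0 by simp
  have rowt: "(\<Sum>k<?v. dev x j k) = int (items I j) - 2 * int (items J j)" if "j < t" for j
  proof -
    have "(\<Sum>k<?v. dev x j k) = int (\<Sum>k<?v. x j k) - 2 * int (\<Sum>k<?v. z j k)"
      using that by (simp add: dev_def sum_subtractf sum_distrib_left)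
    then show ?thesis using that xf zf same by (simp add: feasible_def del: of_nat_sum)
  qed
  have colt: "(\<Sum>j<Suc t. int (w' j) * dev x j k) = int (capacity I k) - 2 * int (capacity J k)" for k
    unfolding w'sum by (simp add: dev_def slack_def right_diff_distrib sum_subtractf sum_distrib_left mult.left_commute)
  have near: "\<bar>dev x j k\<bar> \<le> prox t w ?v" if jk: "j < t" "k < ?v" for j k
  proof (rule ccontr)
    assume far: "\<not> ?thesis"
    have "\<exists>h. (\<forall>j<Suc t. (\<Sum>k<?v. h j k) = 0) \<and> (\<forall>k<?v. (\<Sum>j<Suc t. int (w' j) * h j k) = 0) \<and>
        (\<exists>j<Suc t. \<exists>k<?v. h j k \<noteq> 0) \<and> (\<forall>j<Suc t. \<forall>k<?v.
       h j k = 0 \<or> (0 < h j k \<and> 2 * h j k \<le> dev x j k) \<or> (h j k < 0 \<and> dev x j k \<le> 2 * h j k))"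
    proof (rule small_kernel_element[where T="Suc t" and w=w' and c=c and v="?v" and d="dev x" and ?j0.0=j and ?k0.0=k])
      show "0 < w' j" if "j < Suc t" for j using that w by (auto simp: w'_def less_Suc_eq)
      show "0 \<le> c" using c0 W0 c_alt by simp
      show col: "\<bar>\<Sum>j<Suc t. int (w' j) * dev x j k\<bar> \<le> c" if "k < ?v" for k
        using cap[OF that] c0 by (simp only: colt c_alt W_def)
      show "\<bar>\<Sum>k<?v. dev x j k\<bar> \<le> c" if "j < Suc t" for j
      proof (cases "j < t")
        case True
        then show ?thesis using items[OF True] c0 c_alt W0 unfolding rowt[OF True] by linarith
      next
        case False
        \<comment> \<open>The slack row has no prescribed sum; its sum is what the column sums leave
          after subtracting the weighted sums of the other rows. This is the origin of the factor
          \<open>v\<close> in \<open>c\<close>.\<close>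
        then have "(\<Sum>k<?v. dev x j k) = (\<Sum>k<?v. (\<Sum>j<Suc t. int (w' j) * dev x j k) - (\<Sum>j<t. int (w j) * dev x j k))"
          using that by (simp only: w'sum) (simp add: less_Suc_eq)
        also have "\<dots> = (\<Sum>k<?v. int (capacity I k) - 2 * int (capacity J k)) - (\<Sum>k<?v. \<Sum>j<t. int (w j) * dev x j k)"
          by (simp only: colt sum_subtractf)
        also have "(\<Sum>k<?v. \<Sum>j<t. int (w j) * dev x j k) = (\<Sum>j<t. int (w j) * (\<Sum>k<?v. dev x j k))"
          by (subst sum.swap) (simp add: sum_distrib_left)
        finally have eq: "(\<Sum>k<?v. dev x j k) = (\<Sum>k<?v. int (capacity I k) - 2 * int (capacity J k))
            - (\<Sum>j<t. int (w j) * (\<Sum>k<?v. dev x j k))" .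
        have "\<bar>\<Sum>k<?v. int (capacity I k) - 2 * int (capacity J k)\<bar> \<le> (\<Sum>k<?v. 2 * W + 1)"
          using cap by (intro order_trans[OF sum_abs] sum_mono) (auto simp: W_def)
        moreover have "\<bar>\<Sum>j<t. int (w j) * (\<Sum>k<?v. dev x j k)\<bar> \<le> (\<Sum>j<t. int (w j) * 1)"
          using items rowt by (intro order_trans[OF sum_abs] sum_mono) (auto simp: abs_mult intro!: mult_left_le)
        ultimately have "\<bar>\<Sum>k<?v. dev x j k\<bar> \<le> int ?v * (2 * W + 1) + W"
          unfolding eq by (simp add: W_def)
        then show ?thesis using c_alt W0 by simp
      qed
      show "threshold (2 * int (prod w' {..<Suc t})) (int (sum w' {..<Suc t})) c (int ?v) (Suc (Suc t)) \<le> \<bar>dev x j k\<bar>"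
        using far unfolding w'L w'W prox_def by (simp add: W_def c_def)
      show "j < Suc t" "k < ?v" using jk by simp_all
    qed blast
    then obtain h where hrow: "\<And>j. j < Suc t \<Longrightarrow> (\<Sum>k<?v. h j k) = 0"
      and hcol: "\<And>k. k < ?v \<Longrightarrow> (\<Sum>j<Suc t. int (w' j) * h j k) = 0"
      and hne: "\<exists>j<Suc t. \<exists>k<?v. h j k \<noteq> 0"
      and hsgn: "\<And>j k. j < Suc t \<Longrightarrow> k < ?v \<Longrightarrow>
       h j k = 0 \<or> (0 < h j k \<and> 2 * h j k \<le> dev x j k) \<or> (h j k < 0 \<and> dev x j k \<le> 2 * h j k)"
      by blast
    \<comment> \<open>Truncation by \<open>nat\<close> is harmless: \<open>0 < h\<close> gives
      \<open>x >= 2 * h + 2 * z\<close>, and \<open>h < 0\<close> gives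
      \<open>2 * z >= x - 2 * h\<close>, that is \<open>z + h >= 0\<close>. The slacks obey the same
      inequalities.\<close>
    define x' where "x' j k = nat (int (x j k) - h j k)" for j k
    define z' where "z' j k = nat (int (z j k) + h j k)" for j k
    have x': "int (x' j k) = int (x j k) - h j k" and z': "int (z' j k) = int (z j k) + h j k"
      if "j < t" "k < ?v" for j k
      using hsgn[of j k] that by (auto simp: x'_def z'_def dev_def)
    have sx: "slack I x' k = slack I x k - h t k" and sz: "slack J z' k = slack J z k + h t k"
      if "k < ?v" for k
      using hcol[OF that] x' z' that unfolding w'sum slack_def
      by (simp_all add: right_diff_distrib distrib_left sum_subtractf sum.distrib cong: sum.cong_simp)
    have fx': "feasible t w I x'"
      unfolding feasible_def
    proof (intro conjI allI impI)
      fix j assume "j < t"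
      then have "int (\<Sum>k<?v. x' j k) = int (\<Sum>k<?v. x j k)"
        using hrow[of j] by (simp add: x' sum_subtractf cong: sum.cong_simp)
      then have "(\<Sum>k<?v. x' j k) = (\<Sum>k<?v. x j k)" by linarith
      then show "(\<Sum>k<?v. x' j k) = items I j" using xf \<open>j < t\<close> by (simp add: feasible_def)
    next
      fix k assume k: "k < ?v"
      have "0 \<le> slack I x' k"
        using sx[OF k] hsgn[of t k] k slack_nonneg[OF xf k] slack_nonneg[OF zf, of k] same by (auto simp: dev_def)
      then have "int (\<Sum>j<t. w j * x' j k) \<le> int (capacity I k)" by (simp add: slack_def)
      then show "(\<Sum>j<t. w j * x' j k) \<le> capacity I k" by linarith
    qed
    have fz': "feasible t w J z'"
      unfolding feasible_def same
    proof (intro conjI allI impI)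
      fix j assume "j < t"
      then have "int (\<Sum>k<?v. z' j k) = int (\<Sum>k<?v. z j k)"
        using hrow[of j] by (simp add: z' sum.distrib cong: sum.cong_simp)
      then have "(\<Sum>k<?v. z' j k) = (\<Sum>k<?v. z j k)" by linarith
      then show "(\<Sum>k<?v. z' j k) = items J j" using zf \<open>j < t\<close> same by (simp add: feasible_def)
    next
      fix k assume k: "k < ?v"
      have "0 \<le> slack J z' k"
        using sz[OF k] hsgn[of t k] k slack_nonneg[OF xf k] slack_nonneg[OF zf, of k] same by (auto simp: dev_def)
      then have "int (\<Sum>j<t. w j * z' j k) \<le> int (capacity J k)" by (simp add: slack_def)
      then show "(\<Sum>j<t. w j * z' j k) \<le> capacity J k" by linarith
    qed
    define ch where "ch = (\<Sum>j<t. \<Sum>k<?v. price I j k * h j k)"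
    have cx': "total_cost t I x' = total_cost t I x - ch"
      unfolding total_cost_def ch_def by (simp add: x' right_diff_distrib sum_subtractf cong: sum.cong_simp)
    have cz': "total_cost t J z' = total_cost t J z + ch"
      unfolding total_cost_def ch_def same by (simp add: z' distrib_left sum.distrib cong: sum.cong_simp)
    \<comment> \<open>One inequality suffices: \<open>z'\<close> competes with the optimal
      \<open>z\<close>, so \<open>h\<close> has nonnegative cost, and subtracting it cannot make
      \<open>x\<close> dearer.\<close>
    have "0 \<le> ch" using z fz' cz' by (auto simp: optimal_def)
    then have "optimal t w I x'" using x fx' cx' by (auto simp: optimal_def intro: order_trans)
    then have le: "M x \<le> M x'" by (rule xmin)
    have dev': "dev x' j k = dev x j k - h j k" if "j < Suc t" "k < ?v" for j k
      using that x' sx by (auto simp: dev_def less_Suc_eq)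
    have dle: "\<bar>dev x' j k\<bar> \<le> \<bar>dev x j k\<bar>" and dless: "h j k \<noteq> 0 \<Longrightarrow> \<bar>dev x' j k\<bar> < \<bar>dev x j k\<bar>"
      if "j < Suc t" "k < ?v" for j k
      using dev'[OF that] hsgn[OF that] by linarith+
    obtain j1 k1 where jk1: "j1 < Suc t" "k1 < ?v" "h j1 k1 \<noteq> 0" using hne by auto
    have "(\<Sum>j<Suc t. \<Sum>k<?v. \<bar>dev x' j k\<bar>) < (\<Sum>j<Suc t. \<Sum>k<?v. \<bar>dev x j k\<bar>)"
    proof (rule sum_strict_mono_ex1)
      show "\<forall>j\<in>{..<Suc t}. (\<Sum>k<?v. \<bar>dev x' j k\<bar>) \<le> (\<Sum>k<?v. \<bar>dev x j k\<bar>)"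
        by (auto intro!: sum_mono dle)
      show "\<exists>j\<in>{..<Suc t}. (\<Sum>k<?v. \<bar>dev x' j k\<bar>) < (\<Sum>k<?v. \<bar>dev x j k\<bar>)"
        using jk1 by (intro bexI[of _ j1] sum_strict_mono_ex1 ballI bexI[of _ k1]) (auto intro!: dle dless)
    qed simp
    moreover have "0 \<le> (\<Sum>j<Suc t. \<Sum>k<?v. \<bar>dev x' j k\<bar>)" by (intro sum_nonneg) auto
    ultimately have "M x' < M x" unfolding M_def by linarith
    then show False using le by simp
  qed
  show ?thesis using x near by (auto simp: dev_def intro!: exI[of _ x])
qed

text \<open>Nested floors differ from doubling by at most \<open>1\<close>. The surplus occurs
  doubled on one side and, for \<open>D = 1\<close>, not at all on the other, which is where
  \<open>2 * int C\<close> comes from.\<close>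

lemma optimal_near_double_coarse:
  assumes "\<And>j. j < t \<Longrightarrow> 0 < w j" "0 < D"
    and "optimal t w (coarse t w (2 * D) I) z" "feasible t w (coarse t w D I) y"
  shows "\<exists>x. optimal t w (coarse t w D I) x \<and>
    (\<forall>j<t. \<forall>k<vessels I. \<bar>int (x j k) - 2 * int (z j k)\<bar> \<le> prox t w (vessels I))"
proof -
  have div2: "\<bar>int (a div D) - 2 * int (a div (2 * D))\<bar> \<le> 1" for a
    by (simp add: div_mult2_eq mult.commute[of 2 D])
  have "\<bar>int (if D = 1 then a else a div D + C) - 2 * int (a div (2 * D) + C)\<bar> \<le> 2 * int C + 1" for a C
    using div2[of a] by (auto split: if_splits)
  then show ?thesis
    using optimal_near_double[of t w "coarse t w (2 * D) I" "coarse t w D I" z y] assms div2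
    by (simp del: of_nat_add of_nat_sum of_nat_mult cong: if_cong)
qed

section \<open>Counting steps with bounded values\<close>

lemma bitlen_le: "0 \<le> z \<Longrightarrow> z < 2 ^ m \<Longrightarrow> bitlen z \<le> int m"
  by (simp add: bitlen_le_iff_power)

lemma int_bits_le: "\<bar>z\<bar> < 2 ^ m \<Longrightarrow> int_bits z \<le> Suc m"
  using bitlen_le[of "\<bar>z\<bar>" m] by (simp add: int_bits_def)

lemma less_power_int_bits: "\<bar>z\<bar> < 2 ^ int_bits z"
proof -
  have "\<bar>z\<bar> < 2 ^ nat (bitlen \<bar>z\<bar>)" using bitlen_bounds[of "\<bar>z\<bar>"]
    by (cases "z = 0") (auto simp: bitlen_bounds)
  also have "\<dots> \<le> 2 ^ int_bits z" by (simp add: int_bits_def)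
  finally show ?thesis .
qed

definition bounded_state :: "nat \<Rightarrow> state \<Rightarrow> bool" where
  "bounded_state S s \<longleftrightarrow> (\<forall>r. \<bar>fst s r\<bar> < 2 ^ S) \<and> (\<forall>a. \<bar>snd s a\<bar> < 2 ^ S)"

definition setr :: "state \<Rightarrow> nat \<Rightarrow> int \<Rightarrow> state" where
  "setr s r x = ((fst s)(r := x), snd s)"

definition setm :: "state \<Rightarrow> int \<Rightarrow> int \<Rightarrow> state" where
  "setm s a x = (fst s, (snd s)(a := x))"

lemma set_simps [simp]:
  "fst (setr s r x) q = (if q = r then x else fst s q)" "snd (setr s r x) = snd s"
  "fst (setm s a x) = fst s" "snd (setm s a x) b = (if b = a then x else snd s b)"
  by (simp_all add: setr_def setm_def)

text \<open>A constant read off the expression: in a state with \<open>S\<close>-bit contents its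
  value fits into this many blocks of \<open>S + 1\<close> bits. Products add up the bits, quotients
  need no more than the dividend, and the extra \<open>1\<close> for sums pays for the
  carry.\<close>

fun val_weight :: "expr \<Rightarrow> nat" where
  "val_weight (Const z) = int_bits z"
| "val_weight (Reg r) = 1"
| "val_weight (Mem a) = 1"
| "val_weight (Add a b) = val_weight a + val_weight b + 1"
| "val_weight (Sub a b) = val_weight a + val_weight b + 1"
| "val_weight (Mul a b) = val_weight a + val_weight b"
| "val_weight (Div a b) = val_weight a"

fun expr_weight :: "expr \<Rightarrow> nat" where
  "expr_weight (Const z) = int_bits z"
| "expr_weight (Reg r) = int_bits (int r) + 1"
| "expr_weight (Mem a) = expr_weight a + 1"
| "expr_weight (Add a b) = expr_weight a + expr_weight b + 1 + val_weight (Add a b)"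
| "expr_weight (Sub a b) = expr_weight a + expr_weight b + 1 + val_weight (Sub a b)"
| "expr_weight (Mul a b) = expr_weight a + expr_weight b + 1 + val_weight (Mul a b)"
| "expr_weight (Div a b) = expr_weight a + expr_weight b + 1 + val_weight (Div a b)"

lemma abs_div_le: "\<bar>a div b\<bar> \<le> \<bar>a\<bar>" for a b :: int
proof (cases "b = 0")
  case False
  have pos: "\<bar>a div b\<bar> \<le> \<bar>a\<bar>" if b: "0 < b" for a b :: int
  proof (cases "0 \<le> a div b")
    case True
    then have "1 * (a div b) \<le> b * (a div b)" using b by (intro mult_right_mono) auto
    then show ?thesis using True div_mult_mod_eq[of a b] pos_mod_sign[OF b, of a] mult.commute[of b "a div b"] by linarith
  next
    case False
    then have "b * (a div b + 1) \<le> 1 * (a div b + 1)" using b by (intro mult_right_mono_neg) auto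
    then have "a \<le> a div b" using div_mult_mod_eq[of a b] pos_mod_bound[OF b, of a] mult.commute[of b "a div b"]
      by (simp only: distrib_left)
    then show ?thesis using False by simp
  qed
  show ?thesis
  proof (cases "0 < b")
    case False
    have "a div b = - a div - b" by simp
    then show ?thesis using pos[of "- b" "- a"] False \<open>b \<noteq> 0\<close> by simp
  qed (rule pos)
qed simp

lemma add_less_power:
  fixes a b :: int
  assumes "\<bar>a\<bar> < 2 ^ m" "\<bar>b\<bar> < 2 ^ n"
  shows "\<bar>a\<bar> + \<bar>b\<bar> < 2 ^ (m + n + 1)"
proof -
  have "(2::int) ^ m \<le> 2 ^ (m + n)" "(2::int) ^ n \<le> 2 ^ (m + n)" by (simp_all add: power_increasing)
  then show ?thesis using assms by (simp only: power_add power_one_right)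
qed

lemma val_bound:
  assumes "bounded_state S s"
  shows "\<bar>val s e\<bar> < 2 ^ (val_weight e * (S + 1))"
proof (induction e)
  case (Const z)
  have "\<bar>z\<bar> < 2 ^ int_bits z" by (rule less_power_int_bits)
  also have "\<dots> \<le> 2 ^ (int_bits z * (S + 1))" by (intro power_increasing) auto
  finally show ?case by simp
next
  case (Reg r)
  have "\<bar>fst s r\<bar> < 2 ^ S" using assms by (simp add: bounded_state_def)
  also have "\<dots> \<le> 2 ^ (S + 1)" by (intro power_increasing) auto
  finally show ?case by simp
next
  case (Mem a)
  have "\<bar>snd s (val s a)\<bar> < 2 ^ S" using assms by (simp add: bounded_state_def)
  also have "\<dots> \<le> 2 ^ (S + 1)" by (intro power_increasing) auto
  finally show ?case by simp
next
  case (Add a b)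
  have "\<bar>val s a + val s b\<bar> < 2 ^ (val_weight a * (S + 1) + val_weight b * (S + 1) + 1)"
    using add_less_power[OF Add] by linarith
  also have "\<dots> \<le> 2 ^ (val_weight (Add a b) * (S + 1))"
    by (intro power_increasing) (auto simp: algebra_simps)
  finally show ?case by simp
next
  case (Sub a b)
  have "\<bar>val s a - val s b\<bar> < 2 ^ (val_weight a * (S + 1) + val_weight b * (S + 1) + 1)"
    using add_less_power[OF Sub] by linarith
  also have "\<dots> \<le> 2 ^ (val_weight (Sub a b) * (S + 1))"
    by (intro power_increasing) (auto simp: algebra_simps)
  finally show ?case by simp
next
  case (Mul a b)
  have "\<bar>val s a * val s b\<bar> < 2 ^ (val_weight a * (S + 1)) * 2 ^ (val_weight b * (S + 1))"
    unfolding abs_mult using Mul by (intro mult_strict_mono') auto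
  then show ?case by (simp only: val.simps val_weight.simps power_add distrib_right)
next
  case (Div a b)
  show ?case using order_le_less_trans[OF abs_div_le Div(1)] by simp
qed

lemma int_bits_val:
  assumes "bounded_state S s"
  shows "int_bits (val s e) \<le> (1 + val_weight e) * (S + 1)"
proof -
  have "int_bits (val s e) \<le> Suc (val_weight e * (S + 1))"
    by (rule int_bits_le[OF val_bound[OF assms]])
  then show ?thesis by (simp add: distrib_right)
qed

lemma eval_cost_le:
  assumes "bounded_state S s"
  shows "eval_cost s e \<le> expr_weight e * (S + 1)"
proof (induction e)
  case (Reg r)
  have "int_bits (fst s r) \<le> S + 1"
    using assms int_bits_le by (simp add: bounded_state_def)
  then show ?case by (simp add: distrib_right)
next
  case (Mem a)
  have "int_bits (val s (Mem a)) \<le> S + 1"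
    using assms int_bits_le[of "snd s (val s a)" S] by (simp add: bounded_state_def)
  then show ?case using Mem by (simp add: distrib_right)
next
  case (Add a b)
  then show ?case using int_bits_val[OF assms, of "Add a b"] by (simp add: distrib_right)
next
  case (Sub a b)
  then show ?case using int_bits_val[OF assms, of "Sub a b"] by (simp add: distrib_right)
next
  case (Mul a b)
  then show ?case using int_bits_val[OF assms, of "Mul a b"] by (simp add: distrib_right)
next
  case (Div a b)
  then show ?case using int_bits_val[OF assms, of "Div a b"] by (simp add: distrib_right)
qed simp

fun prog_weight :: "prog \<Rightarrow> nat" where
  "prog_weight Skip = 1"
| "prog_weight (Assign r e) = 1 + int_bits (int r) + expr_weight e"
| "prog_weight (Store a e) = 1 + expr_weight a + expr_weight e"
| "prog_weight (Seq c d) = prog_weight c + prog_weight d"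
| "prog_weight (IfPos e c d) = 1 + expr_weight e + prog_weight c + prog_weight d"
| "prog_weight (WhilePos e c) = 1 + expr_weight e + prog_weight c"

text \<open>A unit-cost semantics that restricts the stored values instead of measuring them.
  Addresses and intermediate results need no condition, as \<open>val_bound\<close> controls them;
  \<open>runs_exec\<close> multiplies the number of steps by a constant of the program and by
  \<open>S + 1\<close> to bound the logarithmic cost.\<close>

inductive runs :: "nat \<Rightarrow> prog \<Rightarrow> state \<Rightarrow> nat \<Rightarrow> state \<Rightarrow> bool" for S where
  Skip: "runs S Skip s 1 s"
| Assign: "\<bar>val s e\<bar> < 2 ^ S \<Longrightarrow> runs S (Assign r e) s 1 (setr s r (val s e))"
| Store: "\<bar>val s e\<bar> < 2 ^ S \<Longrightarrow> runs S (Store a e) s 1 (setm s (val s a) (val s e))"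
| Seq: "runs S c s n s' \<Longrightarrow> runs S d s' n' s'' \<Longrightarrow> runs S (Seq c d) s (n + n') s''"
| IfTrue: "0 < val s e \<Longrightarrow> runs S c s n s' \<Longrightarrow> runs S (IfPos e c d) s (1 + n) s'"
| IfFalse: "\<not> 0 < val s e \<Longrightarrow> runs S d s n s' \<Longrightarrow> runs S (IfPos e c d) s (1 + n) s'"
| WhileFalse: "\<not> 0 < val s e \<Longrightarrow> runs S (WhilePos e c) s 1 s"
| WhileTrue: "0 < val s e \<Longrightarrow> runs S c s n s' \<Longrightarrow> runs S (WhilePos e c) s' n' s'' \<Longrightarrow>
    runs S (WhilePos e c) s (1 + n + n') s''"

lemma runs_exec:
  assumes "runs S c s n s'" "bounded_state S s"
  shows "bounded_state S s' \<and> (\<exists>T. exec c s T s' \<and> T \<le> n * (prog_weight c * (S + 1)))"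
  using assms
proof (induction rule: runs.induct)
  case (Skip s)
  then show ?case by (auto intro!: exI[of _ 1] exec.Skip)
next
  case (Assign s e r)
  have "exec (Assign r e) s (1 + int_bits (int r) + eval_cost s e) (setr s r (val s e))"
    unfolding setr_def by (rule exec.Assign)
  moreover have "1 + int_bits (int r) + eval_cost s e \<le> 1 * (prog_weight (Assign r e) * (S + 1))"
    using eval_cost_le[OF Assign.prems, of e] by (simp add: distrib_right)
  ultimately show ?case using Assign by (auto simp: bounded_state_def)
next
  case (Store s e a)
  have "exec (Store a e) s (1 + eval_cost s a + eval_cost s e) (setm s (val s a) (val s e))"
    unfolding setm_def by (rule exec.Store)
  moreover have "1 + eval_cost s a + eval_cost s e \<le> 1 * (prog_weight (Store a e) * (S + 1))"
    using eval_cost_le[OF Store.prems, of e] eval_cost_le[OF Store.prems, of a] by (simp add: distrib_right)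
  ultimately show ?case using Store by (auto simp: bounded_state_def)
next
  case (Seq c s n s' d n' s'')
  then obtain T T' where T: "exec c s T s'" "T \<le> n * (prog_weight c * (S + 1))"
    "exec d s' T' s''" "T' \<le> n' * (prog_weight d * (S + 1))" by auto
  have "T \<le> n * (prog_weight (Seq c d) * (S + 1))" "T' \<le> n' * (prog_weight (Seq c d) * (S + 1))"
    by (rule order_trans[OF T(2)], (intro mult_le_mono; simp))
      (rule order_trans[OF T(4)], (intro mult_le_mono; simp))
  then show ?case using exec.Seq[OF T(1,3)] Seq by (intro conjI exI[of _ "T + T'"]) (auto simp: add_mult_distrib)
next
  case (IfTrue s e c n s' d)
  then obtain T where T: "exec c s T s'" "T \<le> n * (prog_weight c * (S + 1))" by auto
  have "T \<le> n * (prog_weight (IfPos e c d) * (S + 1))"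
    by (rule order_trans[OF T(2)], intro mult_le_mono) simp_all
  moreover have "1 + eval_cost s e \<le> prog_weight (IfPos e c d) * (S + 1)"
    using eval_cost_le[OF IfTrue.prems, of e] by (simp add: distrib_right)
  ultimately show ?case using exec.IfTrue[OF IfTrue(1) T(1), of d] IfTrue
    by (intro conjI exI[of _ "1 + eval_cost s e + T"]) (simp_all only: add_mult_distrib mult_1 add_mono)
next
  case (IfFalse s e d n s' c)
  then obtain T where T: "exec d s T s'" "T \<le> n * (prog_weight d * (S + 1))" by auto
  have "T \<le> n * (prog_weight (IfPos e c d) * (S + 1))"
    by (rule order_trans[OF T(2)], intro mult_le_mono) simp_all
  moreover have "1 + eval_cost s e \<le> prog_weight (IfPos e c d) * (S + 1)"
    using eval_cost_le[OF IfFalse.prems, of e] by (simp add: distrib_right)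
  ultimately show ?case using exec.IfFalse[OF IfFalse(1) T(1), of c] IfFalse
    by (intro conjI exI[of _ "1 + eval_cost s e + T"]) (simp_all only: add_mult_distrib mult_1 add_mono)
next
  case (WhileFalse s e c)
  have "1 + eval_cost s e \<le> 1 * (prog_weight (WhilePos e c) * (S + 1))"
    using eval_cost_le[OF WhileFalse.prems, of e] by (simp add: distrib_right)
  then show ?case using exec.WhileFalse[OF WhileFalse(1), of c] WhileFalse by blast
next
  case (WhileTrue s e c n s' n' s'')
  then obtain T T' where T: "exec c s T s'" "T \<le> n * (prog_weight c * (S + 1))"
    "exec (WhilePos e c) s' T' s''" "T' \<le> n' * (prog_weight (WhilePos e c) * (S + 1))" by auto
  have "T \<le> n * (prog_weight (WhilePos e c) * (S + 1))"
    by (rule order_trans[OF T(2)], intro mult_le_mono) simp_all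
  moreover have "1 + eval_cost s e \<le> prog_weight (WhilePos e c) * (S + 1)"
    using eval_cost_le[OF WhileTrue.prems, of e] by (simp add: distrib_right)
  ultimately show ?case using exec.WhileTrue[OF WhileTrue(1) T(1,3)] WhileTrue T(4)
    by (intro conjI exI[of _ "1 + eval_cost s e + T + T'"]) (simp_all only: add_mult_distrib mult_1 add_mono)
qed

section \<open>Total correctness with step budgets\<close>

definition wp :: "nat \<Rightarrow> prog \<Rightarrow> nat \<Rightarrow> (state \<Rightarrow> bool) \<Rightarrow> state \<Rightarrow> bool" where
  "wp S c n Q s \<longleftrightarrow> (\<exists>m\<le>n. \<exists>s'. runs S c s m s' \<and> Q s')"

lemma wp_mono: "wp S c n Q s \<Longrightarrow> (\<And>s'. Q s' \<Longrightarrow> Q' s') \<Longrightarrow> n \<le> n' \<Longrightarrow> wp S c n' Q' s"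
  unfolding wp_def by (meson order_trans)

lemma wp_Skip: "Q s \<Longrightarrow> 1 \<le> n \<Longrightarrow> wp S Skip n Q s"
  unfolding wp_def using runs.Skip by blast

lemma wp_Assign: "\<bar>val s e\<bar> < 2 ^ S \<Longrightarrow> Q (setr s r (val s e)) \<Longrightarrow> wp S (Assign r e) 1 Q s"
  unfolding wp_def using runs.Assign by blast

lemma wp_Store: "\<bar>val s e\<bar> < 2 ^ S \<Longrightarrow> Q (setm s (val s a) (val s e)) \<Longrightarrow> wp S (Store a e) 1 Q s"
  unfolding wp_def using runs.Store by blast

lemma wp_Seq: "wp S c n (wp S d n' Q) s \<Longrightarrow> wp S (Seq c d) (n + n') Q s"
  unfolding wp_def by (meson add_mono runs.Seq)

lemma wp_IfPos:
  assumes "0 < val s e \<Longrightarrow> wp S c n Q s" "\<not> 0 < val s e \<Longrightarrow> wp S d n Q s"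
  shows "wp S (IfPos e c d) (1 + n) Q s"
  using assms unfolding wp_def by (cases "0 < val s e") (meson add_left_mono runs.IfTrue runs.IfFalse)+

text \<open>The index of \<open>Inv\<close> is at once the variant and the number of rounds still
  paid for; it may drop by more than one.\<close>

lemma wp_WhilePos:
  assumes step: "\<And>i s. Inv i s \<Longrightarrow> 0 < val s e \<Longrightarrow> wp S c m (\<lambda>s'. \<exists>i'<i. Inv i' s') s"
    and exit: "\<And>i s. Inv i s \<Longrightarrow> \<not> 0 < val s e \<Longrightarrow> Q s"
  shows "Inv i s \<Longrightarrow> wp S (WhilePos e c) (1 + i * (1 + m)) Q s"
proof (induction i arbitrary: s rule: less_induct)
  case (less i)
  show ?case
  proof (cases "0 < val s e")
    case True
    obtain n s' i' where s': "n \<le> m" "runs S c s n s'" "i' < i" "Inv i' s'"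
      using step[OF less.prems True] unfolding wp_def by blast
    obtain n' s'' where s'': "n' \<le> 1 + i' * (1 + m)" "runs S (WhilePos e c) s' n' s''" "Q s''"
      using less.IH[OF s'(3,4)] unfolding wp_def by blast
    have "Suc i' * (1 + m) \<le> i * (1 + m)" using s'(3) by (intro mult_right_mono) auto
    then have "1 + n + n' \<le> 1 + i * (1 + m)" using s'(1) s''(1) by simp
    then show ?thesis using runs.WhileTrue[OF True s'(2) s''(2)] s''(3) unfolding wp_def by blast
  next
    case False
    then show ?thesis using exit[OF less.prems] runs.WhileFalse unfolding wp_def by fastforce
  qed
qed

definition For :: "nat \<Rightarrow> expr \<Rightarrow> prog \<Rightarrow> prog" where
  "For r e c = Seq (Assign r (Const 0))
     (WhilePos (Sub e (Reg r)) (Seq c (Assign r (Add (Reg r) (Const 1)))))"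

text \<open>The bound \<open>e\<close> is evaluated anew in every round, so the invariant has to pin
  its value to \<open>n\<close>, and the body must leave the counter as it found it. The
  \<open>2\<close> added to \<open>m\<close> pays for guard and increment.\<close>

lemma wp_For:
  assumes init: "Inv 0 (setr s r 0)"
    and reg: "\<And>i s. i \<le> n \<Longrightarrow> Inv i s \<Longrightarrow> val s e = int n \<and> fst s r = int i"
    and body: "\<And>i s. i < n \<Longrightarrow> Inv i s \<Longrightarrow>
      wp S c m (\<lambda>s'. fst s' r = int i \<and> Inv (Suc i) (setr s' r (int i + 1))) s"
    and exit: "\<And>s. Inv n s \<Longrightarrow> Q s"
    and n: "int n < 2 ^ S"
  shows "wp S (For r e c) (2 + n * (m + 2)) Q s"
proof -
  let ?e = "Sub e (Reg r)" and ?c = "Seq c (Assign r (Add (Reg r) (Const 1)))"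
  have "wp S (WhilePos ?e ?c) (1 + n * (1 + (m + 1))) Q (setr s r 0)"
  \<comment> \<open>The loop rule counts down, so its index is the number of remaining
    rounds.\<close>
  proof (rule wp_WhilePos[where Inv = "\<lambda>k s. k \<le> n \<and> Inv (n - k) s" and Q = Q])
    fix k s assume k: "k \<le> n \<and> Inv (n - k) s" "0 < val s ?e"
    have "fst s r = int (n - k)" "val s e = int n" using reg[of "n - k" s] k by auto
    then have lt: "n - k < n" using k by simp
    show "wp S ?c (m + 1) (\<lambda>s'. \<exists>i'<k. i' \<le> n \<and> Inv (n - i') s') s"
    proof (rule wp_Seq, rule wp_mono[OF body[OF lt]])
      fix s' assume s': "fst s' r = int (n - k) \<and> Inv (Suc (n - k)) (setr s' r (int (n - k) + 1))"
      have "0 < k" "Suc (n - k) = n - (k - 1)" "k - 1 < k" "k - 1 \<le> n" using lt k by auto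
      moreover have v: "val s' (Add (Reg r) (Const 1)) = int (n - k) + 1" using s' by simp
      moreover have "\<bar>int (n - k) + 1\<bar> < 2 ^ S" using lt n by linarith
      ultimately show "wp S (Assign r (Add (Reg r) (Const 1))) 1 (\<lambda>s'. \<exists>i'<k. i' \<le> n \<and> Inv (n - i') s') s'"
        using s' by (intro wp_Assign) (auto simp only: v intro!: exI[of _ "k - 1"])
    qed (use k in auto)
  next
    fix k s assume k: "k \<le> n \<and> Inv (n - k) s" "\<not> 0 < val s ?e"
    then have "n - k = n" using reg[of "n - k" s] by auto
    then show "Q s" using exit k by simp
  qed (use init in simp)
  then have "wp S (For r e c) (1 + (1 + n * (1 + (m + 1)))) Q s"
    unfolding For_def by (intro wp_Seq wp_Assign) auto
  then show ?thesis by (rule wp_mono) auto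
qed

section \<open>Base-M digits and min-plus convolution tables\<close>

lemma digits_bound:
  fixes a :: "nat \<Rightarrow> nat"
  assumes "\<And>j. j < t \<Longrightarrow> a j < M"
  shows "(\<Sum>j<t. a j * M ^ j) < M ^ t"
  using assms
proof (induction t)
  case (Suc t)
  have "(\<Sum>j<t. a j * M ^ j) < M ^ t" using Suc by simp
  moreover have "a t * M ^ t + M ^ t \<le> M * M ^ t"
    using Suc.prems[of t] mult_le_mono1[of "Suc (a t)" M "M ^ t"] by simp
  ultimately show ?case by simp
qed simp

lemma digit_of_sum:
  fixes a :: "nat \<Rightarrow> nat"
  assumes "\<And>j. j < t \<Longrightarrow> a j < M" "i < t"
  shows "(\<Sum>j<t. a j * M ^ j) div M ^ i mod M = a i"
  using assms
proof (induction t)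
  case (Suc t)
  have M: "0 < M" using Suc.prems(1)[of t] by simp
  show ?case
  proof (cases "i = t")
    case True
    have "(\<Sum>j<t. a j * M ^ j) < M ^ t" using Suc.prems by (intro digits_bound) simp
    then show ?thesis using True M Suc.prems(1)[of t] by simp
  next
    case False
    then have i: "i < t" using Suc.prems by simp
    have "M ^ t = M ^ i * (M * M ^ (t - Suc i))"
      using i by (simp flip: power_add power_Suc)
    then have "(\<Sum>j<Suc t. a j * M ^ j) div M ^ i = (\<Sum>j<t. a j * M ^ j) div M ^ i + M * (a t * M ^ (t - Suc i))"
      using M by (simp add: mult.left_commute[of "a t"])
    then show ?thesis using Suc i by simp
  qed
qed simp

lemma sum_of_digits:
  fixes x M :: nat
  shows "x < M ^ t \<Longrightarrow> (\<Sum>j<t. (x div M ^ j mod M) * M ^ j) = x"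
proof -
  have "(\<Sum>j<t. (x div M ^ j mod M) * M ^ j) = x mod M ^ t"
  proof (induction t)
    case (Suc t)
    then show ?case by (simp add: mod_mult2_eq mult.commute[of M])
  qed simp
  then show "x < M ^ t \<Longrightarrow> ?thesis" by simp
qed

section \<open>Min-plus tables and backtracking\<close>

text \<open>
  The first component of an entry is \<open>1\<close> plus the best last option, or \<open>0\<close> if the position is
  unreachable; the second is the cost. An option is identified with the distance it moves.
\<close>

fun scan :: "(nat \<Rightarrow> bool) \<Rightarrow> (nat \<Rightarrow> int) \<Rightarrow> (nat \<Rightarrow> int \<times> int) \<Rightarrow> nat \<Rightarrow> nat \<Rightarrow> int \<times> int" where
  "scan V c T p 0 = (0, 0)"
| "scan V c T p (Suc n) =
     (if V n \<and> 0 < fst (T (p - n)) \<and>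
         (fst (scan V c T p n) = 0 \<or> snd (T (p - n)) + c n < snd (scan V c T p n))
      then (int n + 1, snd (T (p - n)) + c n) else scan V c T p n)"

text \<open>Layer \<open>Suc k\<close> is the min-plus convolution of layer \<open>k\<close> with
  the option costs of vessel \<open>k\<close>. Exactly the options from \<open>0\<close> to
  \<open>p\<close> are scanned, hence \<open>Suc p\<close>: for larger ones \<open>p - n\<close>
  would be truncated to \<open>0\<close>.\<close>

fun tab :: "(nat \<Rightarrow> nat \<Rightarrow> bool) \<Rightarrow> (nat \<Rightarrow> nat \<Rightarrow> int) \<Rightarrow> nat \<Rightarrow> nat \<Rightarrow> int \<times> int" where
  "tab V c 0 p = (if p = 0 then (1, 0) else (0, 0))"
| "tab V c (Suc k) p = scan (V k) (c k) (tab V c k) p (Suc p)"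

lemma scan_spec:
  "(fst (scan V c T p n) = 0 \<and> snd (scan V c T p n) = 0 \<and> (\<forall>q<n. \<not> (V q \<and> 0 < fst (T (p - q))))) \<or>
   (\<exists>q<n. scan V c T p n = (int q + 1, snd (T (p - q)) + c q) \<and> V q \<and> 0 < fst (T (p - q)) \<and>
     (\<forall>q'<n. V q' \<and> 0 < fst (T (p - q')) \<longrightarrow> snd (scan V c T p n) \<le> snd (T (p - q')) + c q'))"
proof (induction n)
  case (Suc n)
  show ?case
  proof (cases "V n \<and> 0 < fst (T (p - n)) \<and>
         (fst (scan V c T p n) = 0 \<or> snd (T (p - n)) + c n < snd (scan V c T p n))")
    case True
    then show ?thesis using Suc by (intro disjI2 exI[of _ n]) (auto simp: less_Suc_eq)
  next
    case False
    then have eq: "scan V c T p (Suc n) = scan V c T p n" by auto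
    show ?thesis unfolding eq using Suc False by (auto simp: less_Suc_eq)
  qed
qed simp

lemma scan_bounds: "0 \<le> fst (scan V c T p n) \<and> fst (scan V c T p n) \<le> int n"
  by (induction n) auto

lemma scan_value_bound:
  assumes "\<And>q. \<bar>snd (T q)\<bar> \<le> b" "\<And>q. V q \<Longrightarrow> \<bar>c q\<bar> \<le> b'" "0 \<le> b" "0 \<le> b'"
  shows "\<bar>snd (scan V c T p n)\<bar> \<le> b + b'"
proof (induction n)
  case (Suc n)
  show ?case
    using Suc assms(1)[of "p - n"] assms(2)[of n] by auto
qed (use assms in simp)

lemma tab_nonneg: "0 \<le> fst (tab V c k p)"
  by (cases k) (use scan_bounds in \<open>auto simp del: scan.simps\<close>)

lemma tab_value_bound:
  assumes "\<And>i q. i < k \<Longrightarrow> V i q \<Longrightarrow> \<bar>c i q\<bar> \<le> b" "0 \<le> b"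
  shows "\<bar>snd (tab V c k p)\<bar> \<le> int k * b"
  using assms(1)
proof (induction k arbitrary: p)
  case (Suc k)
  have "\<bar>snd (scan (V k) (c k) (tab V c k) p (Suc p))\<bar> \<le> int k * b + b"
    using Suc assms(2) by (intro scan_value_bound) auto
  then show ?case by (simp add: distrib_right add.commute del: scan.simps)
qed simp

lemma tab_Suc_cases:
  obtains "fst (tab V c (Suc k) p) = 0" "\<And>q. q \<le> p \<Longrightarrow> V k q \<Longrightarrow> fst (tab V c k (p - q)) = 0"
  | q where "q \<le> p" "tab V c (Suc k) p = (int q + 1, snd (tab V c k (p - q)) + c k q)" "V k q"
    "0 < fst (tab V c k (p - q))"
    "\<And>q'. q' \<le> p \<Longrightarrow> V k q' \<Longrightarrow> 0 < fst (tab V c k (p - q')) \<Longrightarrow>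
      snd (tab V c (Suc k) p) \<le> snd (tab V c k (p - q')) + c k q'"
  using scan_spec[of "V k" "c k" "tab V c k" p "Suc p"] tab_nonneg[of V c k]
  unfolding tab.simps(2)[symmetric] less_Suc_eq_le by (metis order_le_less)

text \<open>The optimality half: no selection of valid options beats the table. That its values are
  attained, by backtracking, is \<open>tab_sound\<close>.\<close>

lemma tab_complete:
  assumes "\<And>i. i < k \<Longrightarrow> V i (f i)" "(\<Sum>i<k. f i) = p"
  shows "0 < fst (tab V c k p) \<and> snd (tab V c k p) \<le> (\<Sum>i<k. c i (f i))"
  using assms
proof (induction k arbitrary: p)
  case (Suc k)
  have q: "f k \<le> p" "V k (f k)" "(\<Sum>i<k. f i) = p - f k" using Suc.prems by auto
  have IH: "0 < fst (tab V c k (p - f k)) \<and> snd (tab V c k (p - f k)) \<le> (\<Sum>i<k. c i (f i))"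
    using Suc.prems(1) q(3) by (intro Suc.IH) auto
  show ?case
  proof (cases rule: tab_Suc_cases[of V c k p])
    case 1
    then show ?thesis using q IH by fastforce
  next
    case (2 q')
    then show ?thesis using 2(5)[OF q(1,2)] IH by (simp del: tab.simps)
  qed
qed simp

text \<open>Backtracking: the first component of the entry, less \<open>1\<close>, is both the
  option of the last vessel and the distance to step back.\<close>

fun chosen :: "(nat \<Rightarrow> nat \<Rightarrow> bool) \<Rightarrow> (nat \<Rightarrow> nat \<Rightarrow> int) \<Rightarrow> nat \<Rightarrow> nat \<Rightarrow> nat \<Rightarrow> nat" where
  "chosen V c 0 p i = 0"
| "chosen V c (Suc k) p i = (let q = nat (fst (tab V c (Suc k) p)) - 1 in
     if i = k then q else chosen V c k (p - q) i)"

lemma tab_step: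
  assumes "0 < fst (tab V c (Suc k) p)"
  defines "q \<equiv> nat (fst (tab V c (Suc k) p)) - 1"
  shows "q \<le> p" "V k q" "0 < fst (tab V c k (p - q))" "fst (tab V c (Suc k) p) = int q + 1"
    "snd (tab V c (Suc k) p) = snd (tab V c k (p - q)) + c k q"
proof -
  obtain q' where q': "q' \<le> p" "tab V c (Suc k) p = (int q' + 1, snd (tab V c k (p - q')) + c k q')" "V k q'"
    "0 < fst (tab V c k (p - q'))"
    using assms(1) by (cases rule: tab_Suc_cases[of V c k p]) (auto simp del: tab.simps)
  then have "q = q'" by (simp add: q_def del: tab.simps)
  then show "q \<le> p" "V k q" "0 < fst (tab V c k (p - q))" "fst (tab V c (Suc k) p) = int q + 1"
    "snd (tab V c (Suc k) p) = snd (tab V c k (p - q)) + c k q"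
    using q' by (simp_all del: tab.simps)
qed

lemma tab_sound:
  assumes "0 < fst (tab V c k p)"
  shows "(\<forall>i<k. V i (chosen V c k p i)) \<and> (\<Sum>i<k. chosen V c k p i) = p \<and>
    (\<Sum>i<k. c i (chosen V c k p i)) = snd (tab V c k p)"
  using assms
proof (induction k arbitrary: p)
  case (Suc k)
  define q where "q = nat (fst (tab V c (Suc k) p)) - 1"
  note st = tab_step[OF Suc.prems, folded q_def]
  have ch: "chosen V c (Suc k) p i = (if i = k then q else chosen V c k (p - q) i)" for i
    by (simp add: q_def Let_def)
  show ?case using Suc.IH[OF st(3)] st unfolding ch by (auto simp del: tab.simps simp: less_Suc_eq)
qed (auto split: if_splits)

section \<open>Correctness of the refinement step\<close>

definition digit :: "nat \<Rightarrow> nat \<Rightarrow> nat \<Rightarrow> nat" where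
  "digit M j q = q div M ^ j mod M"

text \<open>
  An option for a vessel is a number whose base-\<open>M\<close> digits are the deviations from \<open>2 * z\<close>, shifted by \<open>P\<close>
  to make them nonnegative; \<open>M\<close> is so large that summing over all vessels causes no carries.
\<close>

definition decode :: "(nat \<Rightarrow> nat \<Rightarrow> nat) \<Rightarrow> nat \<Rightarrow> nat \<Rightarrow> nat \<Rightarrow> nat \<Rightarrow> nat \<Rightarrow> int" where
  "decode z P M k q j = 2 * int (z j k) + int (digit M j q) - int P"

text \<open>The cap \<open>2 * P\<close> on the digits is the upper half of the proximity condition;
  the lower half holds as digits are nonnegative. It also keeps the sum of the digits over all
  vessels below \<open>M\<close>.\<close>

definition valid :: "nat \<Rightarrow> (nat \<Rightarrow> nat) \<Rightarrow> shipment \<Rightarrow> (nat \<Rightarrow> nat \<Rightarrow> nat) \<Rightarrow> nat \<Rightarrow> nat \<Rightarrow> nat \<Rightarrow> nat \<Rightarrow> bool" where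
  "valid t w J z P M k q \<longleftrightarrow> (\<forall>j<t. 0 \<le> decode z P M k q j \<and> digit M j q \<le> 2 * P) \<and>
     (\<Sum>j<t. int (w j) * decode z P M k q j) \<le> int (capacity J k)"

definition load_cost :: "nat \<Rightarrow> shipment \<Rightarrow> (nat \<Rightarrow> nat \<Rightarrow> nat) \<Rightarrow> nat \<Rightarrow> nat \<Rightarrow> nat \<Rightarrow> nat \<Rightarrow> int" where
  "load_cost t J z P M k q = (\<Sum>j<t. price J j k * decode z P M k q j)"

text \<open>The remainder \<open>n div D - 2 * (n div (2 * D))\<close>, which is \<open>0\<close> or
  \<open>1\<close>, is the prescribed row sum of the deviations; every vessel contributes its shift
  \<open>P\<close>.\<close>

definition goal_code :: "nat \<Rightarrow> shipment \<Rightarrow> nat \<Rightarrow> nat \<Rightarrow> nat \<Rightarrow> nat" where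
  "goal_code t I D P M = (\<Sum>j<t. (items I j div D - 2 * (items I j div (2 * D)) + vessels I * P) * M ^ j)"

lemma goal_code_less: "vessels I * P + 1 < M \<Longrightarrow> goal_code t I D P M < M ^ t"
proof -
  assume M: "vessels I * P + 1 < M"
  have "items I j div D - 2 * (items I j div (2 * D)) \<le> 1" for j
    by (simp add: div_mult2_eq mult.commute[of 2 D])
  then have "items I j div D - 2 * (items I j div (2 * D)) + vessels I * P < M" for j
    using M by (metis add.commute add_le_mono1 le_less_trans)
  then show ?thesis unfolding goal_code_def by (intro digits_bound)
qed

text \<open>Proximity enters for completeness: an optimal plan near \<open>2 * z\<close> is encoded
  by valid options that sum up to \<open>g\<close>. For soundness, sums of digits stay below
  \<open>M\<close>, so equal codes have equal digits and the row sums come out right.\<close>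

lemma dp_correct:
  fixes I :: shipment
  assumes w: "\<And>j. j < t \<Longrightarrow> 0 < w j" and D: "0 < D"
    and z: "optimal t w (coarse t w (2 * D) I) z"
    and P: "int P = prox t w (vessels I)" and M: "2 * vessels I * P + 1 < M" "2 * P < M"
  defines "J \<equiv> coarse t w D I"
  defines "V \<equiv> valid t w J z P M" and "c \<equiv> load_cost t J z P M"
  defines "g \<equiv> goal_code t I D P M"
  shows "0 < fst (tab V c (vessels I) g) \<Longrightarrow>
      optimal t w J (\<lambda>j k. nat (decode z P M k (chosen V c (vessels I) g k) j))" (is "_ \<Longrightarrow> ?opt")
    and "\<not> 0 < fst (tab V c (vessels I) g) \<Longrightarrow> \<nexists>y. feasible t w J y"
proof -
  let ?v = "vessels I"
  define r where "r j = items I j div D - 2 * (items I j div (2 * D))" for j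
  have r1: "r j \<le> 1" for j by (simp add: r_def div_mult2_eq mult.commute[of 2 D])
  have r: "int (items I j div D) = 2 * int (items I j div (2 * D)) + int (r j)" for j
    by (simp add: r_def div_mult2_eq mult.commute[of 2 D])
  have g: "g = (\<Sum>j<t. (r j + ?v * P) * M ^ j)" by (simp add: g_def goal_code_def r_def)
  have rM: "r j + ?v * P < M" for j using r1[of j] M(1) by simp
  have gM: "g < M ^ t" unfolding g using rM by (intro digits_bound) simp
  have zsum: "(\<Sum>k<?v. int (z j k)) = int (items I j div (2 * D))" if "j < t" for j
    using z that by (simp add: optimal_def feasible_def flip: of_nat_sum)
  have complete: "0 < fst (tab V c ?v g) \<and> snd (tab V c ?v g) \<le> total_cost t J y"
    if y: "feasible t w J y" for y
  proof -
    obtain x where x: "optimal t w J x"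
      "\<And>j k. j < t \<Longrightarrow> k < ?v \<Longrightarrow> \<bar>int (x j k) - 2 * int (z j k)\<bar> \<le> int P"
      using optimal_near_double_coarse[OF w D z, of y] y unfolding J_def P by blast
    define a where "a k j = nat (int (x j k) - 2 * int (z j k) + int P)" for k j
    have a: "int (a k j) = int (x j k) - 2 * int (z j k) + int P" "a k j \<le> 2 * P"
      if "j < t" "k < ?v" for k j using x(2)[OF that] by (auto simp: a_def)
    define f where "f k = (\<Sum>j<t. a k j * M ^ j)" for k
    have dig: "digit M j (f k) = a k j" if "j < t" "k < ?v" for k j
      unfolding digit_def f_def using a(2) M that by (intro digit_of_sum) (force+)
    have dec: "decode z P M k (f k) j = int (x j k)" if "j < t" "k < ?v" for k j
      using dig[OF that] a(1)[OF that] by (simp add: decode_def)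
    have "V k (f k)" if "k < ?v" for k
    proof -
      have "(\<Sum>j<t. w j * x j k) \<le> capacity J k"
        using x(1) that by (simp add: optimal_def feasible_def J_def)
      then have "(\<Sum>j<t. int (w j) * int (x j k)) \<le> int (capacity J k)"
        by (simp flip: of_nat_mult of_nat_sum)
      then show ?thesis using that a(2) by (auto simp: V_def valid_def dec dig)
    qed
    moreover have "(\<Sum>k<?v. f k) = g"
    proof -
      have "(\<Sum>k<?v. a k j) = r j + ?v * P" if j: "j < t" for j
      proof -
        have "int (\<Sum>k<?v. a k j) = (\<Sum>k<?v. int (x j k)) - 2 * (\<Sum>k<?v. int (z j k)) + int ?v * int P"
          using j by (simp add: a sum.distrib sum_subtractf sum_distrib_left cong: sum.cong_simp)
        also have "(\<Sum>k<?v. int (x j k)) = int (items I j div D)"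
          using x(1) j by (simp add: optimal_def feasible_def J_def flip: of_nat_sum)
        finally have "int (\<Sum>k<?v. a k j) = int (r j + ?v * P)"
          using zsum[OF j] r[of j] by simp
        then show ?thesis by linarith
      qed
      then show ?thesis unfolding f_def g by (subst sum.swap) (simp flip: sum_distrib_right)
    qed
    ultimately have "0 < fst (tab V c ?v g) \<and> snd (tab V c ?v g) \<le> (\<Sum>k<?v. c k (f k))"
      by (intro tab_complete)
    moreover have "(\<Sum>k<?v. c k (f k)) = total_cost t J x"
      unfolding total_cost_def c_def load_cost_def by (subst sum.swap) (simp add: dec J_def cong: sum.cong_simp)
    moreover have "total_cost t J x \<le> total_cost t J y" using x(1) y by (simp add: optimal_def)
    ultimately show ?thesis by simp
  qed
  show "\<nexists>y. feasible t w J y" if "\<not> 0 < fst (tab V c ?v g)" using that complete by blast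
  show ?opt if pos: "0 < fst (tab V c ?v g)"
  proof -
    define f where "f = chosen V c ?v g"
    define x where "x j k = nat (decode z P M k (f k) j)" for j k
    have f: "\<And>k. k < ?v \<Longrightarrow> V k (f k)" "(\<Sum>k<?v. f k) = g" "(\<Sum>k<?v. c k (f k)) = snd (tab V c ?v g)"
      using tab_sound[OF pos] by (auto simp: f_def)
    have x: "int (x j k) = decode z P M k (f k) j" if "j < t" "k < ?v" for j k
      using f(1)[OF that(2)] that by (simp add: x_def V_def valid_def)
    \<comment> \<open>Digits from position \<open>t\<close> on would be ignored by
      \<open>decode\<close> but still count in the sum; being a summand of \<open>g\<close> excludes
      them.\<close>
    have fM: "f k < M ^ t" if "k < ?v" for k
    proof -
      have "f k \<le> (\<Sum>k<?v. f k)" using that by (intro member_le_sum) auto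
      then show ?thesis using f(2) gM by simp
    qed
    have "g = (\<Sum>k<?v. \<Sum>j<t. digit M j (f k) * M ^ j)"
      unfolding f(2)[symmetric] digit_def using fM by (intro sum.cong refl sum_of_digits[symmetric]) auto
    also have "\<dots> = (\<Sum>j<t. (\<Sum>k<?v. digit M j (f k)) * M ^ j)"
      by (subst sum.swap) (simp add: sum_distrib_right)
    finally have gd: "g = (\<Sum>j<t. (\<Sum>k<?v. digit M j (f k)) * M ^ j)" .
    have dM: "(\<Sum>k<?v. digit M j (f k)) < M" if "j < t" for j
    proof -
      have "(\<Sum>k<?v. digit M j (f k)) \<le> (\<Sum>k<?v. 2 * P)"
        using f(1) that by (intro sum_mono) (auto simp: V_def valid_def)
      then show ?thesis using M(1) by simp
    qed
    have dsum: "(\<Sum>k<?v. digit M j (f k)) = r j + ?v * P" if "j < t" for j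
      using digit_of_sum[of t "\<lambda>j. \<Sum>k<?v. digit M j (f k)" M j, OF dM that, folded gd]
        digit_of_sum[of t "\<lambda>j. r j + ?v * P" M j, OF rM that, folded g] by simp
    have xf: "feasible t w J x" unfolding feasible_def
    proof (intro conjI allI impI)
      fix j assume j: "j < t"
      have "int (\<Sum>k<?v. x j k) = 2 * (\<Sum>k<?v. int (z j k)) + int (\<Sum>k<?v. digit M j (f k)) - int ?v * int P"
        using j by (simp add: x decode_def sum.distrib sum_subtractf sum_distrib_left cong: sum.cong_simp)
      also have "\<dots> = int (items I j div D)" unfolding dsum[OF j] zsum[OF j] r[of j] by simp
      finally show "(\<Sum>k<vessels J. x j k) = items J j" by (simp add: J_def del: of_nat_sum)
    next
      fix k assume k: "k < vessels J"
      then have k': "k < ?v" by (simp add: J_def)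
      have "int (\<Sum>j<t. w j * x j k) = (\<Sum>j<t. int (w j) * decode z P M k (f k) j)"
        using k' by (simp add: x cong: sum.cong_simp)
      also have "\<dots> \<le> int (capacity J k)" using f(1)[OF k'] by (simp add: V_def valid_def)
      finally show "(\<Sum>j<t. w j * x j k) \<le> capacity J k" by (simp del: of_nat_sum of_nat_mult)
    qed
    have "total_cost t J x = (\<Sum>k<?v. c k (f k))"
      unfolding total_cost_def c_def load_cost_def by (subst sum.swap) (simp add: x J_def cong: sum.cong_simp)
    then have "optimal t w J x" using xf complete f(3) by (simp add: optimal_def)
    then show ?thesis by (simp add: x_def[abs_def] f_def)
  qed
qed

section \<open>Programs\<close>

text \<open>
  The registers hold the number of vessels, \<open>P\<close>, \<open>M\<close>, \<open>M ^ t\<close>, the scale, a flag cleared on infeasibility, the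
  current vessel, the current table position, the current option, the current type, and a cost.
\<close>

abbreviation (input) "rV \<equiv> 0 :: nat"
abbreviation (input) "rP \<equiv> 1 :: nat"
abbreviation (input) "rM \<equiv> 2 :: nat"
abbreviation (input) "rW \<equiv> 3 :: nat"
abbreviation (input) "rD \<equiv> 4 :: nat"
abbreviation (input) "rOK \<equiv> 5 :: nat"
abbreviation (input) "rK \<equiv> 6 :: nat"
abbreviation (input) "rX \<equiv> 7 :: nat"
abbreviation (input) "rQ \<equiv> 8 :: nat"
abbreviation (input) "rJ \<equiv> 9 :: nat"
abbreviation (input) "rC \<equiv> 10 :: nat"

text \<open>The number of types is fixed, so sums, powers and conjunctions over the types are
  unrolled into one expression of constant size.\<close>

primrec sumE :: "nat \<Rightarrow> (nat \<Rightarrow> expr) \<Rightarrow> expr" where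
  "sumE 0 f = Const 0"
| "sumE (Suc n) f = Add (sumE n f) (f n)"

primrec powE :: "expr \<Rightarrow> nat \<Rightarrow> expr" where
  "powE e 0 = Const 1"
| "powE e (Suc n) = Mul e (powE e n)"

text \<open>For \<open>y < 0\<close> the quotient of \<open>y\<close> by \<open>1 + y * y\<close> is rounded down to \<open>-1\<close>, otherwise to \<open>0\<close>.\<close>

definition nonnegE :: "expr \<Rightarrow> expr" where
  "nonnegE e = Add (Const 1) (Div e (Add (Const 1) (Mul e e)))"

primrec allE :: "nat \<Rightarrow> (nat \<Rightarrow> expr) \<Rightarrow> expr" where
  "allE 0 f = Const 1"
| "allE (Suc n) f = Mul (allE n f) (nonnegE (f n))"

lemma val_sumE [simp]: "val s (sumE n f) = (\<Sum>j<n. val s (f j))"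
  by (induction n) auto

lemma val_powE [simp]: "val s (powE e n) = val s e ^ n"
  by (induction n) auto

lemma val_nonnegE [simp]: "val s (nonnegE e) = of_bool (0 \<le> val s e)"
proof -
  have *: "y div (1 + y * y) = - of_bool (y < 0)" for y :: int
  proof -
    have "0 \<le> y * (y - 1)" "0 \<le> y * (y + 1)" by (simp_all add: zero_le_mult_iff; linarith)+
    then have y: "y < 1 + y * y" "0 < y + (1 + y * y)" by (simp_all add: algebra_simps)
    show ?thesis
    proof (cases "y < 0")
      case True
      then show ?thesis using y int_div_pos_eq[of y "1 + y * y" "- 1" "y + (1 + y * y)"] by simp
    next
      case False
      then show ?thesis using y by (simp add: div_pos_pos_trivial)
    qed
  qed
  show ?thesis unfolding nonnegE_def using *[of "val s e"] by simp
qed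

lemma val_allE [simp]: "val s (allE n f) = of_bool (\<forall>j<n. 0 \<le> val s (f j))"
  by (induction n) (auto simp: less_Suc_eq)

text \<open>
  Three interleaved arrays occupy the negative addresses: the plan (\<open>m = 0\<close>) and the two components
  of the dynamic programming table (\<open>m = 1, 2\<close>).
\<close>

definition adr :: "nat \<Rightarrow> nat \<Rightarrow> int" where
  "adr m q = - 1 - int m - 3 * int q"

lemma adr_neg [simp]: "adr m q < 0"
  by (simp add: adr_def)

lemma adr_neq [simp]: "0 \<le> a \<Longrightarrow> a \<noteq> adr m q" "0 \<le> a \<Longrightarrow> adr m q \<noteq> a"
  using adr_neg[of m q] by linarith+

lemma adr_eq [simp]: "m < 3 \<Longrightarrow> m' < 3 \<Longrightarrow> adr m q = adr m' q' \<longleftrightarrow> m = m' \<and> q = q'"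
  unfolding adr_def by presburger

definition adrE :: "nat \<Rightarrow> expr \<Rightarrow> expr" where
  "adrE m e = Sub (Const (- 1 - int m)) (Mul (Const 3) e)"

lemma val_adrE: "val s e = int q \<Longrightarrow> val s (adrE m e) = adr m q"
  by (simp add: adrE_def adr_def)

definition zA :: "expr \<Rightarrow> expr" where
  "zA j = adrE 0 (Add (Mul j (Reg rV)) (Reg rK))"

definition cellA :: "nat \<Rightarrow> expr \<Rightarrow> expr \<Rightarrow> expr" where
  "cellA m k p = adrE m (Add (Mul k (Reg rW)) p)"

lemma val_cellA:
  "val s k = int i \<Longrightarrow> val s p = int q \<Longrightarrow> fst s rW = int W \<Longrightarrow> val s (cellA m k p) = adr m (i * W + q)"
  unfolding cellA_def by (intro val_adrE) simp

text \<open>Expressions have no remainder operation, so it is expressed by two quotients.\<close>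

definition digitE :: "nat \<Rightarrow> expr" where
  "digitE j = Sub (Div (Reg rQ) (powE (Reg rM) j)) (Mul (Reg rM) (Div (Reg rQ) (powE (Reg rM) (Suc j))))"

definition decodeE :: "nat \<Rightarrow> expr" where
  "decodeE j = Sub (Add (Mul (Const 2) (Mem (zA (Const (int j))))) (digitE j)) (Reg rP)"

definition itemsE :: "nat \<Rightarrow> expr" where
  "itemsE j = Mem (Const (1 + int j))"

definition priceE :: "nat \<Rightarrow> nat \<Rightarrow> expr" where
  "priceE t j = Mem (Add (Const (1 + int t)) (Add (Reg rV) (Add (Mul (Const (int j)) (Reg rV)) (Reg rK))))"

text \<open>The quotient of \<open>1\<close> by the scale is \<open>1\<close> at scale \<open>1\<close> and \<open>0\<close> at all larger scales.\<close>

definition capacityE :: "nat \<Rightarrow> (nat \<Rightarrow> nat) \<Rightarrow> expr" where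
  "capacityE t w = Add (Div (Mem (Add (Const (1 + int t)) (Reg rK))) (Reg rD))
     (Mul (Const (int (\<Sum>j<t. w j))) (Sub (Const 1) (Div (Const 1) (Reg rD))))"

text \<open>A conjunction as a product of indicators. The last factor asks for a reachable
  predecessor, whose first component is at least \<open>1\<close>.\<close>

definition candidateE :: "nat \<Rightarrow> (nat \<Rightarrow> nat) \<Rightarrow> expr" where
  "candidateE t w = Mul (Mul (allE t decodeE) (allE t (\<lambda>j. Sub (Mul (Const 2) (Reg rP)) (digitE j))))
     (Mul (nonnegE (Sub (capacityE t w) (sumE t (\<lambda>j. Mul (Const (int (w j))) (decodeE j)))))
       (nonnegE (Sub (Mem (cellA 1 (Reg rK) (Sub (Reg rX) (Reg rQ)))) (Const 1))))"

definition new_costE :: "nat \<Rightarrow> expr" where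
  "new_costE t = Add (Mem (cellA 2 (Reg rK) (Sub (Reg rX) (Reg rQ))))
     (sumE t (\<lambda>j. Mul (priceE t j) (decodeE j)))"

definition curA :: "nat \<Rightarrow> expr" where
  "curA m = cellA m (Add (Reg rK) (Const 1)) (Reg rX)"

text \<open>Positive if the cell is still unreachable or strictly dearer; ties keep the earlier
  option, as in \<open>scan\<close>.\<close>

definition betterE :: expr where
  "betterE = Sub (Const 1) (Mul (nonnegE (Sub (Mem (curA 1)) (Const 1))) (nonnegE (Sub (Reg rC) (Mem (curA 2)))))"

definition option_prog :: "nat \<Rightarrow> (nat \<Rightarrow> nat) \<Rightarrow> prog" where
  "option_prog t w = IfPos (candidateE t w)
     (Seq (Assign rC (new_costE t))
       (IfPos betterE
         (Seq (Store (curA 1) (Add (Reg rQ) (Const 1))) (Store (curA 2) (Reg rC))) Skip)) Skip"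

definition cell_prog :: "nat \<Rightarrow> (nat \<Rightarrow> nat) \<Rightarrow> prog" where
  "cell_prog t w = Seq (Store (curA 1) (Const 0)) (Seq (Store (curA 2) (Const 0))
     (For rQ (Add (Reg rX) (Const 1)) (option_prog t w)))"

definition table_prog :: "nat \<Rightarrow> (nat \<Rightarrow> nat) \<Rightarrow> prog" where
  "table_prog t w =
     Seq (For rX (Reg rW) (Seq (Store (cellA 1 (Const 0) (Reg rX)) (Const 0))
            (Store (cellA 2 (Const 0) (Reg rX)) (Const 0))))
    (Seq (Store (cellA 1 (Const 0) (Const 0)) (Const 1))
         (For rK (Reg rV) (For rX (Reg rW) (cell_prog t w))))"

definition goalE :: "nat \<Rightarrow> expr" where
  "goalE t = sumE t (\<lambda>j. Mul (Add (Sub (Div (itemsE j) (Reg rD))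
       (Mul (Const 2) (Div (itemsE j) (Mul (Const 2) (Reg rD))))) (Mul (Reg rV) (Reg rP))) (powE (Reg rM) j))"

text \<open>Here the type is a loop counter, so its power of \<open>M\<close> cannot be unrolled
  into an expression; instead \<open>rQ\<close> sheds its lowest digit in every round.\<close>

definition column_prog :: "nat \<Rightarrow> prog" where
  "column_prog t = For rJ (Const (int t))
     (Seq (Store (zA (Reg rJ)) (Sub (Add (Mul (Const 2) (Mem (zA (Reg rJ))))
         (Sub (Reg rQ) (Mul (Reg rM) (Div (Reg rQ) (Reg rM))))) (Reg rP)))
       (Assign rQ (Div (Reg rQ) (Reg rM))))"

definition extract_prog :: "nat \<Rightarrow> prog" where
  "extract_prog t = Seq (Assign rK (Reg rV)) (WhilePos (Reg rK)
     (Seq (Assign rQ (Sub (Mem (cellA 1 (Reg rK) (Reg rX))) (Const 1)))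
     (Seq (Assign rK (Sub (Reg rK) (Const 1)))
     (Seq (Assign rX (Sub (Reg rX) (Reg rQ)))
       (column_prog t)))))"

definition refine_prog :: "nat \<Rightarrow> (nat \<Rightarrow> nat) \<Rightarrow> prog" where
  "refine_prog t w = Seq (Assign rD (Div (Reg rD) (Const 2)))
     (Seq (table_prog t w)
     (Seq (Assign rX (goalE t))
       (IfPos (Mem (cellA 1 (Reg rV) (Reg rX))) (extract_prog t) (Assign rOK (Const 0)))))"

section \<open>State invariants and values of the expressions\<close>

lemma idx_eq: "(p::nat) < W \<Longrightarrow> p' < W \<Longrightarrow> k * W + p = k' * W + p' \<longleftrightarrow> k = k' \<and> p = p'"
proof
  assume p: "p < W" "p' < W" and eq: "k * W + p = k' * W + p'"
  have "k = (k * W + p) div W" "k' = (k' * W + p') div W" using p by simp_all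
  with eq have "k = k'" by simp
  then show "k = k' \<and> p = p'" using eq by simp
qed simp

definition cells :: "nat \<Rightarrow> state \<Rightarrow> nat \<Rightarrow> nat \<Rightarrow> int \<times> int" where
  "cells W s k p = (snd s (adr 1 (k * W + p)), snd s (adr 2 (k * W + p)))"

lemma cells_setr [simp]: "cells W (setr s r x) = cells W s"
  by (simp add: cells_def fun_eq_iff)

lemma cells_setm_0 [simp]: "cells W (setm s (adr 0 q) x) = cells W s"
  by (simp add: cells_def fun_eq_iff)

lemma cells_setm:
  assumes "p < W" "p' < W"
  shows "cells W (setm s (adr (Suc 0) (k * W + p)) y) k' p' =
      (if k' = k \<and> p' = p then (y, snd (cells W s k p)) else cells W s k' p')"
    "cells W (setm s (adr 2 (k * W + p)) y) k' p' =
      (if k' = k \<and> p' = p then (fst (cells W s k p), y) else cells W s k' p')"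
  using idx_eq[OF assms(2,1), of k' k] by (auto simp: cells_def)

text \<open>\<open>S\<close> bounds the bit lengths of all stored values, \<open>A\<close> the numbers in the input, and \<open>P\<close> the deviations.\<close>

locale machine =
  fixes S t :: nat and w :: "nat \<Rightarrow> nat" and I :: shipment and P M A :: nat
  assumes items_le: "\<And>j. j < t \<Longrightarrow> items I j \<le> A"
    and price_le: "\<And>j k. j < t \<Longrightarrow> k < vessels I \<Longrightarrow> \<bar>price I j k\<bar> \<le> int A"
    and M_gt: "2 * vessels I * P + 1 < M" "2 * P < M"
    and S_table: "M ^ t + vessels I + t + 2 < 2 ^ S"
    and S_cost: "(vessels I + 1) * (t * (A * (2 * A + P))) < 2 ^ S"
    and S_load: "2 * A + P < 2 ^ S"
begin

abbreviation "v \<equiv> vessels I"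
abbreviation "W \<equiv> M ^ t"

lemma W_pos: "0 < W" using M_gt by simp

definition input :: "state \<Rightarrow> bool" where
  "input s \<longleftrightarrow> (\<forall>j<t. snd s (1 + int j) = int (items I j)) \<and>
    (\<forall>k<v. snd s (1 + int t + int k) = int (capacity I k)) \<and>
    (\<forall>j<t. \<forall>k<v. snd s (1 + int t + int v + int j * int v + int k) = price I j k)"

definition env :: "nat \<Rightarrow> (nat \<Rightarrow> nat \<Rightarrow> int) \<Rightarrow> state \<Rightarrow> bool" where
  "env D Z s \<longleftrightarrow> input s \<and> fst s rV = int v \<and> fst s rP = int P \<and> fst s rM = int M \<and>
    fst s rW = int W \<and> fst s rD = int D \<and> fst s rOK = 1 \<and>
    (\<forall>j<t. \<forall>k<v. snd s (adr 0 (j * v + k)) = Z j k)"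

lemma input_setm [simp]: "a < 0 \<Longrightarrow> input (setm s a x) = input s"
  unfolding input_def by (auto; smt (verit, best) of_nat_0_le_iff mult_nonneg_nonneg)

lemma input_setr [simp]: "input (setr s r x) = input s"
  by (simp add: input_def)

lemma env_setr [simp]: "5 < r \<Longrightarrow> env D Z (setr s r x) = env D Z s"
  by (auto simp: env_def)

lemma env_setm [simp]: "0 < m \<Longrightarrow> m < 3 \<Longrightarrow> env D Z (setm s (adr m q) x) = env D Z s"
  by (simp add: env_def)

lemma env_setz:
  assumes "env D Z s" "j < t" "k < v"
  shows "env D (Z(j := (Z j)(k := x))) (setm s (adr 0 (j * v + k)) x)"
  using assms by (auto simp: env_def idx_eq)

lemma env_cong:
  assumes "env D Z s" "\<And>j k. j < t \<Longrightarrow> k < v \<Longrightarrow> Z j k = Z' j k"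
  shows "env D Z' s"
  using assms by (auto simp: env_def)

lemma env_reg:
  assumes "env D Z s"
  shows "fst s 0 = int v" "fst s (Suc 0) = int P" "fst s 2 = int M" "fst s 3 = int W" "fst s 4 = int D" "fst s 5 = 1"
  using assms by (simp_all add: env_def)

lemma val_z:
  assumes "env D Z s" "val s e = int j" "fst s rK = int k" "j < t" "k < v"
  shows "val s (Mem (zA e)) = Z j k" "val s (zA e) = adr 0 (j * v + k)"
proof -
  show "val s (zA e) = adr 0 (j * v + k)" unfolding zA_def
    using assms by (intro val_adrE) (simp add: env_reg)
  then show "val s (Mem (zA e)) = Z j k" using assms by (simp add: env_def)
qed

lemma val_digitE:
  assumes "env D Z s" "fst s rQ = int q"
  shows "val s (digitE j) = int (digit M j q)"
proof -
  have "val s (digitE j) = int (q div M ^ j) - int M * int (q div M ^ Suc j)"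
    using assms by (simp add: digitE_def env_reg zdiv_int)
  also have "q div M ^ Suc j = q div M ^ j div M" by (simp add: div_mult2_eq mult.commute[of M])
  also have "int (q div M ^ j) - int M * int (q div M ^ j div M) = int (digit M j q)"
    by (simp only: digit_def zmod_int zdiv_int minus_mult_div_eq_mod)
  finally show ?thesis .
qed

lemma val_decodeE:
  assumes "env D (\<lambda>j k. int (z j k)) s" "fst s rQ = int q" "fst s rK = int k" "j < t" "k < v"
  shows "val s (decodeE j) = decode z P M k q j"
proof -
  have "val s (Mem (zA (Const (int j)))) = int (z j k)"
    by (rule val_z(1)[OF assms(1) _ assms(3-5)]) simp
  then show ?thesis unfolding decodeE_def decode_def val.simps val_digitE[OF assms(1,2)] env_reg(2)[OF assms(1)]
    by (simp only: env_reg(2)[OF assms(1)] One_nat_def)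
qed

lemma val_capacityE:
  assumes "env D Z s" "fst s rK = int k" "k < v" "0 < D"
  shows "val s (capacityE t w) = int (capacity (coarse t w D I) k)"
proof -
  have u: "snd s (1 + int t + int k) = int (capacity I k)"
    using assms unfolding env_def input_def by blast
  show ?thesis
  proof (cases "D = 1")
    case False
    then have "(1::int) div int D = 0" using assms(4) by (intro div_pos_pos_trivial) auto
    then show ?thesis using u assms(2) False by (simp add: capacityE_def env_reg[OF assms(1)] zdiv_int)
  qed (use u assms(2) in \<open>simp add: capacityE_def env_reg[OF assms(1)]\<close>)
qed

lemma val_itemsE:
  assumes "env D Z s" "j < t"
  shows "val s (itemsE j) = int (items I j)"
  using assms unfolding env_def input_def itemsE_def by simp

lemma val_priceE:
  assumes "env D Z s" "fst s rK = int k" "j < t" "k < v"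
  shows "val s (priceE t j) = price I j k"
proof -
  have "snd s (1 + int t + int v + int j * int v + int k) = price I j k"
    using assms unfolding env_def input_def by blast
  then show ?thesis using assms(2) by (simp add: priceE_def env_reg[OF assms(1)] add.assoc)
qed

end

section \<open>Running the dynamic program\<close>

lemma (in machine) nat_less_S: "n \<le> M ^ t + v + t + 2 \<Longrightarrow> int n < 2 ^ S"
  using le_less_trans[OF _ S_table] by (simp only: of_nat_less_numeral_power_cancel_iff)

locale refine = machine +
  fixes D :: nat and z :: "nat \<Rightarrow> nat \<Rightarrow> nat"
  assumes D_pos: "0 < D" and z_le: "\<And>j k. j < t \<Longrightarrow> k < vessels I \<Longrightarrow> z j k \<le> A"
begin

abbreviation "J \<equiv> coarse t w D I"
abbreviation "V \<equiv> valid t w J z P M"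
abbreviation "c \<equiv> load_cost t J z P M"
abbreviation "E \<equiv> env D (\<lambda>j k. int (z j k))"
abbreviation "\<T> \<equiv> tab V c"

lemma decode_bounds:
  assumes "V k q" "j < t" "k < v"
  shows "0 \<le> decode z P M k q j" "decode z P M k q j \<le> 2 * int A + int P"
proof -
  have "digit M j q \<le> 2 * P" "0 \<le> decode z P M k q j" using assms by (auto simp: valid_def)
  then show "0 \<le> decode z P M k q j" "decode z P M k q j \<le> 2 * int A + int P"
    using z_le[OF assms(2,3)] by (auto simp: decode_def)
qed

lemma load_cost_bound:
  assumes "V k q" "k < v"
  shows "\<bar>c k q\<bar> \<le> int (t * (A * (2 * A + P)))"
proof -
  have "\<bar>c k q\<bar> \<le> (\<Sum>j<t. int A * (2 * int A + int P))"
    unfolding load_cost_def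
  proof (intro order_trans[OF sum_abs] sum_mono)
    fix j assume "j \<in> {..<t}"
    then show "\<bar>price J j k * decode z P M k q j\<bar> \<le> int A * (2 * int A + int P)"
      unfolding abs_mult using price_le[of j k] decode_bounds[OF assms(1) _ assms(2), of j] assms(2)
      by (intro mult_mono) auto
  qed
  then show ?thesis by simp
qed

text \<open>The new cost is assigned to \<open>rC\<close> before it is compared, so there must be
  room for one load cost on top of any table value; this is the \<open>+ 1\<close> in
  \<open>S_cost\<close>.\<close>

lemma cost_less: "k \<le> v \<Longrightarrow> \<bar>snd (\<T> k p)\<bar> + int (t * (A * (2 * A + P))) < 2 ^ S"
proof -
  let ?b = "int (t * (A * (2 * A + P)))"
  assume k: "k \<le> v"
  have "\<bar>snd (\<T> k p)\<bar> \<le> int k * ?b"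
    using load_cost_bound k by (intro tab_value_bound) auto
  also have "\<dots> \<le> int v * ?b" using k by (intro mult_right_mono) auto
  finally have "\<bar>snd (\<T> k p)\<bar> \<le> int v * ?b" .
  moreover have "int v * ?b + ?b = int ((v + 1) * (t * (A * (2 * A + P))))"
    by (simp add: algebra_simps)
  moreover have "int ((v + 1) * (t * (A * (2 * A + P)))) < 2 ^ S"
    using S_cost by (simp only: of_nat_less_numeral_power_cancel_iff)
  ultimately show ?thesis by linarith
qed

definition option_inv :: "nat \<Rightarrow> nat \<Rightarrow> nat \<Rightarrow> state \<Rightarrow> bool" where
  "option_inv k p q s \<longleftrightarrow> E s \<and> fst s rK = int k \<and> fst s rX = int p \<and> fst s rQ = int q \<and>
    (\<forall>k'\<le>k. \<forall>p'<W. cells W s k' p' = \<T> k' p') \<and> (\<forall>p'<p. cells W s (Suc k) p' = \<T> (Suc k) p') \<and>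
    cells W s (Suc k) p = scan (V k) (c k) (\<T> k) p q"

lemma val_curA:
  assumes "E s" "fst s rK = int k" "fst s rX = int p"
  shows "val s (curA m) = adr m (Suc k * W + p)"
  unfolding curA_def using assms by (intro val_cellA) (auto simp: env_reg)

lemma val_prevA:
  assumes "E s" "fst s rK = int k" "fst s rX = int p" "fst s rQ = int q" "q \<le> p"
  shows "val s (cellA m (Reg rK) (Sub (Reg rX) (Reg rQ))) = adr m (k * W + (p - q))"
  using assms by (intro val_cellA) (auto simp: env_reg)

lemma val_candidateE:
  assumes "E s" "fst s rK = int k" "fst s rX = int p" "fst s rQ = int q" "q \<le> p" "k < v"
  shows "0 < val s (candidateE t w) \<longleftrightarrow> V k q \<and> 0 < fst (cells W s k (p - q))"
proof -
  note dec = val_decodeE[OF assms(1,4,2) _ assms(6)]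
  have "(\<forall>j<t. 0 \<le> val s (decodeE j)) \<longleftrightarrow> (\<forall>j<t. 0 \<le> decode z P M k q j)" by (simp add: dec)
  moreover have "val s (Sub (Mul (Const 2) (Reg rP)) (digitE j)) = 2 * int P - int (digit M j q)" for j
    using assms by (simp add: val_digitE env_reg)
  moreover have "(\<Sum>j<t. val s (Mul (Const (int (w j))) (decodeE j))) = (\<Sum>j<t. int (w j) * decode z P M k q j)"
    by (simp add: dec)
  moreover have "val s (capacityE t w) = int (capacity J k)"
    using assms D_pos by (intro val_capacityE)
  moreover have "val s (Mem (cellA 1 (Reg rK) (Sub (Reg rX) (Reg rQ)))) = fst (cells W s k (p - q))"
    unfolding val.simps val_prevA[OF assms(1-5)] by (simp add: cells_def)
  moreover have "0 \<le> 2 * int P - int d \<longleftrightarrow> d \<le> 2 * P" for d by linarith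
  ultimately show ?thesis
    unfolding candidateE_def valid_def val.simps(4-6) val_nonnegE val_allE val_sumE val.simps(1)
    by (auto simp: zero_less_mult_iff)
qed

lemma val_new_costE:
  assumes "E s" "fst s rK = int k" "fst s rX = int p" "fst s rQ = int q" "q \<le> p" "k < v"
  shows "val s (new_costE t) = snd (cells W s k (p - q)) + c k q"
proof -
  have "val s (Mem (cellA 2 (Reg rK) (Sub (Reg rX) (Reg rQ)))) = snd (cells W s k (p - q))"
    unfolding val.simps val_prevA[OF assms(1-5)] by (simp add: cells_def)
  moreover have "(\<Sum>j<t. val s (Mul (priceE t j) (decodeE j))) = c k q"
    unfolding load_cost_def using assms
    by (intro sum.cong refl) (simp add: val_decodeE[OF assms(1,4,2) _ assms(6)] val_priceE)
  ultimately show ?thesis unfolding new_costE_def by simp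
qed

lemma val_betterE:
  assumes "E s" "fst s rK = int k" "fst s rX = int p"
  shows "0 < val s betterE \<longleftrightarrow> fst (cells W s (Suc k) p) \<le> 0 \<or> fst s rC < snd (cells W s (Suc k) p)"
proof -
  have "val s (Mem (curA 1)) = fst (cells W s (Suc k) p)" "val s (Mem (curA 2)) = snd (cells W s (Suc k) p)"
    unfolding val.simps val_curA[OF assms] by (simp_all add: cells_def)
  then show ?thesis unfolding betterE_def val.simps(2,5,6,1) val_nonnegE by auto
qed

text \<open>\<open>5\<close> steps cover the longest branch: two guards, one assignment, two stores.
  Whichever branch is taken, the cell advances by one step of \<open>scan\<close>.\<close>

lemma wp_option:
  assumes inv: "option_inv k p q s" and k: "k < v" and p: "p < W" and q: "q \<le> p"
  shows "wp S (option_prog t w) 5 (\<lambda>s'. fst s' rQ = int q \<and> option_inv k p (Suc q) (setr s' rQ (int q + 1))) s"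
    (is "wp _ _ _ ?post _")
proof -
  have s: "E s" "fst s rK = int k" "fst s rX = int p" "fst s rQ = int q"
    and prev: "\<And>k' p'. k' \<le> k \<Longrightarrow> p' < W \<Longrightarrow> cells W s k' p' = \<T> k' p'"
    and row: "\<And>p'. p' < p \<Longrightarrow> cells W s (Suc k) p' = \<T> (Suc k) p'"
    and cur: "cells W s (Suc k) p = scan (V k) (c k) (\<T> k) p q"
    using inv by (auto simp: option_inv_def simp del: tab.simps)
  have prevq: "cells W s k (p - q) = \<T> k (p - q)" using p by (intro prev) auto
  let ?x = "snd (\<T> k (p - q)) + c k q"
  let ?cand = "V k q \<and> 0 < fst (\<T> k (p - q))"
  let ?better = "fst (scan (V k) (c k) (\<T> k) p q) = 0 \<or> ?x < snd (scan (V k) (c k) (\<T> k) p q)"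
  note nn = scan_bounds[of "V k" "c k" "\<T> k" p q]
  have same: "?post s'" if "\<not> (?cand \<and> ?better)" "s' = s \<or> s' = setr s rC x" for s' x
  proof -
    have "scan (V k) (c k) (\<T> k) p (Suc q) = scan (V k) (c k) (\<T> k) p q" using that(1) by auto
    then show ?thesis using that(2) s prev row cur unfolding option_inv_def
      by (auto simp del: tab.simps scan.simps)
  qed
  show ?thesis
  proof (cases ?cand)
    case False
    then have "\<not> 0 < val s (candidateE t w)"
      using val_candidateE[OF s q k] prevq by simp
    moreover have "?post s" using same[of s] False by blast
    ultimately have "wp S (option_prog t w) (1 + 4) ?post s" unfolding option_prog_def
      by (intro wp_IfPos wp_Skip) (blast, simp_all)
    then show ?thesis by simp
  next
    case True
    have "\<bar>c k q\<bar> \<le> int (t * (A * (2 * A + P)))" using True k by (intro load_cost_bound) auto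
    then have xS: "\<bar>?x\<bar> < 2 ^ S" using cost_less[of k "p - q"] k by linarith
    have nc: "val s (new_costE t) = ?x" using val_new_costE[OF s q k] prevq by simp
    define s1 where "s1 = setr s rC ?x"
    have s1: "E s1" "fst s1 rK = int k" "fst s1 rX = int p" "fst s1 rQ = int q" "fst s1 rC = ?x"
      "cells W s1 = cells W s" using s by (simp_all add: s1_def)
    have qS: "\<bar>int q + 1\<bar> < 2 ^ S"
    proof -
      have "q + 1 < 2 ^ S" using q p S_table by linarith
      then have "int (q + 1) < 2 ^ S" by (simp only: of_nat_less_numeral_power_cancel_iff)
      then show ?thesis by simp
    qed
    have bet: "0 < val s1 betterE \<longleftrightarrow> ?better"
      unfolding val_betterE[OF s1(1-3)] using nn by (auto simp: s1 cur simp del: tab.simps scan.simps)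
    have upd: "wp S (Seq (Store (curA 1) (Add (Reg rQ) (Const 1))) (Store (curA 2) (Reg rC))) (1 + 1) ?post s1"
      if b: ?better
    proof (intro wp_Seq wp_Store)
      show "\<bar>val s1 (Add (Reg rQ) (Const 1))\<bar> < 2 ^ S" using qS s1 by simp
      define s2 where "s2 = setm s1 (val s1 (curA 1)) (val s1 (Add (Reg rQ) (Const 1)))"
      have s2_eq: "s2 = setm s1 (adr 1 (Suc k * W + p)) (int q + 1)"
        using s1(4) by (simp add: s2_def val_curA[OF s1(1-3)])
      have s2: "E s2" "fst s2 rK = int k" "fst s2 rX = int p" "fst s2 rQ = int q" "fst s2 rC = ?x"
        using s1 by (simp_all add: s2_eq)
      define s3 where "s3 = setm s2 (val s2 (curA 2)) (val s2 (Reg rC))"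
      have s3_eq: "s3 = setm s2 (adr 2 (Suc k * W + p)) ?x"
        using s2(5) by (simp add: s3_def val_curA[OF s2(1-3)])
      have s3: "E s3" "fst s3 rK = int k" "fst s3 rX = int p" "fst s3 rQ = int q"
        using s2 by (simp_all add: s3_eq)
      have c3: "cells W s3 k' p' = (if k' = Suc k \<and> p' = p then (int q + 1, ?x) else cells W s k' p')" if "p' < W" for k' p'
        unfolding s3_eq s2_eq One_nat_def using that p by (simp add: cells_setm s1 del: mult_Suc tab.simps)
      have "scan (V k) (c k) (\<T> k) p (Suc q) = (int q + 1, ?x)" using True b by simp
      then have "?post s3" unfolding option_inv_def using s3 prev row p
        by (simp add: c3 del: scan.simps tab.simps)
      then show "?post (setm (setm s1 (val s1 (curA 1)) (val s1 (Add (Reg rQ) (Const 1))))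
        (val (setm s1 (val s1 (curA 1)) (val s1 (Add (Reg rQ) (Const 1)))) (curA 2))
        (val (setm s1 (val s1 (curA 1)) (val s1 (Add (Reg rQ) (Const 1)))) (Reg rC)))"
        unfolding s3_def s2_def .
      show "\<bar>val (setm s1 (val s1 (curA 1)) (val s1 (Add (Reg rQ) (Const 1)))) (Reg rC)\<bar> < 2 ^ S"
        using xS s1(5) by simp
    qed
    have "wp S (IfPos betterE (Seq (Store (curA 1) (Add (Reg rQ) (Const 1))) (Store (curA 2) (Reg rC))) Skip) (1 + (1 + 1)) ?post s1"
    proof (intro wp_IfPos)
      assume "\<not> 0 < val s1 betterE"
      then show "wp S Skip (1 + 1) ?post s1" using bet same[of s1] by (intro wp_Skip) (auto simp: s1_def simp del: tab.simps scan.simps)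
    qed (use bet upd in blast)
    then have bt: "wp S (IfPos betterE (Seq (Store (curA 1) (Add (Reg rQ) (Const 1))) (Store (curA 2) (Reg rC))) Skip)
      (1 + (1 + 1)) ?post (setr s rC (val s (new_costE t)))" unfolding s1_def nc .
    have ncS: "\<bar>val s (new_costE t)\<bar> < 2 ^ S" unfolding nc by (rule xS)
    have cand: "0 < val s (candidateE t w)" using True val_candidateE[OF s q k] prevq by simp
    have "wp S (option_prog t w) (1 + (1 + (1 + (1 + 1)))) ?post s"
      unfolding option_prog_def
      by (rule wp_IfPos, rule wp_Seq[OF wp_Assign], rule ncS, rule bt) (use cand in blast)
    then show ?thesis by (rule wp_mono) auto
  qed
qed

definition cell_inv :: "nat \<Rightarrow> nat \<Rightarrow> state \<Rightarrow> bool" where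
  "cell_inv k p s \<longleftrightarrow> E s \<and> fst s rK = int k \<and> fst s rX = int p \<and>
    (\<forall>k'\<le>k. \<forall>p'<W. cells W s k' p' = \<T> k' p') \<and> (\<forall>p'<p. cells W s (Suc k) p' = \<T> (Suc k) p')"

lemma wp_cell:
  assumes inv: "cell_inv k p s" and k: "k < v" and p: "p < W"
  shows "wp S (cell_prog t w) (4 + W * 7) (\<lambda>s'. fst s' rX = int p \<and> cell_inv k (Suc p) (setr s' rX (int p + 1))) s"
    (is "wp _ _ _ ?post _")
proof -
  have s: "E s" "fst s rK = int k" "fst s rX = int p"
    and prev: "\<And>k' p'. k' \<le> k \<Longrightarrow> p' < W \<Longrightarrow> cells W s k' p' = \<T> k' p'"
    and row: "\<And>p'. p' < p \<Longrightarrow> cells W s (Suc k) p' = \<T> (Suc k) p'"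
    using inv by (auto simp: cell_inv_def simp del: tab.simps)
  define s1 where "s1 = setm s (adr 1 (Suc k * W + p)) 0"
  have s1: "E s1" "fst s1 rK = int k" "fst s1 rX = int p" using s by (simp_all add: s1_def)
  define s2 where "s2 = setm s1 (adr 2 (Suc k * W + p)) 0"
  have s2: "E s2" "fst s2 rK = int k" "fst s2 rX = int p" using s1 by (simp_all add: s2_def)
  have c2: "cells W s2 k' p' = (if k' = Suc k \<and> p' = p then (0, 0) else cells W s k' p')" if "p' < W" for k' p'
    unfolding s2_def s1_def One_nat_def using that p by (simp add: cells_setm del: mult_Suc tab.simps)
  have "wp S (For rQ (Add (Reg rX) (Const 1)) (option_prog t w)) (2 + Suc p * (5 + 2)) ?post s2"
  proof (rule wp_For[where Inv = "option_inv k p"])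
    show "option_inv k p 0 (setr s2 rQ 0)"
      unfolding option_inv_def using s2 prev row p by (auto simp: c2 simp del: tab.simps)
    show "val s (Add (Reg rX) (Const 1)) = int (Suc p) \<and> fst s rQ = int i"
      if "option_inv k p i s" for i s using that by (auto simp: option_inv_def)
    show "wp S (option_prog t w) 5 (\<lambda>s'. fst s' rQ = int i \<and> option_inv k p (Suc i) (setr s' rQ (int i + 1))) s"
      if "i < Suc p" "option_inv k p i s" for i s using that k p by (intro wp_option) auto
    show "?post s" if "option_inv k p (Suc p) s" for s
    proof -
      have "\<T> (Suc k) p = scan (V k) (c k) (\<T> k) p (Suc p)" by simp
      with that show ?thesis by (auto simp: option_inv_def cell_inv_def less_Suc_eq simp del: tab.simps scan.simps)
    qed
    show "int (Suc p) < 2 ^ S" using p by (intro nat_less_S) auto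
  qed
  then have "wp S (cell_prog t w) (1 + (1 + (2 + Suc p * (5 + 2)))) ?post s"
    unfolding cell_prog_def by (intro wp_Seq wp_Store)
     (simp_all only: val_curA[OF s] val_curA[OF s1] val.simps s1_def[symmetric] s2_def[symmetric], simp_all)
  moreover have "Suc p * 7 \<le> W * 7" using p by (intro mult_right_mono) auto
  ultimately show ?thesis by (elim wp_mono) auto
qed

definition layer_inv :: "nat \<Rightarrow> state \<Rightarrow> bool" where
  "layer_inv k s \<longleftrightarrow> E s \<and> fst s rK = int k \<and> (\<forall>k'\<le>k. \<forall>p'<W. cells W s k' p' = \<T> k' p')"

definition layer_time :: nat where "layer_time = 2 + W * (4 + W * 7 + 2)"

lemma wp_layer:
  assumes inv: "layer_inv k s" and k: "k < v"
  shows "wp S (For rX (Reg rW) (cell_prog t w)) layer_time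
    (\<lambda>s'. fst s' rK = int k \<and> layer_inv (Suc k) (setr s' rK (int k + 1))) s"
  unfolding layer_time_def
proof (rule wp_For[where Inv = "cell_inv k"])
  show "cell_inv k 0 (setr s rX 0)" using inv by (auto simp: cell_inv_def layer_inv_def)
  show "val s (Reg rW) = int W \<and> fst s rX = int i" if "cell_inv k i s" for i s
    using that by (auto simp: cell_inv_def env_reg)
  show "wp S (cell_prog t w) (4 + W * 7) (\<lambda>s'. fst s' rX = int i \<and> cell_inv k (Suc i) (setr s' rX (int i + 1))) s"
    if "i < W" "cell_inv k i s" for i s using that k by (intro wp_cell)
  show "fst s rK = int k \<and> layer_inv (Suc k) (setr s rK (int k + 1))" if "cell_inv k W s" for s
    using that by (auto simp: cell_inv_def layer_inv_def le_Suc_eq simp del: tab.simps)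
  show "int W < 2 ^ S" by (intro nat_less_S) auto
qed

definition table_time :: nat where "table_time = (2 + W * 4) + (1 + (2 + v * (layer_time + 2)))"

text \<open>Layer \<open>0\<close> has to be cleared explicitly, since the memory may still hold the
  table of the previous scale; the cells of later layers are reset by
  \<open>cell_prog\<close>.\<close>

lemma wp_table:
  assumes "E s"
  shows "wp S (table_prog t w) table_time
    (\<lambda>s'. E s' \<and> (\<forall>k\<le>v. \<forall>p<W. cells W s' k p = \<T> k p)) s" (is "wp _ _ _ ?post _")
  unfolding table_prog_def table_time_def
proof (rule wp_Seq)
  define base where "base p s \<longleftrightarrow> E s \<and> fst s rX = int p \<and> (\<forall>p'<p. cells W s 0 p' = (0, 0))" for p s
  let ?last = "For rK (Reg rV) (For rX (Reg rW) (cell_prog t w))"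
  let ?init = "Store (cellA 1 (Const 0) (Const 0)) (Const 1)"
  have "wp S (For rX (Reg rW) (Seq (Store (cellA 1 (Const 0) (Reg rX)) (Const 0))
            (Store (cellA 2 (Const 0) (Reg rX)) (Const 0)))) (2 + W * (2 + 2))
      (wp S (Seq ?init ?last) (1 + (2 + v * (layer_time + 2))) ?post) s"
  proof (rule wp_For[where Inv = base])
    show "base 0 (setr s rX 0)" using assms by (simp add: base_def)
    show "val s (Reg rW) = int W \<and> fst s rX = int i" if "base i s" for i s
      using that by (auto simp: base_def env_reg)
    show "wp S (Seq (Store (cellA 1 (Const 0) (Reg rX)) (Const 0)) (Store (cellA 2 (Const 0) (Reg rX)) (Const 0))) 2
       (\<lambda>s'. fst s' rX = int i \<and> base (Suc i) (setr s' rX (int i + 1))) s" (is "wp _ _ _ ?Q _")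
      if i: "i < W" and b: "base i s" for i s
    proof -
      have s: "E s" "fst s rX = int i" using b by (auto simp: base_def)
      have v: "val s (cellA m (Const 0) (Reg rX)) = adr m (0 * W + i)" if "E s" "fst s rX = int i" for m s
        using that by (intro val_cellA) (auto simp: env_reg)
      define s1 where "s1 = setm s (adr 1 (0 * W + i)) 0"
      have s1: "E s1" "fst s1 rX = int i" using s by (simp_all add: s1_def)
      define s2 where "s2 = setm s1 (adr 2 (0 * W + i)) 0"
      have s2: "E s2" "fst s2 rX = int i" using s1 by (simp_all add: s2_def)
      have c2: "cells W s2 k' p' = (if k' = 0 \<and> p' = i then (0, 0) else cells W s k' p')" if "p' < W" for k' p'
        unfolding s2_def s1_def One_nat_def using that i by (simp add: cells_setm[where k = 0, simplified])
      have "?Q s2" using s2 b i by (auto simp: base_def c2 less_Suc_eq)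
      then have "wp S (Seq (Store (cellA 1 (Const 0) (Reg rX)) (Const 0)) (Store (cellA 2 (Const 0) (Reg rX)) (Const 0))) (1 + 1) ?Q s"
        by (intro wp_Seq wp_Store) (simp_all only: v[OF s] v[OF s1] val.simps s1_def[symmetric] s2_def[symmetric], simp_all)
      then show ?thesis by (rule wp_mono) auto
    qed
    show "int W < 2 ^ S" by (intro nat_less_S) auto
    show "wp S (Seq ?init ?last) (1 + (2 + v * (layer_time + 2))) ?post s" if b: "base W s" for s
    proof (rule wp_Seq, rule wp_Store)
      show "\<bar>val s (Const 1)\<bar> < 2 ^ S" using nat_less_S[of 1] by simp
      have s: "E s" using b by (simp add: base_def)
      have a: "val s (cellA 1 (Const 0) (Const 0)) = adr 1 (0 * W + 0)"
        using s by (intro val_cellA) (auto simp: env_reg)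
      define s1 where "s1 = setm s (adr 1 (0 * W + 0)) 1"
      have s1: "E s1" using s by (simp add: s1_def)
      have c1: "cells W s1 0 p' = \<T> 0 p'" if "p' < W" for p'
        unfolding s1_def One_nat_def using that b W_pos
        by (simp add: cells_setm[where k = 0 and p = 0, simplified] base_def)
      have "wp S ?last (2 + v * (layer_time + 2)) ?post s1"
      proof (rule wp_For[where Inv = layer_inv])
        show "layer_inv 0 (setr s1 rK 0)" using s1 c1 by (auto simp: layer_inv_def)
        show "val s (Reg rV) = int v \<and> fst s rK = int i" if "layer_inv i s" for i s
          using that by (auto simp: layer_inv_def env_reg)
        show "wp S (For rX (Reg rW) (cell_prog t w)) layer_time
           (\<lambda>s'. fst s' rK = int i \<and> layer_inv (Suc i) (setr s' rK (int i + 1))) s"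
          if "i < v" "layer_inv i s" for i s using that by (intro wp_layer)
        show "?post s" if "layer_inv v s" for s using that by (auto simp: layer_inv_def)
        show "int v < 2 ^ S" by (intro nat_less_S) auto
      qed
      then show "wp S ?last (2 + v * (layer_time + 2)) ?post (setm s (val s (cellA 1 (Const 0) (Const 0))) (val s (Const 1)))"
        unfolding a val.simps s1_def .
    qed
  qed
  then show "wp S (For rX (Reg rW) (Seq (Store (cellA 1 (Const 0) (Reg rX)) (Const 0))
            (Store (cellA 2 (Const 0) (Reg rX)) (Const 0)))) (2 + W * 4)
      (wp S (Seq ?init ?last) (1 + (2 + v * (layer_time + 2))) ?post) s"
    by (rule wp_mono) auto
qed

end

section \<open>Extracting the refined plan\<close>

context refine
begin

text \<open>The new plan overwrites the old one in place, which is safe because each entry depends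
  on its own old value and the option only.\<close>

lemma wp_column:
  assumes e: "env D Z s" and s: "fst s rK = int k" "fst s rX = x" "fst s rQ = int q" and k: "k < v"
    and Z: "\<And>j. j < t \<Longrightarrow> Z j k = int (z j k)" and V: "V k q" and q: "q < W"
    and post: "\<And>s'. env D (\<lambda>j i. if i = k then decode z P M k q j else Z j i) s' \<Longrightarrow>
      fst s' rK = int k \<Longrightarrow> fst s' rX = x \<Longrightarrow> cells W s' = cells W s \<Longrightarrow> Q s'"
  shows "wp S (column_prog t) (2 + t * (2 + 2)) Q s"
proof -
  let ?Z = "\<lambda>n j i. if i = k \<and> j < n then decode z P M k q j else Z j i"
  define inv where "inv n s' \<longleftrightarrow> env D (?Z n) s' \<and> fst s' rK = int k \<and> fst s' rX = x \<and>
    fst s' rQ = int (q div M ^ n) \<and> fst s' rJ = int n \<and> cells W s' = cells W s" for n s'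
  show ?thesis unfolding column_prog_def
  proof (rule wp_For[where Inv = inv])
    show "inv 0 (setr s rJ 0)" using assms by (simp add: inv_def)
    show "val s (Const (int t)) = int t \<and> fst s rJ = int i" if "inv i s" for i s
      using that by (simp add: inv_def)
    show "int t < 2 ^ S" by (rule nat_less_S) simp
    show "Q s'" if "inv t s'" for s'
    proof (rule post)
      show "env D (\<lambda>j i. if i = k then decode z P M k q j else Z j i) s'"
        using that by (auto simp: inv_def elim!: env_cong)
    qed (use that in \<open>simp_all add: inv_def\<close>)
    fix n s1 assume n: "n < t" and i1: "inv n s1"
    let ?st = "Sub (Add (Mul (Const 2) (Mem (zA (Reg rJ)))) (Sub (Reg rQ) (Mul (Reg rM) (Div (Reg rQ) (Reg rM))))) (Reg rP)"
    have e1: "env D (?Z n) s1" and s1: "fst s1 rK = int k" "fst s1 rX = x" "fst s1 rQ = int (q div M ^ n)"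
      "fst s1 rJ = int n" "cells W s1 = cells W s" using i1 by (auto simp: inv_def)
    have z1: "val s1 (Mem (zA (Reg rJ))) = int (z n k)" "val s1 (zA (Reg rJ)) = adr 0 (n * v + k)"
      using val_z[OF e1 _ s1(1) n k, of "Reg rJ"] Z[OF n] s1(4) by auto
    have "int (q div M ^ n) - int M * (int (q div M ^ n) div int M) = int (digit M n q)"
      by (simp only: digit_def zmod_int minus_mult_div_eq_mod)
    then have st: "val s1 ?st = decode z P M k q n"
      using s1 e1 unfolding val.simps(4-7,1) z1(1) decode_def by (simp add: env_reg[OF e1])
    define s2 where "s2 = setm s1 (adr 0 (n * v + k)) (decode z P M k q n)"
    have e2: "env D (?Z (Suc n)) s2"
      unfolding s2_def using env_setz[OF e1 n k, of "decode z P M k q n"]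
      by (rule env_cong) auto
    have s2: "fst s2 rK = int k" "fst s2 rX = x" "fst s2 rQ = int (q div M ^ n)"
      "fst s2 rJ = int n" "cells W s2 = cells W s" using s1 by (simp_all add: s2_def)
    have "q div M ^ n div M = q div M ^ Suc n" by (simp add: div_mult2_eq mult.commute[of M])
    then have q2: "val s2 (Div (Reg rQ) (Reg rM)) = int (q div M ^ Suc n)"
      using s2(3) env_reg[OF e2] by (simp add: zdiv_int[symmetric] del: power_Suc)
    have "\<bar>val s1 ?st\<bar> < 2 ^ S"
    proof -
      have "int (2 * A + P) < 2 ^ S" using S_load by (simp only: of_nat_less_numeral_power_cancel_iff)
      then show ?thesis unfolding st using decode_bounds[OF V n k] by simp
    qed
    moreover have "\<bar>val s2 (Div (Reg rQ) (Reg rM))\<bar> < 2 ^ S"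
    proof -
      have "q div M ^ Suc n \<le> W" using q by (meson div_le_dividend le_trans less_imp_le)
      then have "int (q div M ^ Suc n) < 2 ^ S" by (intro nat_less_S) simp
      then show ?thesis unfolding q2 by simp
    qed
    moreover have "fst (setr s2 rQ (int (q div M ^ Suc n))) rJ = int n \<and>
        inv (Suc n) (setr (setr s2 rQ (int (q div M ^ Suc n))) rJ (int n + 1))"
      using e2 s2 by (simp add: inv_def del: power_Suc)
    ultimately have "wp S (Seq (Store (zA (Reg rJ)) ?st) (Assign rQ (Div (Reg rQ) (Reg rM)))) (1 + 1)
         (\<lambda>s'. fst s' rJ = int n \<and> inv (Suc n) (setr s' rJ (int n + 1))) s1"
      by (intro wp_Seq wp_Store wp_Assign) (simp_all only: z1(2) st s2_def[symmetric] q2)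
    then show "wp S (Seq (Store (zA (Reg rJ)) ?st) (Assign rQ (Div (Reg rQ) (Reg rM)))) 2
         (\<lambda>s'. fst s' rJ = int n \<and> inv (Suc n) (setr s' rJ (int n + 1))) s1"
      by (rule wp_mono) auto
  qed
qed

definition extract_time :: nat where
  "extract_time = 1 + (1 + v * (1 + (1 + (1 + (1 + (2 + t * (2 + 2)))))))"

lemma wp_extract:
  assumes e: "E s" and g: "fst s rX = int g" "g < W" "0 < fst (\<T> v g)"
    and tabs: "\<And>k p. k \<le> v \<Longrightarrow> p < W \<Longrightarrow> cells W s k p = \<T> k p"
    and post: "\<And>s'. env D (\<lambda>j k. decode z P M k (chosen V c v g k) j) s' \<Longrightarrow> Q s'"
  shows "wp S (extract_prog t) extract_time Q s"
proof -
  let ?f = "chosen V c v g"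
  \<comment> \<open>Columns below \<open>k\<close> still hold \<open>z\<close>, the others the new
    plan; \<open>rX\<close> is the position in layer \<open>k\<close> from which backtracking agrees
    with that from \<open>g\<close>.\<close>
  define inv where "inv k s' \<longleftrightarrow> k \<le> v \<and>
    env D (\<lambda>j i. if i < k then int (z j i) else decode z P M i (?f i) j) s' \<and> fst s' rK = int k \<and>
    (\<forall>k\<le>v. \<forall>p<W. cells W s' k p = \<T> k p) \<and>
    (\<exists>p<W. fst s' rX = int p \<and> 0 < fst (\<T> k p) \<and> (\<forall>i<k. ?f i = chosen V c k p i))" for k s'
  let ?body = "Seq (Assign rQ (Sub (Mem (cellA 1 (Reg rK) (Reg rX))) (Const 1)))
     (Seq (Assign rK (Sub (Reg rK) (Const 1))) (Seq (Assign rX (Sub (Reg rX) (Reg rQ))) (column_prog t)))"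
  have "wp S (WhilePos (Reg rK) ?body) (1 + v * (1 + (1 + (1 + (1 + (2 + t * (2 + 2))))))) Q (setr s rK (int v))"
  proof (rule wp_WhilePos[where Inv = inv])
    show "inv v (setr s rK (int v))"
      using e g tabs by (auto simp: inv_def elim!: env_cong)
    show "Q s" if "inv k s" "\<not> 0 < val s (Reg rK)" for k s
      using that by (intro post) (auto simp: inv_def)
    fix k0 s1 assume i1: "inv k0 s1" and pos: "0 < val s1 (Reg rK)"
    then obtain k where k0: "k0 = Suc k" by (cases k0) (auto simp: inv_def)
    have k: "k < v" using i1 k0 by (simp add: inv_def)
    obtain p where p: "p < W" "fst s1 rX = int p" "0 < fst (\<T> (Suc k) p)"
      "\<And>i. i < Suc k \<Longrightarrow> ?f i = chosen V c (Suc k) p i"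
      using i1 by (auto simp: inv_def k0 simp del: tab.simps chosen.simps)
    define q where "q = nat (fst (\<T> (Suc k) p)) - 1"
    note st = tab_step[OF p(3), folded q_def]
    have fk: "?f k = q" using p(4)[of k] by (simp add: q_def Let_def del: tab.simps)
    have fi: "?f i = chosen V c k (p - q) i" if "i < k" for i
      using p(4)[of i] that by (simp add: q_def Let_def del: tab.simps)
    have e1: "env D (\<lambda>j i. if i < Suc k then int (z j i) else decode z P M i (?f i) j) s1"
      and r1: "fst s1 rK = int (Suc k)"
      and t1: "\<And>k p. k \<le> v \<Longrightarrow> p < W \<Longrightarrow> cells W s1 k p = \<T> k p"
      using i1 by (auto simp: inv_def k0 simp del: tab.simps)
    have a: "val s1 (cellA 1 (Reg rK) (Reg rX)) = adr 1 (Suc k * W + p)"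
      using r1 p(2) env_reg[OF e1] by (intro val_cellA) auto
    have q1: "val s1 (Sub (Mem (cellA 1 (Reg rK) (Reg rX))) (Const 1)) = int q"
      unfolding val.simps a using t1[of "Suc k" p] k p(1) st(4) by (simp add: cells_def prod_eq_iff del: tab.simps)
    define s2 where "s2 = setr (setr (setr s1 rQ (int q)) rK (int k)) rX (int (p - q))"
    have s2: "env D (\<lambda>j i. if i < Suc k then int (z j i) else decode z P M i (?f i) j) s2"
      "fst s2 rK = int k" "fst s2 rX = int (p - q)" "fst s2 rQ = int q" "cells W s2 = cells W s1"
      using e1 by (simp_all add: s2_def)
    have col: "wp S (column_prog t) (2 + t * (2 + 2)) (\<lambda>s'. \<exists>i'<k0. inv i' s') s2"
    proof (rule wp_column[OF s2(1-4) k])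
      show "q < W" using st(1) p(1) by simp
      fix s' assume s': "env D (\<lambda>j i. if i = k then decode z P M k q j else
          if i < Suc k then int (z j i) else decode z P M i (?f i) j) s'"
        "fst s' rK = int k" "fst s' rX = int (p - q)" "cells W s' = cells W s2"
      have "inv k s'" unfolding inv_def
      proof (intro conjI exI[of _ "p - q"])
        show "env D (\<lambda>j i. if i < k then int (z j i) else decode z P M i (?f i) j) s'"
          using s'(1) by (rule env_cong) (auto simp: fk)
      qed (use s' s2 t1 k p fi st in \<open>auto simp del: tab.simps\<close>)
      then show "\<exists>i'<k0. inv i' s'" using k0 by blast
    qed (use st in simp_all)
    have less: "\<bar>int n\<bar> < 2 ^ S" if "n \<le> W + v" for n using that nat_less_S[of n] by simp
    have "wp S ?body (1 + (1 + (1 + (2 + t * (2 + 2))))) (\<lambda>s'. \<exists>i'<k0. inv i' s') s1"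
    proof (intro wp_Seq wp_Assign)
      show "\<bar>val s1 (Sub (Mem (cellA 1 (Reg rK) (Reg rX))) (Const 1))\<bar> < 2 ^ S"
        unfolding q1 using p(1) st(1) by (intro less) simp
      have k2: "val (setr s1 rQ (int q)) (Sub (Reg rK) (Const 1)) = int k" using r1 by simp
      show "\<bar>val (setr s1 rQ (val s1 (Sub (Mem (cellA 1 (Reg rK) (Reg rX))) (Const 1)))) (Sub (Reg rK) (Const 1))\<bar> < 2 ^ S"
        unfolding q1 k2 using k by (intro less) simp
      have x2: "val (setr (setr s1 rQ (int q)) rK (int k)) (Sub (Reg rX) (Reg rQ)) = int (p - q)"
        using p(2) st(1) by simp
      show "\<bar>val (setr (setr s1 rQ (val s1 (Sub (Mem (cellA 1 (Reg rK) (Reg rX))) (Const 1)))) rK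
          (val (setr s1 rQ (val s1 (Sub (Mem (cellA 1 (Reg rK) (Reg rX))) (Const 1)))) (Sub (Reg rK) (Const 1))))
          (Sub (Reg rX) (Reg rQ))\<bar> < 2 ^ S"
        unfolding q1 k2 x2 using p(1) by (intro less) simp
      show "wp S (column_prog t) (2 + t * (2 + 2)) (\<lambda>s'. \<exists>i'<k0. inv i' s')
         (setr (setr (setr s1 rQ (val s1 (Sub (Mem (cellA 1 (Reg rK) (Reg rX))) (Const 1)))) rK
          (val (setr s1 rQ (val s1 (Sub (Mem (cellA 1 (Reg rK) (Reg rX))) (Const 1)))) (Sub (Reg rK) (Const 1)))) rX
          (val (setr (setr s1 rQ (val s1 (Sub (Mem (cellA 1 (Reg rK) (Reg rX))) (Const 1)))) rK
            (val (setr s1 rQ (val s1 (Sub (Mem (cellA 1 (Reg rK) (Reg rX))) (Const 1)))) (Sub (Reg rK) (Const 1))))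
            (Sub (Reg rX) (Reg rQ))))"
        unfolding q1 k2 x2 using col unfolding s2_def .
    qed
    then show "wp S ?body (1 + (1 + (1 + (2 + t * (2 + 2))))) (\<lambda>s'. \<exists>i'<k0. inv i' s') s1" .
  qed
  moreover have "\<bar>val s (Reg rV)\<bar> < 2 ^ S" "val s (Reg rV) = int v"
    using env_reg[OF e] nat_less_S[of v] by simp_all
  ultimately show ?thesis unfolding extract_prog_def extract_time_def
    by (intro wp_Seq wp_Assign) (simp_all only:)
qed

lemma val_goalE:
  assumes "E s"
  shows "val s (goalE t) = int (goal_code t I D P M)"
proof -
  have "2 * (n div (2 * D)) \<le> n div D" for n :: nat
    by (simp add: div_mult2_eq mult.commute[of 2 D])
  then have r: "int (n div D - 2 * (n div (2 * D))) = int n div int D - 2 * (int n div (2 * int D))" for n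
    by (simp add: of_nat_diff zdiv_int)
  show ?thesis unfolding goalE_def goal_code_def of_nat_sum of_nat_mult of_nat_add of_nat_power r
    by (simp add: val_itemsE[OF assms] env_reg[OF assms])
qed

end

context machine
begin

definition failed :: "state \<Rightarrow> bool" where
  "failed s \<longleftrightarrow> fst s rOK = 0 \<and> (\<nexists>y. feasible t w I y)"

definition solved :: "nat \<Rightarrow> state \<Rightarrow> bool" where
  "solved D s \<longleftrightarrow> (\<exists>x. optimal t w (coarse t w D I) x \<and> env D (\<lambda>j k. int (x j k)) s)"

text \<open>Free of the scale and of the current plan, because all rounds of the main loop share
  this bound.\<close>

definition refine_time :: nat where
  "refine_time = 1 + ((2 + W * 4) + (1 + (2 + v * ((2 + W * (4 + W * 7 + 2)) + 2)))
     + (1 + (1 + (1 + (1 + v * (1 + (1 + (1 + (1 + (2 + t * (2 + 2)))))))))))"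

lemma feasible_le:
  assumes "feasible t w J x" "j < t" "k < vessels J"
  shows "x j k \<le> items J j"
proof -
  have "x j k \<le> (\<Sum>k<vessels J. x j k)" using assms by (intro member_le_sum) auto
  then show ?thesis using assms by (simp add: feasible_def)
qed

lemma wp_refine:
  assumes w: "\<And>j. j < t \<Longrightarrow> 0 < w j" and P: "int P = prox t w v"
    and D: "0 < D" "int D < 2 ^ S" and s: "solved (2 * D) s"
  shows "wp S (refine_prog t w) refine_time (\<lambda>s'. solved D s' \<or> failed s') s"
proof -
  obtain z where z: "optimal t w (coarse t w (2 * D) I) z" "env (2 * D) (\<lambda>j k. int (z j k)) s"
    using s by (auto simp: solved_def)
  interpret refine S t w I P M A D z
  proof
    show "0 < D" by (rule D)
    fix j k assume "j < t" "k < v"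
    then have "z j k \<le> items I j div (2 * D)"
      using feasible_le[of "coarse t w (2 * D) I" z j k] z(1) by (simp add: optimal_def)
    also have "\<dots> \<le> A" using items_le[OF \<open>j < t\<close>] by (meson div_le_dividend le_trans)
    finally show "z j k \<le> A" .
  qed
  define g where "g = goal_code t I D P M"
  have gW: "g < W" unfolding g_def using M_gt by (intro goal_code_less) simp
  note correct = dp_correct[OF w D(1) z(1) P M_gt, folded g_def]
  let ?Q = "\<lambda>s'. solved D s' \<or> failed s'"
  have d: "val s (Div (Reg rD) (Const 2)) = int D" using env_reg[OF z(2)] by simp
  have e1: "E (setr s rD (int D))" using z(2) by (auto simp: env_def)
  have rest: "wp S (Seq (Assign rX (goalE t))
       (IfPos (Mem (cellA 1 (Reg rV) (Reg rX))) (extract_prog t) (Assign rOK (Const 0))))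
     (1 + (1 + extract_time)) ?Q s1"
    if s1: "E s1" "\<forall>k\<le>v. \<forall>p<W. cells W s1 k p = \<T> k p" for s1
  proof (rule wp_Seq, rule wp_Assign)
    note gv = val_goalE[OF s1(1), folded g_def]
    show "\<bar>val s1 (goalE t)\<bar> < 2 ^ S" unfolding gv using nat_less_S[of g] gW by simp
    define s2 where "s2 = setr s1 rX (int g)"
    have s2: "E s2" "fst s2 rX = int g" "cells W s2 = cells W s1" using s1 by (simp_all add: s2_def)
    have a: "val s2 (cellA 1 (Reg rV) (Reg rX)) = adr 1 (v * W + g)"
      using s2 by (intro val_cellA) (auto simp: env_reg)
    have f: "val s2 (Mem (cellA 1 (Reg rV) (Reg rX))) = fst (\<T> v g)"
    proof -
      have "cells W s2 v g = \<T> v g" using s1(2) gW s2(3) by simp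
      then have "fst (cells W s2 v g) = fst (\<T> v g)" by simp
      then show ?thesis unfolding val.simps a by (simp add: cells_def)
    qed
    have "wp S (IfPos (Mem (cellA 1 (Reg rV) (Reg rX))) (extract_prog t) (Assign rOK (Const 0)))
       (1 + extract_time) ?Q s2"
    proof (rule wp_IfPos)
      assume "0 < val s2 (Mem (cellA 1 (Reg rV) (Reg rX)))"
      then have pos: "0 < fst (\<T> v g)" by (simp only: f)
      show "wp S (extract_prog t) extract_time ?Q s2"
      proof (rule wp_extract[OF s2(1,2) gW pos])
        fix s' assume e': "env D (\<lambda>j k. decode z P M k (chosen V c v g k) j) s'"
        have "env D (\<lambda>j k. int (nat (decode z P M k (chosen V c v g k) j))) s'"
          using e' by (rule env_cong) (use tab_sound[OF pos] decode_bounds(1) in auto)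
        then show "?Q s'" using correct(1)[OF _ pos] by (auto simp: solved_def)
      qed (use s1 s2 in simp)
    next
      assume "\<not> 0 < val s2 (Mem (cellA 1 (Reg rV) (Reg rX)))"
      then have "\<not> 0 < fst (\<T> v g)" by (simp only: f not_False_eq_True)
      then have "\<nexists>y. feasible t w J y" using correct(2) by blast
      \<comment> \<open>Contraposition of \<open>feasible_coarse\<close>: infeasibility at one scale
        settles the original instance, so the search can stop at once.\<close>
      then have "\<nexists>y. feasible t w I y" using feasible_coarse[OF _ D(1)] by blast
      then have "failed (setr s2 rOK 0)" by (simp add: failed_def)
      then show "wp S (Assign rOK (Const 0)) extract_time ?Q s2"
        by (intro wp_mono[OF wp_Assign[where Q = ?Q]]) (simp_all add: extract_time_def)
    qed
    then show "wp S (IfPos (Mem (cellA 1 (Reg rV) (Reg rX))) (extract_prog t) (Assign rOK (Const 0)))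
       (1 + extract_time) ?Q (setr s1 rX (val s1 (goalE t)))" unfolding s2_def gv .
  qed
  have "wp S (refine_prog t w) (1 + (table_time + (1 + (1 + extract_time)))) ?Q s"
    unfolding refine_prog_def
  proof (rule wp_Seq, rule wp_Assign)
    show "\<bar>val s (Div (Reg rD) (Const 2))\<bar> < 2 ^ S" unfolding d using D by simp
    have "wp S (Seq (table_prog t w) (Seq (Assign rX (goalE t))
       (IfPos (Mem (cellA 1 (Reg rV) (Reg rX))) (extract_prog t) (Assign rOK (Const 0)))))
       (table_time + (1 + (1 + extract_time))) ?Q (setr s rD (int D))"
      by (rule wp_Seq, rule wp_mono[OF wp_table[OF e1]]) (use rest in auto)
    then show "wp S (Seq (table_prog t w) (Seq (Assign rX (goalE t))
       (IfPos (Mem (cellA 1 (Reg rV) (Reg rX))) (extract_prog t) (Assign rOK (Const 0)))))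
       (table_time + (1 + (1 + extract_time))) ?Q (setr s rD (val s (Div (Reg rD) (Const 2))))"
      unfolding d .
  qed
  then show ?thesis
    unfolding refine_time_def table_time_def layer_time_def extract_time_def by (rule wp_mono) auto
qed

end

section \<open>The complete program\<close>

lemma length_table: "length (table t v f) = t * v"
  by (induction t) (auto simp: table_def)

lemma nth_table:
  assumes "q < t * v"
  shows "table t v f ! q = f (q div v) (q mod v)"
  using assms
proof (induction t)
  case (Suc t)
  have eq: "table (Suc t) v f = table t v f @ map (f t) [0..<v]" by (simp add: table_def)
  show ?case
  proof (cases "q < t * v")
    case True
    then show ?thesis using Suc.IH by (simp add: eq nth_append length_table)
  next
    case False
    define r where "r = q - t * v"
    have r: "q = r + t * v" "r < v" using False Suc.prems by (auto simp: r_def)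
    then have "q div v = t" "q mod v = r" by auto
    then show ?thesis using r False by (simp add: eq nth_append length_table)
  qed
qed simp

text \<open>\<open>P\<close> depends on the number of vessels, hence on the input, so the machine
  computes it; the depth of the recursion depends on \<open>t\<close> alone and is unrolled.\<close>

primrec thresholdE :: "expr \<Rightarrow> expr \<Rightarrow> expr \<Rightarrow> expr \<Rightarrow> nat \<Rightarrow> expr" where
  "thresholdE a W c v 0 = a"
| "thresholdE a W c v (Suc i) = Add (Add c (Const 1)) (Mul W (Add (Add c (Const 1)) (Mul v (thresholdE a W c v i))))"

lemma val_thresholdE [simp]:
  "val s (thresholdE a W c v i) = threshold (val s a) (val s W) (val s c) (val s v) i"
  by (induction i) auto

definition proxE :: "nat \<Rightarrow> (nat \<Rightarrow> nat) \<Rightarrow> expr" where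
  "proxE t w = thresholdE (Const (2 * int (\<Prod>j<t. w j))) (Const (int (\<Sum>j<t. w j) + 1))
     (Mul (Add (Reg rV) (Const 1)) (Const (2 * int (\<Sum>j<t. w j) + 1))) (Reg rV) (t + 2)"

text \<open>The base \<open>(2 * P + 2) * (v + 1)\<close>, for \<open>v\<close> vessels, exceeds
  both \<open>2 * v * P + 1\<close> and \<open>2 * P\<close>, which rules out carries.\<close>

definition init_prog :: "nat \<Rightarrow> (nat \<Rightarrow> nat) \<Rightarrow> prog" where
  "init_prog t w = Seq (Assign rV (Mem (Const 0))) (Seq (Assign rP (proxE t w))
    (Seq (Assign rM (Mul (Add (Mul (Const 2) (Reg rP)) (Const 2)) (Add (Reg rV) (Const 1))))
    (Seq (Assign rW (powE (Reg rM) t)) (Seq (Assign rD (Const 1)) (Assign rOK (Const 1))))))"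

definition grow_prog :: "nat \<Rightarrow> prog" where
  "grow_prog t = WhilePos (Sub (Add (sumE t itemsE) (Const 1)) (Reg rD)) (Assign rD (Mul (Const 2) (Reg rD)))"

definition output_prog :: "nat \<Rightarrow> prog" where
  "output_prog t = Seq (For rK (Mul (Const (int t)) (Reg rV))
     (Store (Add (Const 1) (Reg rK)) (Mem (adrE 0 (Reg rK))))) (Store (Const 0) (Const 1))"

definition shipment_prog :: "nat \<Rightarrow> (nat \<Rightarrow> nat) \<Rightarrow> prog" where
  "shipment_prog t w = Seq (init_prog t w) (Seq (grow_prog t)
     (Seq (WhilePos (Mul (Reg rOK) (Sub (Reg rD) (Const 1))) (refine_prog t w))
       (IfPos (Reg rOK) (output_prog t) (Store (Const 0) (Const 0)))))"

context machine
begin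

lemma wp_init:
  assumes P: "int P = prox t w v" and M: "M = (2 * P + 2) * (v + 1)" "M < 2 ^ S"
    and s: "input s" "snd s 0 = int v" "\<And>q. snd s (adr 0 q) = 0"
  shows "wp S (init_prog t w) (1 + (1 + (1 + (1 + (1 + 1))))) (env 1 (\<lambda>j k. 0)) s"
proof -
  have less: "\<bar>int n\<bar> < 2 ^ S" if "n \<le> W + v + 2" for n using that nat_less_S[of n] by simp
  have "P < 2 ^ S" using S_load by linarith
  then have PS: "\<bar>int P\<bar> < 2 ^ S" and MS: "\<bar>int M\<bar> < 2 ^ S"
    using M(2) by (simp_all only: abs_of_nat of_nat_less_numeral_power_cancel_iff)
  have Mi: "(2 * int P + 2) * (int v + 1) = int M" unfolding M(1) by (simp add: algebra_simps)
  define s1 where "s1 = setr s rV (int v)"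
  define s2 where "s2 = setr s1 rP (int P)"
  define s3 where "s3 = setr s2 rM (int M)"
  define s4 where "s4 = setr s3 rW (int W)"
  define s5 where "s5 = setr s4 rD 1"
  have v1: "val s (Mem (Const 0)) = int v" using s by simp
  have v2: "val s1 (proxE t w) = int P" by (simp add: proxE_def s1_def P prox_def)
  have v3: "val s2 (Mul (Add (Mul (Const 2) (Reg rP)) (Const 2)) (Add (Reg rV) (Const 1))) = int M"
    by (simp add: s2_def s1_def Mi)
  have v4: "val s3 (powE (Reg rM) t) = int W" by (simp add: s3_def)
  have fin: "env 1 (\<lambda>j k. 0) (setr s5 rOK 1)"
    using s by (simp add: env_def s5_def s4_def s3_def s2_def s1_def)
  show ?thesis unfolding init_prog_def
    by (intro wp_Seq wp_Assign)
      (simp_all only: v1 s1_def[symmetric] v2 s2_def[symmetric] v3 s3_def[symmetric] v4 s4_def[symmetric]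
        val.simps(1) s5_def[symmetric] fin PS MS less[of v] less[of W] le_add1 le_add2 add.assoc, use less[of 1] less[of v] less[of W] in simp_all)
qed

text \<open>Once the scale exceeds the total number of items, all numbers of items are rounded to
  \<open>0\<close>, every feasible plan vanishes, and the zero plan is optimal. The cells of the
  plan are still \<open>0\<close>, so nothing has to be stored.\<close>

lemma wp_grow:
  assumes L: "(\<Sum>j<t. items I j) < 2 ^ L" "L < S" and s: "env 1 (\<lambda>j k. 0) s"
  shows "wp S (grow_prog t) (1 + L * (1 + 1)) (\<lambda>s'. \<exists>e\<le>L. solved (2 ^ e) s') s"
  unfolding grow_prog_def
proof (rule wp_WhilePos[where Inv = "\<lambda>i s. \<exists>e. e + i = L \<and> env (2 ^ e) (\<lambda>j k. 0) s"])
  show "\<exists>e. e + L = L \<and> env (2 ^ e) (\<lambda>j k. 0) s" using s by simp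
  have guard: "val s (Sub (Add (sumE t itemsE) (Const 1)) (Reg rD)) = int (\<Sum>j<t. items I j) + 1 - 2 ^ e"
    if "env (2 ^ e) (\<lambda>j k. 0) s" for e s
    using that by (simp add: val_itemsE env_reg)
  show "\<exists>e\<le>L. solved (2 ^ e) s"
    if i: "\<exists>e. e + i = L \<and> env (2 ^ e) (\<lambda>j k. 0) s" and g: "\<not> 0 < val s (Sub (Add (sumE t itemsE) (Const 1)) (Reg rD))" for i s
  proof -
    obtain e where e: "e + i = L" "env (2 ^ e) (\<lambda>j k. 0) s" using i by blast
    have "int (\<Sum>j<t. items I j) < int (2 ^ e)" using g unfolding guard[OF e(2)] by simp
    then have big: "(\<Sum>j<t. items I j) < 2 ^ e" by linarith
    have zero: "items I j div 2 ^ e = 0" if "j < t" for j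
    proof -
      have "items I j \<le> (\<Sum>j<t. items I j)" using that by (intro member_le_sum) auto
      then show ?thesis using big by simp
    qed
    have "optimal t w (coarse t w (2 ^ e) I) (\<lambda>j k. 0)"
      unfolding optimal_def
    proof (intro conjI allI impI)
      show "feasible t w (coarse t w (2 ^ e) I) (\<lambda>j k. 0)" using zero by (simp add: feasible_def)
      fix y assume y: "feasible t w (coarse t w (2 ^ e) I) y"
      have "y j k = 0" if "j < t" "k < v" for j k
        using feasible_le[OF y, of j k] zero[OF that(1)] that by simp
      then show "total_cost t (coarse t w (2 ^ e) I) (\<lambda>j k. 0) \<le> total_cost t (coarse t w (2 ^ e) I) y"
        by (simp add: total_cost_def)
    qed
    then show ?thesis using e by (intro exI[of _ e]) (auto simp: solved_def intro!: exI[of _ "\<lambda>j k. 0"])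
  qed
  show "wp S (Assign rD (Mul (Const 2) (Reg rD))) 1 (\<lambda>s'. \<exists>i'<i. \<exists>e. e + i' = L \<and> env (2 ^ e) (\<lambda>j k. 0) s') s"
    if i: "\<exists>e. e + i = L \<and> env (2 ^ e) (\<lambda>j k. 0) s" and g: "0 < val s (Sub (Add (sumE t itemsE) (Const 1)) (Reg rD))" for i s
  proof -
    obtain e where e: "e + i = L" "env (2 ^ e) (\<lambda>j k. 0) s" using i by blast
    have "int (2 ^ e) \<le> int (\<Sum>j<t. items I j)" using g unfolding guard[OF e(2)] by simp
    then have "(2::nat) ^ e < 2 ^ L" using L(1) by linarith
    then have eL: "e < L" by simp
    have d: "val s (Mul (Const 2) (Reg rD)) = 2 ^ Suc e" using env_reg[OF e(2)] by simp
    have "env (2 ^ Suc e) (\<lambda>j k. 0) (setr s rD (2 ^ Suc e))" using e(2) by (auto simp: env_def)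
    then have "\<exists>i'<i. \<exists>e. e + i' = L \<and> env (2 ^ e) (\<lambda>j k. 0) (setr s rD (2 ^ Suc e'))" if "e' = e" for e'
      using eL e(1) that by (intro exI[of _ "i - 1"] conjI exI[of _ "Suc e"]) auto
    moreover have "\<bar>2 ^ Suc e\<bar> < (2::int) ^ S" using eL L(2) by (simp del: power_Suc)
    ultimately show ?thesis by (intro wp_Assign) (simp_all only: d)
  qed
qed

lemma wp_main_loop:
  assumes w: "\<And>j. j < t \<Longrightarrow> 0 < w j" and P: "int P = prox t w v"
    and e: "e < S" "solved (2 ^ e) s"
  shows "wp S (WhilePos (Mul (Reg rOK) (Sub (Reg rD) (Const 1))) (refine_prog t w)) (1 + e * (1 + refine_time))
    (\<lambda>s'. solved 1 s' \<or> failed s') s"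
\<comment> \<open>The variant is the exponent of the scale. After a failure the flag makes the guard
  \<open>0\<close> whatever scale has been reached, so the exponent is tied to the state only in the
  solved case.\<close>
proof (rule wp_WhilePos[where Inv = "\<lambda>i s. i < S \<and> (solved (2 ^ i) s \<or> failed s)"])
  have guard: "val s (Mul (Reg rOK) (Sub (Reg rD) (Const 1))) = 2 ^ i - 1" if "solved (2 ^ i) s" for i s
    using that by (auto simp: solved_def env_reg)
  have guardf: "val s (Mul (Reg rOK) (Sub (Reg rD) (Const 1))) = 0" if "failed s" for s
    using that by (simp add: failed_def)
  show "e < S \<and> (solved (2 ^ e) s \<or> failed s)" using e by simp
  show "solved 1 s \<or> failed s" if "i < S \<and> (solved (2 ^ i) s \<or> failed s)"
    "\<not> 0 < val s (Mul (Reg rOK) (Sub (Reg rD) (Const 1)))" for i s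
  proof (cases "failed s")
    case False
    then have "solved (2 ^ i) s" using that by simp
    moreover have "i = 0"
    proof (rule ccontr)
      assume "i \<noteq> 0"
      then have "(1::int) < 2 ^ i" by (intro one_less_power) auto
      then show False using that(2) unfolding guard[OF calculation] by linarith
    qed
    ultimately show ?thesis by simp
  qed simp
  show "wp S (refine_prog t w) refine_time (\<lambda>s'. \<exists>i'<i. i' < S \<and> (solved (2 ^ i') s' \<or> failed s')) s"
    if i: "i < S \<and> (solved (2 ^ i) s \<or> failed s)" and g: "0 < val s (Mul (Reg rOK) (Sub (Reg rD) (Const 1)))" for i s
  proof -
    have sol: "solved (2 ^ i) s" using i g guardf by fastforce
    then obtain i' where i': "i = Suc i'" using g guard[OF sol] by (cases i) auto
    have "wp S (refine_prog t w) refine_time (\<lambda>s'. solved (2 ^ i') s' \<or> failed s') s"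
      using sol i i' by (intro wp_refine w P) auto
    then show ?thesis by (rule wp_mono) (use i i' in auto)
  qed
qed

text \<open>The plan is copied over the input, so the invariant forgets the input and keeps what the
  copying reads: the register \<open>rV\<close> and the negative addresses.\<close>

lemma wp_output:
  assumes s: "env 1 (\<lambda>j k. int (x j k)) s" and x: "\<And>j k. j < t \<Longrightarrow> k < v \<Longrightarrow> x j k \<le> A"
    and tv: "t * v < 2 ^ S"
  shows "wp S (output_prog t) ((2 + t * v * (1 + 2)) + 1)
    (\<lambda>s'. has_output s' (1 # table t v (\<lambda>j k. int (x j k)))) s"
proof -
  let ?T = "table t v (\<lambda>j k. int (x j k))"
  define inv where "inv i s' \<longleftrightarrow> fst s' rV = int v \<and> fst s' rK = int i \<and>
    (\<forall>q<t * v. snd s' (adr 0 q) = ?T ! q) \<and> (\<forall>q<i. snd s' (1 + int q) = ?T ! q)" for i s'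
  have jk: "q div v < t" "q mod v < v" if "q < t * v" for q
    using that by (auto simp: less_mult_imp_div_less) (metis mult_0_right not_less_zero mod_less_divisor neq0_conv)
  have one: "(1::int) < 2 ^ S" using nat_less_S[of 1] by simp
  show ?thesis unfolding output_prog_def
  proof (rule wp_Seq, rule wp_For[where Inv = inv])
    show "inv 0 (setr s rK 0)"
    proof -
      have "snd s (adr 0 q) = ?T ! q" if q: "q < t * v" for q
      proof -
        have "snd s (adr 0 (q div v * v + q mod v)) = int (x (q div v) (q mod v))"
          using s jk[OF q] unfolding env_def by blast
        then show ?thesis using q by (simp add: nth_table)
      qed
      then show ?thesis using env_reg[OF s] by (simp add: inv_def)
    qed
    show "val s (Mul (Const (int t)) (Reg rV)) = int (t * v) \<and> fst s rK = int i" if "inv i s" for i s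
      using that by (simp add: inv_def)
    show "int (t * v) < 2 ^ S" using tv by (simp only: of_nat_less_numeral_power_cancel_iff)
    show "wp S (Store (Const 0) (Const 1)) 1 (\<lambda>s'. has_output s' (1 # ?T)) s" if "inv (t * v) s" for s
      using that one by (intro wp_Store) (auto simp: inv_def has_output_def length_table nth_Cons split: nat.splits)
    fix i s1 assume i: "i < t * v" and i1: "inv i s1"
    have a: "val s1 (Add (Const 1) (Reg rK)) = 1 + int i" using i1 by (simp add: inv_def)
    have "val s1 (adrE 0 (Reg rK)) = adr 0 i" using i1 by (intro val_adrE) (simp add: inv_def)
    then have b: "val s1 (Mem (adrE 0 (Reg rK))) = ?T ! i" using i1 i by (simp add: inv_def)
    have "?T ! i = int (x (i div v) (i mod v))" using i by (simp add: nth_table)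
    moreover have "x (i div v) (i mod v) < 2 ^ S" using x[OF jk[OF i]] S_load by linarith
    ultimately have "\<bar>?T ! i\<bar> < 2 ^ S" by simp
    then show "wp S (Store (Add (Const 1) (Reg rK)) (Mem (adrE 0 (Reg rK)))) 1
        (\<lambda>s'. fst s' rK = int i \<and> inv (Suc i) (setr s' rK (int i + 1))) s1"
      using i1 by (intro wp_Store) (simp_all only: a b, auto simp: inv_def less_Suc_eq)
  qed
qed

definition total_time :: "nat \<Rightarrow> nat" where
  "total_time L = 6 + ((1 + L * 2) + ((1 + L * (1 + refine_time)) + (1 + ((2 + t * v * 3) + 1))))"

lemma wp_shipment:
  assumes w: "\<And>j. j < t \<Longrightarrow> 0 < w j" and P: "int P = prox t w v"
    and M: "M = (2 * P + 2) * (v + 1)" "M < 2 ^ S"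
    and s: "input s" "snd s 0 = int v" "\<And>q. snd s (adr 0 q) = 0"
    and L: "(\<Sum>j<t. items I j) < 2 ^ L" "L < S" and tv: "t * v < 2 ^ S"
  shows "wp S (shipment_prog t w) (total_time L)
    (\<lambda>s'. \<exists>ys. has_output s' ys \<and> shipment_answer t w I ys) s"
proof -
  let ?Q = "\<lambda>s'. \<exists>ys. has_output s' ys \<and> shipment_answer t w I ys"
  let ?final = "IfPos (Reg rOK) (output_prog t) (Store (Const 0) (Const 0))"
  let ?loop = "WhilePos (Mul (Reg rOK) (Sub (Reg rD) (Const 1))) (refine_prog t w)"
  have final: "wp S ?final (1 + ((2 + t * v * (1 + 2)) + 1)) ?Q s" if "solved 1 s \<or> failed s" for s
  proof (rule wp_IfPos)
    assume "0 < val s (Reg rOK)"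
    then have "solved 1 s" using that by (auto simp: failed_def)
    then obtain x where x: "optimal t w I x" "env 1 (\<lambda>j k. int (x j k)) s"
      by (auto simp: solved_def)
    have "x j k \<le> A" if "j < t" "k < v" for j k
      using feasible_le[of I x j k] x(1) items_le[of j] that by (auto simp: optimal_def intro: order_trans)
    from wp_output[OF x(2) this tv] show "wp S (output_prog t) ((2 + t * v * (1 + 2)) + 1) ?Q s"
      by (rule wp_mono) (use x(1) in \<open>auto simp: shipment_answer_def\<close>)
  next
    assume "\<not> 0 < val s (Reg rOK)"
    then have "failed s" using that by (auto simp: solved_def env_reg)
    then have "shipment_answer t w I [0]" by (auto simp: failed_def shipment_answer_def)
    then have "wp S (Store (Const 0) (Const 0)) 1 ?Q s"
      by (intro wp_Store exI[of _ "[0]"]) (auto simp: has_output_def)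
    then show "wp S (Store (Const 0) (Const 0)) ((2 + t * v * (1 + 2)) + 1) ?Q s"
      by (rule wp_mono) auto
  qed
  have loop: "wp S (Seq ?loop ?final) ((1 + L * (1 + refine_time)) + (1 + ((2 + t * v * (1 + 2)) + 1))) ?Q s"
    if e: "e \<le> L" "solved (2 ^ e) s" for e s
  proof (rule wp_Seq)
    have "wp S ?loop (1 + e * (1 + refine_time)) (\<lambda>s'. solved 1 s' \<or> failed s') s"
    proof (rule wp_main_loop[OF _ P _ e(2)])
      show "e < S" using e(1) L(2) by simp
    qed (rule w)
    then show "wp S ?loop (1 + L * (1 + refine_time)) (wp S ?final (1 + ((2 + t * v * (1 + 2)) + 1)) ?Q) s"
    proof (rule wp_mono)
      show "1 + e * (1 + refine_time) \<le> 1 + L * (1 + refine_time)"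
        using e(1) by (intro add_mono mult_le_mono) auto
    qed (rule final)
  qed
  have "wp S (shipment_prog t w) ((1 + (1 + (1 + (1 + (1 + 1))))) + ((1 + L * (1 + 1)) +
      ((1 + L * (1 + refine_time)) + (1 + ((2 + t * v * (1 + 2)) + 1))))) ?Q s"
    unfolding shipment_prog_def
  proof (rule wp_Seq, rule wp_mono[OF wp_init[OF P M s]])
    fix s1 assume "env 1 (\<lambda>j k. 0) s1"
    note grow = wp_grow[OF L this]
    show "wp S (Seq (grow_prog t) (Seq ?loop ?final)) ((1 + L * (1 + 1)) +
      ((1 + L * (1 + refine_time)) + (1 + ((2 + t * v * (1 + 2)) + 1)))) ?Q s1"
    proof (rule wp_Seq, rule wp_mono[OF grow])
      fix s2 assume "\<exists>e\<le>L. solved (2 ^ e) s2"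
      then obtain e where "e \<le> L" "solved (2 ^ e) s2" by (elim exE conjE)
      then show "wp S (Seq ?loop ?final) ((1 + L * (1 + refine_time)) + (1 + ((2 + t * v * (1 + 2)) + 1))) ?Q s2"
        by (rule loop)
    qed (rule order_refl)
  qed (rule order_refl)
  then show ?thesis unfolding total_time_def by (rule wp_mono) auto
qed

end

section \<open>Polynomial running time\<close>

definition polynomially_bounded :: "('a \<Rightarrow> nat) \<Rightarrow> ('a \<Rightarrow> nat) \<Rightarrow> bool" where
  "polynomially_bounded sz f \<longleftrightarrow> (\<exists>q. \<forall>x. f x \<le> poly q (sz x))"

lemma polynomially_bounded_const: "polynomially_bounded sz (\<lambda>x. c)"
  unfolding polynomially_bounded_def by (rule exI[of _ "[:c:]"]) simp

lemma polynomially_bounded_le: "(\<And>x. f x \<le> sz x) \<Longrightarrow> polynomially_bounded sz f"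
  unfolding polynomially_bounded_def by (rule exI[of _ "[:0, 1:]"]) simp

lemma polynomially_bounded_add:
  "polynomially_bounded sz f \<Longrightarrow> polynomially_bounded sz g \<Longrightarrow> polynomially_bounded sz (\<lambda>x. f x + g x)"
  unfolding polynomially_bounded_def by (metis add_mono poly_add)

lemma polynomially_bounded_mult:
  "polynomially_bounded sz f \<Longrightarrow> polynomially_bounded sz g \<Longrightarrow> polynomially_bounded sz (\<lambda>x. f x * g x)"
  unfolding polynomially_bounded_def by (metis mult_le_mono poly_mult)

lemma polynomially_bounded_power:
  "polynomially_bounded sz f \<Longrightarrow> polynomially_bounded sz (\<lambda>x. f x ^ n)"
  by (induction n) (auto intro: polynomially_bounded_const polynomially_bounded_mult)

lemmas polynomially_bounded_intros = polynomially_bounded_const polynomially_bounded_add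
  polynomially_bounded_mult polynomially_bounded_power

lemma threshold_nonneg:
  "0 \<le> a \<Longrightarrow> 0 \<le> W \<Longrightarrow> 0 \<le> c \<Longrightarrow> 0 \<le> v \<Longrightarrow> 0 \<le> threshold a W c v i"
  by (induction i) auto

text \<open>The level is fixed while the instance varies; the degree may grow with \<open>i\<close>,
  which for \<open>prox\<close> is determined by \<open>t\<close>.\<close>

lemma polynomially_bounded_threshold:
  assumes "polynomially_bounded sz c" "polynomially_bounded sz v"
  shows "polynomially_bounded sz (\<lambda>x. nat (threshold (int a) (int W) (int (c x)) (int (v x)) i))"
proof (induction i)
  case (Suc i)
  have "nat (threshold (int a) (int W) (int (c x)) (int (v x)) (Suc i)) =
      c x + 1 + W * (c x + 1 + v x * nat (threshold (int a) (int W) (int (c x)) (int (v x)) i))" for x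
    using threshold_nonneg[of "int a" "int W" "int (c x)" "int (v x)" i]
    by (simp add: nat_add_distrib nat_mult_distrib)
  then show ?case using Suc assms by (simp only:) (intro polynomially_bounded_intros)
qed (simp add: polynomially_bounded_const)

lemma prox_nonneg: "0 \<le> prox t w v"
  unfolding prox_def by (intro threshold_nonneg) (simp_all add: sum_nonneg prod_nonneg)

lemma polynomially_bounded_prox:
  "polynomially_bounded sz v \<Longrightarrow> polynomially_bounded sz (\<lambda>x. nat (prox t w (v x)))"
proof -
  assume v: "polynomially_bounded sz v"
  have "prox t w n = threshold (int (2 * (\<Prod>j<t. w j))) (int ((\<Sum>j<t. w j) + 1))
     (int ((n + 1) * (2 * (\<Sum>j<t. w j) + 1))) (int n) (t + 2)" for n
    unfolding prox_def of_nat_mult of_nat_add of_nat_numeral of_nat_1 ..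
  then show ?thesis by (simp only:) (intro polynomially_bounded_threshold polynomially_bounded_intros v)
qed

lemma less_power_size:
  assumes "x \<in> set (shipment_data t I)"
  shows "\<bar>x\<bar> < 2 ^ shipment_size t I"
proof -
  have "int_bits x \<le> sum_list (map int_bits (shipment_data t I))"
    using assms by (intro member_le_sum_list) auto
  then have "(2::int) ^ int_bits x \<le> 2 ^ shipment_size t I"
    by (intro power_increasing) (auto simp: shipment_size_def)
  then show ?thesis using less_power_int_bits[of x] by linarith
qed

lemma nth_shipment_input:
  shows "j < t \<Longrightarrow> shipment_input t I ! (1 + j) = int (items I j)"
    and "k < vessels I \<Longrightarrow> shipment_input t I ! (1 + t + k) = int (capacity I k)"
    and "j < t \<Longrightarrow> k < vessels I \<Longrightarrow>
      shipment_input t I ! (1 + t + vessels I + j * vessels I + k) = price I j k"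
    and "length (shipment_input t I) = 1 + t + vessels I + t * vessels I"
proof -
  show "length (shipment_input t I) = 1 + t + vessels I + t * vessels I"
    by (simp add: shipment_input_def shipment_data_def length_table)
  show "j < t \<Longrightarrow> shipment_input t I ! (1 + j) = int (items I j)"
    "k < vessels I \<Longrightarrow> shipment_input t I ! (1 + t + k) = int (capacity I k)"
    by (simp_all add: shipment_input_def shipment_data_def nth_append)
  assume jk: "j < t" "k < vessels I"
  have "j * vessels I + k < Suc j * vessels I" using jk by simp
  also have "\<dots> \<le> t * vessels I" using jk by (intro mult_le_mono1) simp
  finally have "table t (vessels I) (price I) ! (j * vessels I + k) = price I j k"
    using jk by (simp add: nth_table)
  then show "shipment_input t I ! (1 + t + vessels I + j * vessels I + k) = price I j k"
    by (simp add: shipment_input_def shipment_data_def nth_append add.assoc)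
qed

lemma snd_init_state: "i < length xs \<Longrightarrow> snd (init_state xs) (int i) = xs ! i"
  by (simp add: init_state_def)

lemma bounded_init_state:
  assumes "\<And>x. x \<in> set xs \<Longrightarrow> \<bar>x\<bar> < 2 ^ S"
  shows "bounded_state S (init_state xs)"
  using assms by (auto simp: bounded_state_def init_state_def nat_less_iff)

theorem corollary2p5:
  fixes t :: nat and w :: "nat \<Rightarrow> nat"
  assumes "\<forall>j<t. 0 < w j"
  shows "poly_time_solvable (shipment_input t) (shipment_size t) (shipment_answer t w)"
proof -
  define P where "P I = nat (prox t w (vessels I))" for I :: shipment
  define M where "M I = (2 * P I + 2) * (vessels I + 1)" for I
  \<comment> \<open>\<open>Y\<close> collects the polynomial quantities that have to be stored; by
    \<open>y < 2 ^ y\<close> it is more than enough as a number of bits. Costs are at most such a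
    quantity times \<open>A * A\<close>, where \<open>A = 2 ^ shipment_size t I\<close> exceeds all
    numbers in the data, so \<open>S\<close> adds twice the size.\<close>
  define Y where "Y I = (vessels I + 1) * (t + 1) * (P I + 2) + M I ^ t + M I + vessels I + t + 4" for I
  define S where "S I = 2 * shipment_size t I + Y I" for I
  \<comment> \<open>Each number of items is below \<open>2 ^ shipment_size t I\<close>, and
    \<open>t < 2 ^ t\<close>; so their total is below \<open>2 ^ L I\<close>.\<close>
  define L where "L I = shipment_size t I + t" for I
  let ?R = "\<lambda>I. 1 + ((2 + M I ^ t * 4) + (1 + (2 + vessels I * ((2 + M I ^ t * (4 + M I ^ t * 7 + 2)) + 2)))
     + (1 + (1 + (1 + (1 + vessels I * (1 + (1 + (1 + (1 + (2 + t * (2 + 2)))))))))))"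
  let ?T = "\<lambda>I. (6 + ((1 + L I * 2) + ((1 + L I * (1 + ?R I)) + (1 + ((2 + t * vessels I * 3) + 1)))))
    * (prog_weight (shipment_prog t w) * (S I + 1))"
  have v: "polynomially_bounded (shipment_size t) vessels"
    by (intro polynomially_bounded_le) (simp add: shipment_size_def)
  have sz: "polynomially_bounded (shipment_size t) (shipment_size t)"
    by (intro polynomially_bounded_le) simp
  have "polynomially_bounded (shipment_size t) P"
    unfolding P_def[abs_def] by (intro polynomially_bounded_prox v)
  note pb = polynomially_bounded_intros v sz this
  have "polynomially_bounded (shipment_size t) M" unfolding M_def[abs_def] by (intro pb)
  note pb = pb this
  have "polynomially_bounded (shipment_size t) S" "polynomially_bounded (shipment_size t) L"
    unfolding S_def[abs_def] Y_def[abs_def] L_def[abs_def] by (intro pb)+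
  note pb = pb this
  have "polynomially_bounded (shipment_size t) ?T" by (intro pb)
  then obtain q where q: "\<And>I. ?T I \<le> poly q (shipment_size t I)"
    unfolding polynomially_bounded_def by blast
  have "\<exists>T s ys. exec (shipment_prog t w) (init_state (shipment_input t I)) T s \<and>
      T \<le> poly q (shipment_size t I) \<and> has_output s ys \<and> shipment_answer t w I ys" for I
  proof -
    let ?v = "vessels I" and ?n = "shipment_size t I" and ?s = "init_state (shipment_input t I)"
    define A where "A = (2::nat) ^ ?n"
    have P: "int (P I) = prox t w ?v" using prox_nonneg by (simp add: P_def)
    have data: "\<bar>x\<bar> < int A" if "x \<in> set (shipment_data t I)" for x
      using less_power_size[OF that] by (simp add: A_def)
    have items: "items I j < A" if "j < t" for j
      using data[of "int (items I j)"] that by (auto simp: shipment_data_def)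
    have prices: "\<bar>price I j k\<bar> < int A" if "j < t" "k < ?v" for j k
      using that by (intro data) (force simp: shipment_data_def table_def)
    have A1: "1 \<le> A" by (simp add: A_def)
    have YS: "y * (A * A) < 2 ^ S I" if "y \<le> Y I" for y
    proof -
      have "y < 2 ^ Y I" using that less_exp[of "Y I"] by linarith
      then have "y * (A * A) < 2 ^ Y I * (A * A)" using A1 by (intro mult_strict_right_mono) auto
      also have "\<dots> = 2 ^ S I" by (simp add: S_def A_def power_add mult_2)
      finally show ?thesis .
    qed
    have AA: "1 \<le> A * A" "A \<le> A * A" using A1 by simp_all
    have YS1: "y < 2 ^ S I" if "y \<le> Y I" for y
      using YS[OF that] mult_le_mono2[OF AA(1), of y] by linarith
    have AP: "2 * A + P I \<le> A * (P I + 2)" using A1 by simp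
    have Y1: "(?v + 1) * (t + 1) * (P I + 2) \<le> Y I" by (simp add: Y_def)
    interpret machine "S I" t w I "P I" "M I" A
    proof
      show "items I j \<le> A" if "j < t" for j using items[OF that] by simp
      show "\<bar>price I j k\<bar> \<le> int A" if "j < t" "k < ?v" for j k using prices[OF that] by simp
      show "2 * ?v * P I + 1 < M I" "2 * P I < M I" by (simp_all add: M_def)
      show "M I ^ t + ?v + t + 2 < 2 ^ S I" by (intro YS1) (simp add: Y_def)
      have "(?v + 1) * (t * (A * (2 * A + P I))) \<le> (?v + 1) * ((t + 1) * (A * (A * (P I + 2))))"
        using AP by (intro mult_le_mono order_refl) auto
      also have "\<dots> = ((?v + 1) * (t + 1) * (P I + 2)) * (A * A)" by (simp only: mult_ac)
      also have "\<dots> < 2 ^ S I" by (intro YS Y1)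
      finally show "(?v + 1) * (t * (A * (2 * A + P I))) < 2 ^ S I" .
      have "2 * A + P I \<le> (P I + 2) * (A * A)"
        using AP mult_le_mono2[OF AA(2), of "P I + 2"] by (simp only: mult.commute[of A "P I + 2"])
      also have "\<dots> \<le> ((?v + 1) * (t + 1) * (P I + 2)) * (A * A)" by (intro mult_le_mono1) simp
      also have "\<dots> < 2 ^ S I" by (intro YS Y1)
      finally show "2 * A + P I < 2 ^ S I" .
    qed
    have input: "input ?s"
      unfolding input_def
    proof (intro conjI allI impI)
      note init = snd_init_state[of _ "shipment_input t I", unfolded nth_shipment_input(4)]
      show "snd ?s (1 + int j) = int (items I j)" if "j < t" for j
        using init[of "1 + j"] nth_shipment_input(1)[OF that] that by simp
      show "snd ?s (1 + int t + int k) = int (capacity I k)" if "k < ?v" for k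
        using init[of "1 + t + k"] nth_shipment_input(2)[OF that, of t] that by (simp add: add.assoc)
      show "snd ?s (1 + int t + int ?v + int j * int ?v + int k) = price I j k" if "j < t" "k < ?v" for j k
      proof -
        have "j * ?v + k < Suc j * ?v" using that by simp
        also have "\<dots> \<le> t * ?v" using that by (intro mult_le_mono1) simp
        finally show ?thesis
          using init[of "1 + t + ?v + j * ?v + k"] nth_shipment_input(3)[OF that] by (simp add: add.assoc)
      qed
    qed
    have "wp (S I) (shipment_prog t w) (total_time (L I))
      (\<lambda>s. \<exists>ys. has_output s ys \<and> shipment_answer t w I ys) ?s"
    proof (rule wp_shipment[OF _ P M_def _ input])
      show "0 < w j" if "j < t" for j using assms that by simp
      show "M I < 2 ^ S I" by (intro YS1) (simp add: Y_def)
      show "snd ?s 0 = int ?v" using snd_init_state[of 0 "shipment_input t I"] by (simp add: shipment_input_def)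
      show "snd ?s (adr 0 q) = 0" for q using adr_neg[of 0 q] by (simp add: init_state_def not_le[symmetric] del: adr_neg)
      have "(\<Sum>j<t. items I j) \<le> (\<Sum>j<t. A)" using items by (intro sum_mono) (auto simp: less_imp_le)
      also have "\<dots> = t * A" by simp
      also have "\<dots> < 2 ^ t * A" using A1 by (intro mult_strict_right_mono less_exp) auto
      finally show "(\<Sum>j<t. items I j) < 2 ^ L I" by (simp add: L_def A_def power_add mult.commute)
      show "L I < S I" by (simp add: L_def S_def Y_def)
      show "t * ?v < 2 ^ S I"
      proof (intro YS1 order_trans[OF _ Y1])
        have "t * ?v \<le> (?v + 1) * (t + 1) * 1" by simp
        also have "\<dots> \<le> (?v + 1) * (t + 1) * (P I + 2)" by (intro mult_le_mono2) simp
        finally show "t * ?v \<le> (?v + 1) * (t + 1) * (P I + 2)" .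
      qed
    qed
    then obtain n s ys where run: "n \<le> total_time (L I)" "runs (S I) (shipment_prog t w) ?s n s"
      "has_output s ys" "shipment_answer t w I ys" unfolding wp_def by blast
    have "bounded_state (S I) ?s"
    proof (rule bounded_init_state)
      fix x assume "x \<in> set (shipment_input t I)"
      then consider "x = int ?v" | "x \<in> set (shipment_data t I)" by (auto simp: shipment_input_def)
      then show "\<bar>x\<bar> < 2 ^ S I"
      proof cases
        case 1
        have "?v < 2 ^ S I" by (intro YS1) (simp add: Y_def)
        then show ?thesis using 1 by simp
      next
        case 2
        have "\<bar>x\<bar> < 2 ^ ?n" by (rule less_power_size[OF 2])
        also have "\<dots> \<le> 2 ^ S I" by (intro power_increasing) (auto simp: S_def)
        finally show ?thesis .
      qed
    qed
    then obtain T where T: "exec (shipment_prog t w) ?s T s" "T \<le> n * (prog_weight (shipment_prog t w) * (S I + 1))"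
      using runs_exec[OF run(2)] by blast
    have "n * (prog_weight (shipment_prog t w) * (S I + 1)) \<le> total_time (L I) * (prog_weight (shipment_prog t w) * (S I + 1))"
      using run(1) by (rule mult_le_mono1)
    also have "\<dots> = ?T I" unfolding total_time_def refine_time_def ..
    also have "\<dots> \<le> poly q ?n" by (rule q)
    finally show ?thesis using T run by (meson order_trans)
  qed
  then show ?thesis unfolding poly_time_solvable_def by blast
qed

end
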